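(* Let $n\ge1$ be an integer and let $r\in[0,\infty)$. Then $$W^{r,2}(\mathbb{R}^n)=L^2(\mathbb{R}^n)\cap\widetilde{H}^r(\mathbb{R}^n).$$ Moreover, for any $m\in\mathbb{N}$ and $s\ge0$ such that $r=m+s$, $$W^{r,2}(\mathbb{R}^n)=L^2(\mathbb{R}^n)\cap X^{m,s}.$$
   Context: $\mathbb{N}$ contains $0$. $|\cdot|$ is the Euclidean norm on $\mathbb{R}^n$, and $\lfloor r\rfloor$ is the integer part of $r$. For a multi-index $\alpha\in\mathbb{N}^n$, $|\alpha|=\alpha_1+\cdots+\alpha_n$ and $\partial^\alpha$ is the corresponding distributional derivative. $\mathcal{D}'(\mathbb{R}^n)$ is the space of distributions and $\mathcal{S}'(\mathbb{R}^n)$ the space of tempered distributions on $\mathbb{R}^n$. The Fourier transform of $v\in L^1(\mathbb{R}^n)$ is $\hat v(\xi)=\int_{\mathbb{R}^n}v(x)e^{-ix\cdot\xi}\,dx$, extended as usual to $\mathcal{S}'(\mathbb{R}^n)$. Sobolev spaces: for $r\in\mathbb{N}$, $W^{r,2}(\mathbb{R}^n)$ is the space of $v\in L^2(\mathbb{R}^n)$ with $\partial^\alpha v\in L^2(\mathbb{R}^n)$ for all $|\alpha|\le r$. For $r\in(0,\infty)\setminus\mathbb{N}$, $W^{r,2}(\mathbb{R}^n)$ is the space of (equivalence classes of) functions $v\in W^{\lfloor r\rfloor,2}(\mathbb{R}^n)$ such that $$\sum_{|\alpha|=\lfloor r\rfloor}\int_{\mathbb{R}^n\times\mathbb{R}^n}\frac{|\partial^\alpha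 v(x)-\partial^\alpha v(y)|^2}{|x-y|^{n+2(r-\lfloor r\rfloor)}}\,dx\,dy<\infty.$$ For $t\ge0$, $$\widetilde{H}^t(\mathbb{R}^n)=\Bigl\{v\in\mathcal{S}'(\mathbb{R}^n) : \hat v\in L^1_{\mathrm{loc}}(\mathbb{R}^n),\ \int_{\mathbb{R}^n}|\xi|^{2t}|\hat v(\xi)|^2\,d\xi<\infty\Bigr\}.$$ For $m\in\mathbb{N}$ and $s\ge0$, the Beppo-Levi space is $$X^{m,s}=\bigl\{v\in\mathcal{D}'(\mathbb{R}^n) : \forall\alpha\in\mathbb{N}^n \text{ with } |\alpha|=m,\ \partial^\alpha v\in\widetilde{H}^s(\mathbb{R}^n)\bigr\}.$$ *)

theory Defs
  imports "HOL-Analysis.Analysis"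
begin

text \<open>Functions and distributions are complex valued. All function spaces are realised as subsets of
  \<open>distributions\<close>, where functions that agree almost everywhere are identified.\<close>

section \<open>Multi-indices and smooth functions\<close>

definition mi_order :: "nat ^ 'n::finite \<Rightarrow> nat" where
  "mi_order \<alpha> = (\<Sum>i\<in>UNIV. \<alpha> $ i)"

definition mi_monomial :: "nat ^ 'n::finite \<Rightarrow> real ^ 'n \<Rightarrow> real" where
  "mi_monomial \<beta> x = (\<Prod>i\<in>UNIV. (x $ i) ^ (\<beta> $ i))"

definition partial :: "'n::finite \<Rightarrow> (real ^ 'n \<Rightarrow> complex) \<Rightarrow> real ^ 'n \<Rightarrow> complex" where
  "partial i f x = vector_derivative (\<lambda>t::real. f (x + t *\<^sub>R axis i 1)) (at 0)"

text \<open>An index type of class \<open>finite\<close> carries no canonical order, so an enumeration of the coordinates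
  is chosen. By symmetry of mixed derivatives the choice does not affect \<open>\<partial>\<^sup>\<alpha>\<close> on smooth functions,
  the only functions to which it is applied.\<close>

definition coords :: "'n::finite list" where
  "coords = (SOME xs. distinct xs \<and> set xs = UNIV)"

definition mi_partial :: "nat ^ 'n::finite \<Rightarrow> (real ^ 'n \<Rightarrow> complex) \<Rightarrow> real ^ 'n \<Rightarrow> complex" where
  "mi_partial \<alpha> = foldr (\<lambda>i. partial i ^^ (\<alpha> $ i)) coords"

fun C_k :: "nat \<Rightarrow> (real ^ 'n::finite \<Rightarrow> complex) \<Rightarrow> bool" where
  "C_k 0 f \<longleftrightarrow> continuous_on UNIV f"
| "C_k (Suc k) f \<longleftrightarrow> (\<forall>x. f differentiable (at x)) \<and> (\<forall>i. C_k k (partial i f))"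

definition smooth :: "(real ^ 'n::finite \<Rightarrow> complex) \<Rightarrow> bool" where
  "smooth f \<longleftrightarrow> (\<forall>k. C_k k f)"

text \<open>Sums over multi-indices of bounded order are genuine finite sums.\<close>

lemma finite_mi_order_le: "finite {\<alpha> :: nat ^ 'n::finite. mi_order \<alpha> \<le> k}"
proof (rule finite_subset)
  show "{\<alpha> :: nat ^ 'n. mi_order \<alpha> \<le> k} \<subseteq> vec_lambda ` (Pi\<^sub>E UNIV (\<lambda>_. {..k}))"
  proof
    fix \<alpha> :: "nat ^ 'n" assume "\<alpha> \<in> {\<alpha>. mi_order \<alpha> \<le> k}"
    then have "\<alpha> $ i \<le> k" for i
      using member_le_sum[of i UNIV "\<lambda>i. \<alpha> $ i"] by (auto simp: mi_order_def intro: order_trans)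
    then show "\<alpha> \<in> vec_lambda ` (Pi\<^sub>E UNIV (\<lambda>_. {..k}))"
      by (intro image_eqI[of _ _ "vec_nth \<alpha>"]) auto
  qed
  show "finite (vec_lambda ` (Pi\<^sub>E (UNIV :: 'n set) (\<lambda>_. {..k})))"
    by (intro finite_imageI finite_PiE) auto
qed

lemma finite_mi_order_eq: "finite {\<alpha> :: nat ^ 'n::finite. mi_order \<alpha> = k}"
  by (rule finite_subset[OF _ finite_mi_order_le[of k]]) auto

section \<open>Distributions\<close>

definition test_functions :: "(real ^ 'n::finite \<Rightarrow> complex) set" where
  "test_functions = {\<phi>. smooth \<phi> \<and> compact (closure {x. \<phi> x \<noteq> 0})}"

definition schwartz_functions :: "(real ^ 'n::finite \<Rightarrow> complex) set" where
  "schwartz_functions =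
     {\<phi>. smooth \<phi> \<and> (\<forall>\<alpha> \<beta>. bounded (range (\<lambda>x. mi_monomial \<beta> x *\<^sub>R mi_partial \<alpha> \<phi> x)))}"

text \<open>Functionals on a space of functions are extensional (\<open>undefined\<close> outside that space), so that
  equality of functionals is equality on the space.\<close>

type_synonym 'n functional = "(real ^ 'n \<Rightarrow> complex) \<Rightarrow> complex"

definition linear_functionals :: "(real ^ 'n::finite \<Rightarrow> complex) set \<Rightarrow> 'n functional set" where
  "linear_functionals F =
     {T \<in> extensional F. \<forall>\<phi>\<in>F. \<forall>\<psi>\<in>F. \<forall>a b. T (\<lambda>x. a * \<phi> x + b * \<psi> x) = a * T \<phi> + b * T \<psi>}"

text \<open>Continuity of functionals on both spaces is expressed by the usual seminorm estimates.\<close>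

definition distributions :: "'n::finite functional set" where
  "distributions = {v \<in> linear_functionals test_functions.
     \<forall>K. compact K \<longrightarrow> (\<exists>C N. \<forall>\<phi>\<in>test_functions. closure {x. \<phi> x \<noteq> 0} \<subseteq> K \<longrightarrow>
       cmod (v \<phi>) \<le> C * (\<Sum>\<alpha> | mi_order \<alpha> \<le> N. SUP x. cmod (mi_partial \<alpha> \<phi> x)))}"

definition tempered_distributions :: "'n::finite functional set" where
  "tempered_distributions = {T \<in> linear_functionals schwartz_functions.
     \<exists>C N. \<forall>\<phi>\<in>schwartz_functions. cmod (T \<phi>) \<le>
       C * (\<Sum>\<alpha> | mi_order \<alpha> \<le> N. \<Sum>\<beta> | mi_order \<beta> \<le> N.
              SUP x. cmod (mi_monomial \<beta> x *\<^sub>R mi_partial \<alpha> \<phi> x))}"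

definition dist_deriv :: "nat ^ 'n::finite \<Rightarrow> 'n functional \<Rightarrow> 'n functional" where
  "dist_deriv \<alpha> v = (\<lambda>\<phi>\<in>test_functions. (-1) ^ mi_order \<alpha> * v (mi_partial \<alpha> \<phi>))"

definition regular_dist :: "(real ^ 'n::finite \<Rightarrow> complex) \<Rightarrow> 'n functional" where
  "regular_dist f = (\<lambda>\<phi>\<in>test_functions. \<integral>x. f x * \<phi> x \<partial>lborel)"

text \<open>The inclusion of tempered distributions into distributions is restriction of functionals.\<close>

definition tempered_to_dist :: "'n::finite functional \<Rightarrow> 'n functional" where
  "tempered_to_dist T = restrict T test_functions"

definition fourier :: "(real ^ 'n::finite \<Rightarrow> complex) \<Rightarrow> real ^ 'n \<Rightarrow> complex" where
  "fourier f \<xi> = (\<integral>x. f x * exp (- (\<i> * of_real (x \<bullet> \<xi>))) \<partial>lborel)"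

definition fourier_tempered :: "'n::finite functional \<Rightarrow> 'n functional" where
  "fourier_tempered T = (\<lambda>\<phi>\<in>schwartz_functions. T (fourier \<phi>))"

section \<open>Function spaces\<close>

text \<open>Every Lebesgue class has a Borel representative, so Borel functions suffice.\<close>

definition square_integrable :: "(real ^ 'n::finite \<Rightarrow> complex) \<Rightarrow> bool" where
  "square_integrable f \<longleftrightarrow>
     f \<in> borel_measurable borel \<and> (\<integral>\<^sup>+x. ennreal ((cmod (f x))\<^sup>2) \<partial>lborel) < \<infinity>"

definition locally_integrable :: "(real ^ 'n::finite \<Rightarrow> complex) \<Rightarrow> bool" where
  "locally_integrable f \<longleftrightarrow>
     f \<in> borel_measurable borel \<and> (\<forall>K. compact K \<longrightarrow> set_integrable lborel K f)"

definition L2_space :: "'n::finite functional set" where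
  "L2_space = regular_dist ` {f. square_integrable f}"

definition sobolev_nat :: "nat \<Rightarrow> 'n::finite functional set" where
  "sobolev_nat k = {v \<in> L2_space. \<forall>\<alpha>. mi_order \<alpha> \<le> k \<longrightarrow> dist_deriv \<alpha> v \<in> L2_space}"

definition sobolev_frac :: "real \<Rightarrow> 'n::finite functional set" where
  "sobolev_frac r = {v \<in> sobolev_nat (nat \<lfloor>r\<rfloor>).
     \<exists>g :: nat ^ 'n \<Rightarrow> real ^ 'n \<Rightarrow> complex.
       (\<forall>\<alpha>. mi_order \<alpha> = nat \<lfloor>r\<rfloor> \<longrightarrow>
              square_integrable (g \<alpha>) \<and> dist_deriv \<alpha> v = regular_dist (g \<alpha>)) \<and>
       (\<Sum>\<alpha> | mi_order \<alpha> = nat \<lfloor>r\<rfloor>.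
          \<integral>\<^sup>+(x, y). ennreal ((cmod (g \<alpha> x - g \<alpha> y))\<^sup>2
              / norm (x - y) powr (real CARD('n) + 2 * (r - of_int \<lfloor>r\<rfloor>)))
            \<partial>(lborel \<Otimes>\<^sub>M lborel)) < \<infinity>}"

definition sobolev :: "real \<Rightarrow> 'n::finite functional set" where
  "sobolev r = (if r \<in> \<nat> then sobolev_nat (nat \<lfloor>r\<rfloor>) else sobolev_frac r)"

text \<open>That the Fourier transform is a locally integrable function is an identity of distributions, hence
  tested against \<open>test_functions\<close> only. The value \<open>0 powr 0 = 0\<close> matters only on a null set.\<close>

definition H_tilde :: "real \<Rightarrow> 'n::finite functional set" where
  "H_tilde t = tempered_to_dist ` {T \<in> tempered_distributions.
     \<exists>g. locally_integrable g \<and> tempered_to_dist (fourier_tempered T) = regular_dist g \<and>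
       (\<integral>\<^sup>+\<xi>. ennreal (norm \<xi> powr (2 * t) * (cmod (g \<xi>))\<^sup>2) \<partial>lborel) < \<infinity>}"

definition beppo_levi :: "nat \<Rightarrow> real \<Rightarrow> 'n::finite functional set" where
  "beppo_levi m s = {v \<in> distributions. \<forall>\<alpha>. mi_order \<alpha> = m \<longrightarrow> dist_deriv \<alpha> v \<in> H_tilde s}"

end

theory Submission
  imports Defs "HOL-Probability.Probability"
begin

text \<open>
  On \<open>L\<^sup>2\<close> every space in the theorem is cut out by the single condition
  \<open>\<integral> \<bar>\<xi>\<bar>\<^sup>2\<^sup>r \<bar>F v(\<xi>)\<bar>\<^sup>2 d\<xi> < \<infinity>\<close>. The transform of \<open>v \<in> L\<^sup>2\<close>, written \<open>F v\<close>, is characterised by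
  \<open>\<integral> v F \<phi> = \<integral> F v \<phi>\<close> for Schwartz \<open>\<phi>\<close>; a Gaussian damping argument bounds it in norm, and applying \<open>F\<close>
  twice gives \<open>(2\<pi>)\<^sup>n v(-x)\<close>, so the bound is an equality (Plancherel). A tempered distribution is determined by
  its values on test functions, hence \<open>\<partial>\<^sup>\<alpha> v\<close> has transform \<open>(\<i>\<xi>)\<^sup>\<alpha>\<cdot>F v\<close> in each of the definitions, and
  \<open>\<Sum> \<bar>\<xi>\<^sup>\<alpha>\<bar>\<^sup>2\<close> over \<open>\<bar>\<alpha>\<bar> = m\<close> is comparable with \<open>\<bar>\<xi>\<bar>\<^sup>2\<^sup>m\<close>. For the fractional part, Plancherel applied to
  \<open>v(\<cdot> + z) - v\<close> turns the double integral into \<open>\<integral> \<bar>F v(\<xi>)\<bar>\<^sup>2 c(\<xi>) d\<xi>\<close> with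
  \<open>c(\<xi>) = \<integral> \<bar>z\<bar>\<^sup>-\<^sup>n\<^sup>-\<^sup>2\<^sup>\<sigma> \<bar>exp (\<i>z\<cdot>\<xi>) - 1\<bar>\<^sup>2 dz\<close>, which by scaling is comparable with \<open>\<bar>\<xi>\<bar>\<^sup>2\<^sup>\<sigma>\<close>.
\<close>

section \<open>Partial derivatives of smooth functions\<close>

text \<open>Elements of the spaces are functionals on test functions, and \<open>H_tilde\<close>
  only asserts that some tempered functional restricts to the given one. The transform of that
  functional is evaluated on \<open>fourier \<phi>\<close>, which is Schwartz but in general not
  compactly supported, so an identity known on test functions says nothing about it directly;
  density closes this gap. For the same reason the transform on L^2 is kept as a relation tested
  against all Schwartz functions: it matches the tempered transform by construction and respects
  changes on null sets. Membership in L^2 is essential: the weight |xi|^(2*r) degenerates at low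
  frequencies, and only square integrability of the transform recovers the lower order derivatives
  there. The Gaussian serves as regulariser because its transform is again an explicit kernel of
  known mass, which is the origin of the constant (2*pi)^n. Once each space is a condition on the
  same weighted integral, the order m and the exponent s enter only through m + s, and the claim on
  the homogeneous space is the case m = 0.\<close>

lemma partial_eqI:
  assumes "(f has_derivative D) (at x)"
  shows "partial i f x = D (axis i 1)"
proof -
  have "((\<lambda>t::real. f (x + t *\<^sub>R axis i 1)) has_vector_derivative D (axis i 1)) (at 0)"
    unfolding has_vector_derivative_def
    by (rule has_derivative_eq_rhs, rule has_derivative_compose[of "\<lambda>t. x + t *\<^sub>R axis i 1" _ _ _ f D])
      (auto intro!: derivative_eq_intros assms
        simp: linear_cmul[OF bounded_linear.linear[OF has_derivative_bounded_linear[OF assms]]])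
  then show ?thesis
    unfolding partial_def by (rule vector_derivative_at)
qed

lemma has_derivative_partials:
  fixes f :: "real ^ 'n::finite \<Rightarrow> complex"
  assumes "f differentiable (at x)"
  shows "(f has_derivative (\<lambda>h. \<Sum>i\<in>UNIV. h $ i *\<^sub>R partial i f x)) (at x)"
proof -
  obtain D where D: "(f has_derivative D) (at x)"
    using assms unfolding differentiable_def by blast
  have lin: "linear D"
    using D has_derivative_bounded_linear bounded_linear.linear by blast
  have "D h = (\<Sum>i\<in>UNIV. h $ i *\<^sub>R partial i f x)" for h
  proof -
    have "D h = D (\<Sum>i\<in>UNIV. h $ i *\<^sub>R axis i 1)"
      using basis_expansion[of h] by (simp add: scalar_mult_eq_scaleR)
    also have "\<dots> = (\<Sum>i\<in>UNIV. h $ i *\<^sub>R partial i f x)"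
      by (simp add: linear_sum[OF lin] linear_cmul[OF lin] partial_eqI[OF D])
    finally show ?thesis .
  qed
  then have "D = (\<lambda>h. \<Sum>i\<in>UNIV. h $ i *\<^sub>R partial i f x)" by auto
  with D show ?thesis by simp
qed

lemma has_vector_derivative_line:
  fixes f :: "real ^ 'n::finite \<Rightarrow> complex"
  assumes "f differentiable (at (x + t *\<^sub>R axis i 1))"
  shows "((\<lambda>t. f (x + t *\<^sub>R axis i 1)) has_vector_derivative partial i f (x + t *\<^sub>R axis i 1))
    (at t within S)"
proof -
  obtain D where D: "(f has_derivative D) (at (x + t *\<^sub>R axis i 1))"
    using assms unfolding differentiable_def by blast
  have "((\<lambda>t. f (x + t *\<^sub>R axis i 1)) has_derivative (\<lambda>h. D (h *\<^sub>R axis i 1))) (at t within S)"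
    by (rule has_derivative_compose[of "\<lambda>t. x + t *\<^sub>R axis i 1" _ _ _ f D])
      (auto intro!: derivative_eq_intros D)
  then show ?thesis
    unfolding has_vector_derivative_def partial_eqI[OF D]
    by (simp add: linear_cmul[OF bounded_linear.linear[OF has_derivative_bounded_linear[OF D]]])
qed

lemma C_k_Suc_imp: "C_k (Suc k) f \<Longrightarrow> C_k k f"
proof (induction k arbitrary: f)
  case 0
  then show ?case
    by (auto intro!: differentiable_imp_continuous_on simp: differentiable_on_def
        intro: differentiable_at_withinI)
next
  case (Suc k)
  then show ?case by simp
qed

lemma smooth_differentiable: "smooth f \<Longrightarrow> f differentiable (at x)"
  unfolding smooth_def by (metis C_k.simps(2))

lemma smooth_partial: "smooth f \<Longrightarrow> smooth (partial i f)"
  unfolding smooth_def by (metis C_k.simps(2))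

lemma smooth_continuous: "smooth f \<Longrightarrow> continuous_on S f"
  unfolding smooth_def by (metis C_k.simps(1) continuous_on_subset subset_UNIV)

text \<open>Smoothness is a greatest fixed point: a family of differentiable functions closed under
  partial derivatives consists of smooth functions. This spares an induction on the order whenever
  such a family can be written down.\<close>

lemma smooth_coinduct:
  assumes "f \<in> X"
    and "\<And>f x. f \<in> X \<Longrightarrow> f differentiable (at x)"
    and "\<And>f i. f \<in> X \<Longrightarrow> partial i f \<in> X"
  shows "smooth f"
proof -
  have "C_k k f" if "f \<in> X" for k f
    using that
  proof (induction k arbitrary: f)
    case 0
    then show ?case
      using assms(2) by (auto intro!: differentiable_imp_continuous_on simp: differentiable_on_def
        intro: differentiable_at_withinI)
  next
    case (Suc k)
    then show ?case using assms(2,3) by simp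
  qed
  with assms(1) show ?thesis by (simp add: smooth_def)
qed

lemma partial_add:
  assumes "f differentiable (at x)" "g differentiable (at x)"
  shows "partial i (\<lambda>x. f x + g x) x = partial i f x + partial i g x"
proof -
  obtain D E where D: "(f has_derivative D) (at x)" and E: "(g has_derivative E) (at x)"
    using assms unfolding differentiable_def by blast
  show ?thesis
    unfolding partial_eqI[OF has_derivative_add[OF D E]] partial_eqI[OF D] partial_eqI[OF E] ..
qed

lemma partial_mult:
  assumes "f differentiable (at x)" "g differentiable (at x)"
  shows "partial i (\<lambda>x. f x * g x) x = f x * partial i g x + partial i f x * g x"
proof -
  obtain D E where D: "(f has_derivative D) (at x)" and E: "(g has_derivative E) (at x)"
    using assms unfolding differentiable_def by blast
  show ?thesis
    unfolding partial_eqI[OF has_derivative_mult[OF D E]] partial_eqI[OF D] partial_eqI[OF E] ..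
qed

lemma partial_const [simp]: "partial i (\<lambda>x. c) = (\<lambda>x. 0)"
  by (rule ext, subst partial_eqI[OF has_derivative_const]) simp

lemma partial_cmult:
  assumes "f differentiable (at x)"
  shows "partial i (\<lambda>x. c * f x) x = c * partial i f x"
  using partial_mult[of "\<lambda>x. c" x f i] assms by simp

lemma partial_coord: "partial i (\<lambda>x. complex_of_real (x $ j)) = (\<lambda>x. if i = j then 1 else 0)"
proof
  fix x :: "real ^ 'a"
  have "((\<lambda>x. complex_of_real (x $ j)) has_derivative (\<lambda>h. complex_of_real (h $ j))) (at x)"
    by (intro derivative_eq_intros bounded_linear.has_derivative[OF bounded_linear_vec_nth]
        bounded_linear.has_derivative[OF bounded_linear_of_real]) auto
  from partial_eqI[OF this, of i]
  show "partial i (\<lambda>x. complex_of_real (x $ j)) x = (if i = j then 1 else 0)"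
    by (auto simp: axis_def)
qed

lemma C_k_add: "C_k k f \<Longrightarrow> C_k k g \<Longrightarrow> C_k k (\<lambda>x. f x + g x)"
proof (induction k arbitrary: f g)
  case 0
  then show ?case by (simp add: continuous_on_add)
next
  case (Suc k)
  have eq: "partial i (\<lambda>x. f x + g x) = (\<lambda>x. partial i f x + partial i g x)" for i
    using Suc.prems by (auto simp: partial_add)
  have "C_k k (\<lambda>x. partial i f x + partial i g x)" for i
    by (rule Suc.IH) (use Suc.prems in auto)
  with Suc.prems show ?case
    unfolding C_k.simps(2) eq by (blast intro: differentiable_add)
qed

lemma C_k_mult: "C_k k f \<Longrightarrow> C_k k g \<Longrightarrow> C_k k (\<lambda>x. f x * g x)"
proof (induction k arbitrary: f g)
  case 0
  then show ?case by (simp add: continuous_on_mult)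
next
  case (Suc k)
  have d: "f differentiable (at x)" "g differentiable (at x)" for x
    using Suc.prems by simp_all
  have eq: "partial i (\<lambda>x. f x * g x) = (\<lambda>x. f x * partial i g x + partial i f x * g x)" for i
    by (rule ext, rule partial_mult[OF d])
  \<comment> \<open>The product rule leaves one factor undifferentiated, so the induction hypothesis
    is also needed for the functions themselves at the lower order.\<close>
  have k: "C_k k f" "C_k k g"
    by (rule C_k_Suc_imp[OF Suc.prems(1)], rule C_k_Suc_imp[OF Suc.prems(2)])
  have p: "C_k k (partial i f)" "C_k k (partial i g)" for i
    using Suc.prems by simp_all
  show ?case
    unfolding C_k.simps(2) eq
    by (intro conjI allI differentiable_mult d C_k_add Suc.IH k p)
qed

lemma smooth_add: "smooth f \<Longrightarrow> smooth g \<Longrightarrow> smooth (\<lambda>x. f x + g x)"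
  by (simp add: smooth_def C_k_add)

lemma smooth_mult: "smooth f \<Longrightarrow> smooth g \<Longrightarrow> smooth (\<lambda>x. f x * g x)"
  by (simp add: smooth_def C_k_mult)

lemma smooth_const [simp]: "smooth (\<lambda>x. c)"
  by (rule smooth_coinduct[of _ "range (\<lambda>c x. c)"]) auto

lemma smooth_cmult: "smooth f \<Longrightarrow> smooth (\<lambda>x. c * f x)"
  by (rule smooth_mult) auto

lemma smooth_lincomb: "smooth f \<Longrightarrow> smooth g \<Longrightarrow> smooth (\<lambda>x. a * f x + b * g x)"
  by (intro smooth_add smooth_cmult)

lemma smooth_coord: "smooth (\<lambda>x. complex_of_real (x $ j))"
proof -
  have "C_k k (\<lambda>x. complex_of_real (x $ j))" for k
  proof (cases k)
    case 0
    then show ?thesis by (simp add: continuous_on_of_real continuous_on_component)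
  next
    case (Suc l)
    have "C_k l (\<lambda>x::real^'a. if i = j then 1 else 0)" for i
      using smooth_const unfolding smooth_def by blast
    moreover have "(\<lambda>x. complex_of_real (x $ j)) differentiable (at x)" for x :: "real ^ 'a"
      unfolding differentiable_def
      using bounded_linear_imp_has_derivative[OF
          bounded_linear_compose[OF bounded_linear_of_real bounded_linear_vec_nth]] by blast
    ultimately show ?thesis
      using Suc by (simp add: partial_coord)
  qed
  then show ?thesis by (simp add: smooth_def)
qed

lemma smooth_prod: "finite A \<Longrightarrow> (\<And>a. a \<in> A \<Longrightarrow> smooth (f a)) \<Longrightarrow> smooth (\<lambda>x. \<Prod>a\<in>A. f a x)"
  by (induction A rule: finite_induct) (auto intro: smooth_mult)

text \<open>Symmetry of second derivatives, by differentiating the fundamental theorem of calculus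
  in the direction \<open>j\<close> under the integral sign.\<close>

lemma partial_commute:
  fixes f :: "real ^ 'n::finite \<Rightarrow> complex"
  assumes f: "smooth f"
  shows "partial i (partial j f) = partial j (partial i f)"
proof
  fix x :: "real ^ 'n"
  define p where "p s t = x + s *\<^sub>R axis i 1 + t *\<^sub>R axis j 1" for s t :: real
  have p1: "p s t = (x + t *\<^sub>R axis j 1) + s *\<^sub>R axis i 1" for s t
    by (simp add: p_def)
  have ds: "((\<lambda>s. g (p s t)) has_vector_derivative partial i g (p s t)) (at s within S)"
    if "smooth g" for g s t S
    unfolding p1 by (intro has_vector_derivative_line smooth_differentiable that)
  have dt: "((\<lambda>t. g (p s t)) has_vector_derivative partial j g (p s t)) (at t within S)"
    if "smooth g" for g s t S
    unfolding p_def by (intro has_vector_derivative_line smooth_differentiable that)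
  have cont: "continuous_on S (\<lambda>(t,s). g (p s t))" if "smooth g" for g S
    unfolding p_def split_beta
    by (intro continuous_on_compose2[OF smooth_continuous[OF that, of UNIV]] continuous_intros subset_UNIV)
  have cont1: "continuous_on S (\<lambda>s. g (p s t))" if "smooth g" for g S t
    unfolding p_def
    by (intro continuous_on_compose2[OF smooth_continuous[OF that, of UNIV]] continuous_intros subset_UNIV)
  have FTC: "((\<lambda>\<sigma>. partial i f (p \<sigma> t)) has_integral f (p s t) - f (p 0 t)) {0..s}" if "0 \<le> s" for s t
    using that by (intro fundamental_theorem_of_calculus ds f)
  have L: "((\<lambda>t. integral (cbox 0 s) (\<lambda>\<sigma>. partial i f (p \<sigma> t))) has_vector_derivative
      integral (cbox 0 s) (\<lambda>\<sigma>. partial j (partial i f) (p \<sigma> 0))) (at 0 within UNIV)" for s :: real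
    by (rule leibniz_rule_vector_derivative[where f = "\<lambda>t \<sigma>. partial i f (p \<sigma> t)"
          and fx = "\<lambda>t \<sigma>. partial j (partial i f) (p \<sigma> t)"])
      (simp_all add: dt smooth_partial f cont integrable_continuous_real cont1)
  have eq: "partial j f (p s 0) = partial j f (p 0 0) + integral {0..s} (\<lambda>\<sigma>. partial j (partial i f) (p \<sigma> 0))"
    if "0 \<le> s" for s
  proof -
    have "(\<lambda>t. integral (cbox 0 s) (\<lambda>\<sigma>. partial i f (p \<sigma> t))) = (\<lambda>t. f (p s t) - f (p 0 t))"
      using FTC[OF that] by (auto simp: integral_unique)
    from L[of s, unfolded this] have "((\<lambda>t. f (p s t) - f (p 0 t)) has_vector_derivative
        integral (cbox 0 s) (\<lambda>\<sigma>. partial j (partial i f) (p \<sigma> 0))) (at 0)" .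
    moreover have "((\<lambda>t. f (p s t) - f (p 0 t)) has_vector_derivative
        partial j f (p s 0) - partial j f (p 0 0)) (at 0)"
      by (intro derivative_intros dt f)
    ultimately have "integral (cbox 0 s) (\<lambda>\<sigma>. partial j (partial i f) (p \<sigma> 0)) =
        partial j f (p s 0) - partial j f (p 0 0)"
      by (rule vector_derivative_unique_at)
    then show ?thesis by simp
  qed
  \<comment> \<open>The identity \<open>eq\<close> holds for s \<ge> 0 only, so both sides are
    differentiated at the left end of {0..1}, where one-sided derivatives are still unique.\<close>
  have "((\<lambda>s. partial j f (p 0 0) + integral {0..s} (\<lambda>\<sigma>. partial j (partial i f) (p \<sigma> 0)))
      has_vector_derivative (0 + partial j (partial i f) (p 0 0))) (at 0 within {0..1})"
    by (intro derivative_intros integral_has_vector_derivative cont1 smooth_partial f) auto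
  then have "((\<lambda>s. partial j f (p s 0)) has_vector_derivative (0 + partial j (partial i f) (p 0 0)))
      (at 0 within {0..1})"
    by (rule has_vector_derivative_transform[rotated 2]) (simp, rule eq, simp)
  moreover have "((\<lambda>s. partial j f (p s 0)) has_vector_derivative partial i (partial j f) (p 0 0))
      (at 0 within {0..1})"
    by (intro ds smooth_partial f)
  ultimately have "0 + partial j (partial i f) (p 0 0) = partial i (partial j f) (p 0 0)"
    by (intro vector_derivative_unique_within_closed_interval[of 0 1 0]) auto
  then show "partial i (partial j f) x = partial j (partial i f) x"
    by (simp add: p_def)
qed

section \<open>Iterated partial derivatives as lists of directions\<close>

abbreviation partials :: "'n list \<Rightarrow> (real ^ 'n::finite \<Rightarrow> complex) \<Rightarrow> real ^ 'n \<Rightarrow> complex" where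
  "partials is f \<equiv> foldr partial is f"

lemma smooth_partials: "smooth f \<Longrightarrow> smooth (partials is f)"
  by (induction "is") (auto intro: smooth_partial)

lemma partials_add:
  "smooth f \<Longrightarrow> smooth g \<Longrightarrow> partials is (\<lambda>x. f x + g x) = (\<lambda>x. partials is f x + partials is g x)"
  by (induction "is") (auto simp: partial_add smooth_differentiable smooth_partials)

lemma partials_cmult: "smooth f \<Longrightarrow> partials is (\<lambda>x. c * f x) = (\<lambda>x. c * partials is f x)"
  by (induction "is") (auto simp: partial_cmult smooth_differentiable smooth_partials)

text \<open>This makes the arbitrary enumeration \<open>coords\<close> harmless: on smooth functions
  a list of directions acts only through its multiset, that is, through a multi-index.\<close>

lemma partials_cong_mset:
  fixes f :: "real ^ 'n::finite \<Rightarrow> complex"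
  assumes f: "smooth f" and "mset is = mset js"
  shows "partials is f = partials js f"
proof -
  text \<open>Truncating \<open>partial\<close> to smooth functions makes the operators commute everywhere.\<close>
  define P where "P i g = (if smooth g then partial i g else g)" for i and g :: "real ^ 'n \<Rightarrow> complex"
  have P: "foldr P ks f = partials ks f" for ks
    by (induction ks) (auto simp: P_def smooth_partials f)
  have "fold P (rev is) = fold P (rev js)"
  proof (rule fold_multiset_equiv)
    show "P x \<circ> P y = P y \<circ> P x" for x y
      by (auto simp: P_def fun_eq_iff smooth_partial partial_commute)
    show "mset (rev is) = mset (rev js)" using assms by simp
  qed
  then show ?thesis
    using P[of "is"] P[of js] by (simp add: foldr_conv_fold)
qed

lemma distinct_coords: "distinct (coords :: 'n::finite list)" and set_coords: "set (coords :: 'n list) = UNIV"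
proof -
  have "\<exists>xs :: 'n list. distinct xs \<and> set xs = UNIV"
    using finite_distinct_list[of "UNIV :: 'n set"] by auto
  then have "distinct (coords :: 'n list) \<and> set (coords :: 'n list) = UNIV"
    unfolding coords_def by (rule someI_ex)
  then show "distinct (coords :: 'n list)" "set (coords :: 'n list) = UNIV" by auto
qed

text \<open>Unrolls a multi-index into single directions, so that statements about
  \<open>mi_partial\<close> and \<open>mi_monomial\<close> become list inductions that treat one
  derivative or one coordinate at a time.\<close>

definition mi_list :: "nat ^ 'n::finite \<Rightarrow> 'n list" where
  "mi_list \<alpha> = concat (map (\<lambda>i. replicate (\<alpha> $ i) i) coords)"

lemma mi_partial_eq_partials: "mi_partial \<alpha> f = partials (mi_list \<alpha>) f"
proof -
  have "foldr (\<lambda>i. partial i ^^ (\<alpha> $ i)) xs f = partials (concat (map (\<lambda>i. replicate (\<alpha> $ i) i) xs)) f" for xs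
    by (induction xs) auto
  from this[of coords] show ?thesis
    unfolding mi_partial_def mi_list_def .
qed

lemma count_mi_list: "count (mset (mi_list \<alpha>)) i = \<alpha> $ i"
proof -
  have "count (mset (concat (map (\<lambda>i. replicate (\<alpha> $ i) i) xs))) i = (if i \<in> set xs then \<alpha> $ i else 0)"
    if "distinct xs" for xs
    using that by (induction xs) auto
  then show ?thesis
    by (simp add: mi_list_def distinct_coords set_coords)
qed

lemma partials_eq_mi_partial:
  assumes "smooth f"
  shows "partials is f = mi_partial (\<chi> i. count (mset is) i) f"
  unfolding mi_partial_eq_partials
  by (rule partials_cong_mset[OF assms]) (rule multiset_eqI, simp add: count_mi_list)

lemma length_mi_list: "length (mi_list \<alpha>) = mi_order \<alpha>"
proof -
  have "length (mi_list \<alpha>) = sum_list (map (\<lambda>i. \<alpha> $ i) coords)"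
    by (simp add: mi_list_def length_concat comp_def)
  also have "\<dots> = mi_order \<alpha>"
    by (simp add: sum_list_distinct_conv_sum_set distinct_coords set_coords mi_order_def)
  finally show ?thesis .
qed

lemma mi_monomial_eq_prod_list: "mi_monomial \<alpha> x = prod_list (map (\<lambda>i. x $ i) (mi_list \<alpha>))"
proof -
  have "prod_list (map (\<lambda>i. x $ i) (mi_list \<alpha>)) = prod_list (map (\<lambda>i. (x $ i) ^ (\<alpha> $ i)) xs)"
    if "mi_list \<alpha> = concat (map (\<lambda>i. replicate (\<alpha> $ i) i) xs)" for xs
    unfolding that by (induction xs) (auto simp: map_replicate_const prod_list_replicate)
  from this[of coords] show ?thesis
    by (simp add: mi_list_def mi_monomial_def prod.distinct_set_conv_list[OF distinct_coords, symmetric]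
        set_coords)
qed

lemma mi_partial_lincomb:
  "smooth f \<Longrightarrow> smooth g \<Longrightarrow>
    mi_partial \<alpha> (\<lambda>x. a * f x + b * g x) = (\<lambda>x. a * mi_partial \<alpha> f x + b * mi_partial \<alpha> g x)"
  by (simp add: mi_partial_eq_partials partials_add partials_cmult smooth_cmult)

section \<open>Integration on products of coordinates\<close>

lemma Basis_vec_image: "(Basis :: (real ^ 'n::finite) set) = (\<lambda>i. axis i 1) ` UNIV"
  by (auto simp: Basis_vec_def)

lemma inj_axis_1: "inj (\<lambda>i. axis i (1::real) :: real ^ 'n::finite)"
  by (auto simp: inj_on_def axis_eq_axis)

lemma the_axis_index: "(THE i. axis i (1::real) = (axis j 1 :: real ^ 'n::finite)) = j"
  by (rule the_equality) (auto simp: axis_eq_axis)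

lemma nn_integral_lborel_prod_vec:
  fixes f :: "'n::finite \<Rightarrow> real \<Rightarrow> ennreal"
  assumes [measurable]: "\<And>i. f i \<in> borel_measurable borel"
  shows "(\<integral>\<^sup>+x. (\<Prod>i\<in>UNIV. f i (x $ i)) \<partial>lborel) = (\<Prod>i\<in>UNIV. \<integral>\<^sup>+t. f i t \<partial>lborel)"
proof -
  \<comment> \<open>The factors are indexed by coordinates here but by basis vectors in the product
    formula; \<open>F\<close> reads the index back off an axis vector.\<close>
  define F where "F b = f (THE i. axis i (1::real) = (b :: real ^ 'n))" for b
  have F: "F (axis i 1) = f i" for i by (simp add: F_def the_axis_index)
  have "(\<integral>\<^sup>+x. (\<Prod>b\<in>Basis. F b (x \<bullet> b)) \<partial>lborel) = (\<Prod>b\<in>Basis. \<integral>\<^sup>+t. F b t \<partial>lborel)"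
    by (rule nn_integral_lborel_prod) (simp_all add: F_def)
  then show ?thesis
    by (simp add: Basis_vec_image prod.reindex[OF inj_axis_1] F inner_axis)
qed

lemma integral_lborel_prod_vec:
  fixes f :: "'n::finite \<Rightarrow> real \<Rightarrow> complex"
  assumes f: "\<And>i. integrable lborel (f i)"
  shows "(\<integral>x. (\<Prod>i\<in>UNIV. f i (x $ i)) \<partial>lborel) = (\<Prod>i\<in>UNIV. \<integral>t. f i t \<partial>lborel)"
proof -
  define F where "F b = f (THE i. axis i (1::real) = (b :: real ^ 'n))" for b
  have F: "F (axis i 1) = f i" for i by (simp add: F_def the_axis_index)
  have [measurable]: "F b \<in> borel_measurable borel" for b
    using borel_measurable_integrable[OF f] by (simp add: F_def)
  interpret product_sigma_finite "\<lambda>_::real ^ 'n. lborel :: real measure" ..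
  \<comment> \<open>\<open>lborel\<close> on vectors is the image of the product measure under the
    map taking g to the sum of the vectors g b times b, whose inner product with b is g b
    again.\<close>
  have "(\<integral>x. (\<Prod>b\<in>Basis. F b (x \<bullet> b)) \<partial>lborel) =
      (\<integral>g. (\<Prod>b\<in>Basis. F b ((\<Sum>c\<in>Basis. g c *\<^sub>R c) \<bullet> b)) \<partial>(\<Pi>\<^sub>M b\<in>(Basis :: (real ^ 'n) set). lborel))"
    unfolding lborel_eq[where ?'a = "real ^ 'n"] by (subst integral_distr) auto
  also have "\<dots> = (\<integral>g. (\<Prod>b\<in>Basis. F b (g b)) \<partial>(\<Pi>\<^sub>M b\<in>(Basis :: (real ^ 'n) set). lborel))"
    by (intro Bochner_Integration.integral_cong refl prod.cong arg_cong[of _ _ "F _"])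
      (simp add: inner_sum_left inner_Basis if_distrib cong: if_cong)
  also have "\<dots> = (\<Prod>b\<in>Basis. \<integral>t. F b t \<partial>lborel)"
    by (rule product_integral_prod) (simp_all add: F_def f)
  finally show ?thesis
    by (simp add: Basis_vec_image prod.reindex[OF inj_axis_1] F inner_axis)
qed

text \<open>An integrable majorant for Schwartz functions. It is a product of functions of one
  coordinate so that its integral factors, and its inverse is a polynomial so that the Schwartz
  seminorms control the quotient.\<close>

definition weight :: "real ^ 'n::finite \<Rightarrow> real" where
  "weight x = (\<Prod>i\<in>UNIV. inverse (1 + (x $ i)\<^sup>2))"

lemma weight_inverse: "inverse (weight x) = (\<Prod>i\<in>UNIV. 1 + (x $ i)\<^sup>2)"
proof -
  have "1 + (x $ i)\<^sup>2 \<noteq> 0" for i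
    using zero_le_power2[of "x $ i"] by linarith
  then have "weight x * (\<Prod>i\<in>UNIV. 1 + (x $ i)\<^sup>2) = 1"
    by (simp add: weight_def flip: prod.distrib)
  then show ?thesis by (rule inverse_unique)
qed

lemma weight_pos: "0 < weight x"
  by (auto simp: weight_def intro!: prod_pos add_pos_nonneg)

lemma weight_le_1: "weight x \<le> 1"
  unfolding weight_def by (rule prod_le_1) (auto intro!: inverse_le_1_iff[THEN iffD2])

lemma borel_measurable_weight [measurable]: "weight \<in> borel_measurable borel"
  unfolding weight_def by measurable

lemma integrable_weight: "integrable lborel (weight :: real ^ 'n::finite \<Rightarrow> real)"
proof (rule integrableI_bounded)
  have "integrable lborel (\<lambda>t::real. inverse (1 + t\<^sup>2))"
    using Sinc_Integral.integrable_inverse_1_plus_square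
    by (simp add: set_integrable_def einterval_def)
  then have fin: "(\<integral>\<^sup>+t. ennreal (inverse (1 + t\<^sup>2)) \<partial>lborel) < \<infinity>"
    by (subst (asm) integrable_iff_bounded) simp
  have "(\<integral>\<^sup>+x. ennreal (norm (weight (x :: real ^ 'n))) \<partial>lborel) =
      (\<integral>\<^sup>+x. (\<Prod>i\<in>UNIV. ennreal (inverse (1 + ((x :: real ^ 'n) $ i)\<^sup>2))) \<partial>lborel)"
    using weight_pos by (intro nn_integral_cong) (simp add: prod_ennreal weight_def abs_prod)
  also have "\<dots> = (\<Prod>i\<in>(UNIV :: 'n set). \<integral>\<^sup>+t. ennreal (inverse (1 + t\<^sup>2)) \<partial>lborel)"
    by (rule nn_integral_lborel_prod_vec) measurable
  also have "\<dots> < \<infinity>"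
    using fin by (simp add: power_less_top_ennreal)
  finally show "(\<integral>\<^sup>+x. ennreal (norm (weight (x :: real ^ 'n))) \<partial>lborel) < \<infinity>" .
qed measurable

section \<open>Schwartz functions\<close>

lemma schwartz_smooth: "\<phi> \<in> schwartz_functions \<Longrightarrow> smooth \<phi>"
  by (simp add: schwartz_functions_def)

lemma schwartz_measurable: "\<phi> \<in> schwartz_functions \<Longrightarrow> \<phi> \<in> borel_measurable borel"
  by (rule borel_measurable_continuous_onI[OF smooth_continuous[OF schwartz_smooth]])

lemma schwartz_bounded_partials:
  assumes "\<phi> \<in> schwartz_functions"
  obtains C where "\<And>x. norm (mi_monomial \<beta> x *\<^sub>R partials is \<phi> x) \<le> C"
proof -
  have "bounded (range (\<lambda>x. mi_monomial \<beta> x *\<^sub>R partials is \<phi> x))"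
    using assms unfolding partials_eq_mi_partial[OF schwartz_smooth[OF assms]]
    by (simp add: schwartz_functions_def)
  then show thesis using that by (auto simp: bounded_iff)
qed

lemma schwartz_bounded:
  assumes "\<phi> \<in> schwartz_functions"
  obtains C where "\<And>x. norm (mi_monomial \<beta> x *\<^sub>R \<phi> x) \<le> C"
  using schwartz_bounded_partials[OF assms, of \<beta> "[]"] by auto

lemma schwartzI:
  assumes "smooth \<phi>"
    and "\<And>\<beta> is. \<exists>C. \<forall>x. norm (mi_monomial \<beta> x *\<^sub>R partials is \<phi> x) \<le> C"
  shows "\<phi> \<in> schwartz_functions"
  using assms by (auto simp: schwartz_functions_def mi_partial_eq_partials bounded_iff)

text \<open>In a family closed under partial derivatives and multiplication by coordinates, every
  Schwartz seminorm of a member is the supremum norm of another member, so plain boundedness of all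
  members is enough.\<close>

lemma schwartz_coinduct:
  assumes X: "\<phi> \<in> X"
    and diff: "\<And>f x. f \<in> X \<Longrightarrow> f differentiable (at x)"
    and partial: "\<And>f i. f \<in> X \<Longrightarrow> partial i f \<in> X"
    and coord: "\<And>f j. f \<in> X \<Longrightarrow> (\<lambda>x. complex_of_real (x $ j) * f x) \<in> X"
    and bounded: "\<And>f. f \<in> X \<Longrightarrow> \<exists>C. \<forall>x. norm (f x) \<le> C"
  shows "\<phi> \<in> schwartz_functions"
proof (rule schwartzI)
  show "smooth \<phi>"
    using X diff partial by (rule smooth_coinduct)
  fix \<beta> "is"
  have "partials is \<phi> \<in> X"
    by (induction "is") (auto intro: X partial)
  then have "(\<lambda>x. complex_of_real (prod_list (map (\<lambda>j. x $ j) js)) * partials is \<phi> x) \<in> X" for js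
  proof (induction js)
    case (Cons j js)
    from coord[OF Cons.IH[OF Cons.prems], of j] show ?case by (simp add: mult.assoc)
  qed simp
  from bounded[OF this[of "mi_list \<beta>"]]
  show "\<exists>C. \<forall>x. norm (mi_monomial \<beta> x *\<^sub>R partials is \<phi> x) \<le> C"
    by (simp add: mi_monomial_eq_prod_list scaleR_conv_of_real)
qed

lemma schwartz_partial:
  assumes "\<phi> \<in> schwartz_functions"
  shows "partial i \<phi> \<in> schwartz_functions"
proof (rule schwartzI)
  show "smooth (partial i \<phi>)" using assms by (intro smooth_partial schwartz_smooth)
  show "\<exists>C. \<forall>x. norm (mi_monomial \<beta> x *\<^sub>R partials is (partial i \<phi>) x) \<le> C" for \<beta> "is"
    using schwartz_bounded_partials[OF assms, of \<beta> "is @ [i]"] by auto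
qed

lemma schwartz_mi_partial: "\<phi> \<in> schwartz_functions \<Longrightarrow> mi_partial \<alpha> \<phi> \<in> schwartz_functions"
proof -
  assume "\<phi> \<in> schwartz_functions"
  then have "partials is \<phi> \<in> schwartz_functions" for "is"
    by (induction "is") (auto intro: schwartz_partial)
  then show ?thesis by (simp add: mi_partial_eq_partials)
qed

lemma schwartz_lincomb:
  assumes "\<phi> \<in> schwartz_functions" "\<psi> \<in> schwartz_functions"
  shows "(\<lambda>x. a * \<phi> x + b * \<psi> x) \<in> schwartz_functions"
proof (rule schwartzI)
  note sm = schwartz_smooth[OF assms(1)] schwartz_smooth[OF assms(2)]
  show "smooth (\<lambda>x. a * \<phi> x + b * \<psi> x)"
    by (rule smooth_lincomb[OF sm])
  fix \<beta> :: "nat ^ 'a" and "is"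
  obtain C where C: "\<And>x. norm (mi_monomial \<beta> x *\<^sub>R partials is \<phi> x) \<le> C"
    using schwartz_bounded_partials[OF assms(1)] by blast
  obtain D where D: "\<And>x. norm (mi_monomial \<beta> x *\<^sub>R partials is \<psi> x) \<le> D"
    using schwartz_bounded_partials[OF assms(2)] by blast
  have eq: "partials is (\<lambda>x. a * \<phi> x + b * \<psi> x) = (\<lambda>x. a * partials is \<phi> x + b * partials is \<psi> x)"
    by (simp add: partials_add partials_cmult sm smooth_cmult)
  show "\<exists>C. \<forall>x. norm (mi_monomial \<beta> x *\<^sub>R partials is (\<lambda>x. a * \<phi> x + b * \<psi> x) x) \<le> C"
  proof (intro exI[of _ "norm a * C + norm b * D"] allI)
    fix x
    have "mi_monomial \<beta> x *\<^sub>R (a * partials is \<phi> x + b * partials is \<psi> x) =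
        a * (mi_monomial \<beta> x *\<^sub>R partials is \<phi> x) + b * (mi_monomial \<beta> x *\<^sub>R partials is \<psi> x)"
      by (simp add: scaleR_conv_of_real algebra_simps)
    also have "norm \<dots> \<le> norm a * C + norm b * D"
      by (intro norm_triangle_mono) (simp_all only: norm_mult mult_left_mono C D norm_ge_zero)
    finally show "norm (mi_monomial \<beta> x *\<^sub>R partials is (\<lambda>x. a * \<phi> x + b * \<psi> x) x) \<le> norm a * C + norm b * D"
      by (simp only: eq)
  qed
qed

lemma schwartz_cmult: "\<phi> \<in> schwartz_functions \<Longrightarrow> (\<lambda>x. a * \<phi> x) \<in> schwartz_functions"
  using schwartz_lincomb[of \<phi> \<phi> a 0] by simp

lemma mi_monomial_plus_axis: "mi_monomial (\<beta> + axis j 1) x = mi_monomial \<beta> x * x $ j"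
proof -
  have "mi_monomial (\<beta> + axis j 1) x = (\<Prod>i\<in>UNIV. (x $ i) ^ (\<beta> $ i) * (if i = j then x $ i else 1))"
    unfolding mi_monomial_def by (intro prod.cong) (auto simp: axis_def power_add)
  then show ?thesis
    by (simp add: prod.distrib mi_monomial_def)
qed

text \<open>The innermost derivative is peeled off first: it turns x_j times \<phi> into x_j times a
  partial of \<phi> plus a multiple of \<phi>. The induction hypothesis applies to the first term
  because it is stated for all Schwartz functions.\<close>

lemma schwartz_coord:
  assumes "\<phi> \<in> schwartz_functions"
  shows "(\<lambda>x. complex_of_real (x $ j) * \<phi> x) \<in> schwartz_functions"
proof (rule schwartzI)
  show "smooth (\<lambda>x. complex_of_real (x $ j) * \<phi> x)"
    using assms by (intro smooth_mult smooth_coord schwartz_smooth)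
  show "\<exists>C. \<forall>x. norm (mi_monomial \<beta> x *\<^sub>R partials is (\<lambda>x. complex_of_real (x $ j) * \<phi> x) x) \<le> C" for \<beta> "is"
    using assms
  proof (induction "is" arbitrary: \<phi> rule: rev_induct)
    case Nil
    from schwartz_bounded[OF this, of "\<beta> + axis j 1"] obtain C
      where "\<And>x. norm (mi_monomial (\<beta> + axis j 1) x *\<^sub>R \<phi> x) \<le> C" by blast
    then show ?case
      by (intro exI[of _ C]) (simp add: mi_monomial_plus_axis norm_mult mult.assoc abs_mult del: One_nat_def)
  next
    case (snoc i "is")
    define c :: complex where "c = (if i = j then 1 else 0)"
    note sm = schwartz_smooth[OF snoc.prems]
    have "partial i (\<lambda>x. complex_of_real (x $ j) * \<phi> x) = (\<lambda>x. complex_of_real (x $ j) * partial i \<phi> x + c * \<phi> x)"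
      by (rule ext, subst partial_mult)
        (simp_all only: smooth_differentiable[OF smooth_coord] smooth_differentiable[OF sm] partial_coord c_def)
    then have eq: "partials (is @ [i]) (\<lambda>x. complex_of_real (x $ j) * \<phi> x) =
        (\<lambda>x. partials is (\<lambda>x. complex_of_real (x $ j) * partial i \<phi> x) x + c * partials is \<phi> x)"
      by (simp add: partials_add partials_cmult sm smooth_cmult smooth_mult smooth_coord smooth_partial)
    obtain C where C: "\<And>x. norm (mi_monomial \<beta> x *\<^sub>R partials is (\<lambda>x. complex_of_real (x $ j) * partial i \<phi> x) x) \<le> C"
      using snoc.IH[OF schwartz_partial[OF snoc.prems]] by blast
    obtain D where D: "\<And>x. norm (mi_monomial \<beta> x *\<^sub>R partials is \<phi> x) \<le> D"
      using schwartz_bounded_partials[OF snoc.prems] by blast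
    show ?case
    proof (intro exI[of _ "C + norm c * D"] allI)
      fix x
      have "mi_monomial \<beta> x *\<^sub>R (partials is (\<lambda>x. complex_of_real (x $ j) * partial i \<phi> x) x + c * partials is \<phi> x) =
        mi_monomial \<beta> x *\<^sub>R partials is (\<lambda>x. complex_of_real (x $ j) * partial i \<phi> x) x +
          c * (mi_monomial \<beta> x *\<^sub>R partials is \<phi> x)"
        by (simp add: scaleR_conv_of_real algebra_simps)
      also have "norm \<dots> \<le> C + norm c * D"
        by (intro norm_triangle_mono C) (simp only: norm_mult mult_left_mono D norm_ge_zero)
      finally show "norm (mi_monomial \<beta> x *\<^sub>R partials (is @ [i]) (\<lambda>x. complex_of_real (x $ j) * \<phi> x) x) \<le> C + norm c * D"
        by (simp only: eq)
    qed
  qed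
qed

lemma schwartz_mi_monomial:
  "\<phi> \<in> schwartz_functions \<Longrightarrow> (\<lambda>x. complex_of_real (mi_monomial \<alpha> x) * \<phi> x) \<in> schwartz_functions"
proof -
  assume \<phi>: "\<phi> \<in> schwartz_functions"
  have "(\<lambda>x. complex_of_real (prod_list (map (\<lambda>j. x $ j) js)) * \<phi> x) \<in> schwartz_functions" for js
  proof (induction js)
    case (Cons j js)
    from schwartz_coord[OF Cons.IH, of j] show ?case by (simp add: mult.assoc)
  qed (simp add: \<phi>)
  then show ?thesis by (simp add: mi_monomial_eq_prod_list)
qed

text \<open>Expanding \<open>\<Prod>(1 + x\<^sub>i\<^sup>2)\<close> over subsets \<open>S\<close> of coordinates gives the monomials with exponent \<open>2\<cdot>1\<^sub>S\<close>.\<close>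

lemma norm_le_weight_SUP:
  fixes \<psi> :: "real ^ 'n::finite \<Rightarrow> complex"
  assumes "\<And>\<beta>. bdd_above (range (\<lambda>x. norm (mi_monomial \<beta> x *\<^sub>R \<psi> x)))"
    and N: "2 * CARD('n) \<le> N"
  shows "norm (\<psi> x) \<le> weight x * (\<Sum>\<beta> | mi_order \<beta> \<le> N. SUP x. norm (mi_monomial \<beta> x *\<^sub>R \<psi> x))"
proof -
  define b :: "'n set \<Rightarrow> nat ^ 'n" where "b S = (\<chi> i. if i \<in> S then 2 else 0)" for S
  have inj: "inj b"
    by (auto simp: inj_on_def b_def vec_eq_iff split: if_splits)
  have sup: "norm (mi_monomial \<beta> x *\<^sub>R \<psi> x) \<le> (SUP x. norm (mi_monomial \<beta> x *\<^sub>R \<psi> x))" for \<beta> x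
    by (rule cSUP_upper[OF UNIV_I assms(1)])
  have "(\<Prod>i\<in>UNIV. (x $ i)\<^sup>2 + 1) = (\<Sum>S\<in>Pow UNIV. (\<Prod>i\<in>S. (x $ i)\<^sup>2) * (\<Prod>i\<in>UNIV - S. 1))"
    by (rule prod_add) simp
  also have "\<dots> = (\<Sum>S\<in>UNIV. mi_monomial (b S) x)"
  proof (rule sum.cong)
    fix S :: "'n set"
    have "mi_monomial (b S) x = (\<Prod>i\<in>UNIV. if i \<in> S then (x $ i)\<^sup>2 else 1)"
      unfolding mi_monomial_def b_def by (intro prod.cong) auto
    then show "(\<Prod>i\<in>S. (x $ i)\<^sup>2) * (\<Prod>i\<in>UNIV - S. 1) = mi_monomial (b S) x"
      by (simp add: prod.If_cases)
  qed simp
  finally have w: "inverse (weight x) = (\<Sum>S\<in>UNIV. mi_monomial (b S) x)"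
    by (simp add: weight_inverse add.commute)
  have nonneg: "0 \<le> mi_monomial (b S) x" for S
    unfolding mi_monomial_def b_def by (auto intro!: prod_nonneg)
  have "inverse (weight x) * norm (\<psi> x) = (\<Sum>S\<in>UNIV. norm (mi_monomial (b S) x *\<^sub>R \<psi> x))"
    using nonneg by (simp add: w sum_distrib_right)
  also have "\<dots> \<le> (\<Sum>S\<in>UNIV. SUP x. norm (mi_monomial (b S) x *\<^sub>R \<psi> x))"
    by (intro sum_mono sup)
  also have "\<dots> = (\<Sum>\<beta>\<in>range b. SUP x. norm (mi_monomial \<beta> x *\<^sub>R \<psi> x))"
    by (simp add: sum.reindex[OF inj])
  also have "\<dots> \<le> (\<Sum>\<beta> | mi_order \<beta> \<le> N. SUP x. norm (mi_monomial \<beta> x *\<^sub>R \<psi> x))"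
  proof (rule sum_mono2[OF finite_mi_order_le])
    have "mi_order (b S) \<le> N" for S
    proof -
      have "mi_order (b S) \<le> (\<Sum>i\<in>(UNIV::'n set). 2)"
        unfolding mi_order_def b_def by (intro sum_mono) auto
      with N show ?thesis by simp
    qed
    then show "range b \<subseteq> {\<beta>. mi_order \<beta> \<le> N}" by auto
    show "0 \<le> (SUP x. norm (mi_monomial \<beta> x *\<^sub>R \<psi> x))" for \<beta>
      using sup[of \<beta> 0] norm_ge_zero order_trans by blast
  qed
  finally show ?thesis
    using weight_pos[of x] by (simp add: field_simps)
qed

lemma schwartz_bdd_above:
  "\<phi> \<in> schwartz_functions \<Longrightarrow> bdd_above (range (\<lambda>x. norm (mi_monomial \<beta> x *\<^sub>R \<phi> x)))"
  by (rule schwartz_bounded[of \<phi> \<beta>]) (auto simp: bdd_above_def)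

lemma schwartz_weight:
  assumes "\<phi> \<in> schwartz_functions"
  obtains C where "0 \<le> C" "\<And>x. norm (\<phi> x) \<le> C * weight x"
proof -
  let ?C = "\<Sum>\<beta> | mi_order \<beta> \<le> 2 * CARD('a). SUP x. norm (mi_monomial \<beta> x *\<^sub>R \<phi> x)"
  have le: "norm (\<phi> x) \<le> ?C * weight x" for x
    using norm_le_weight_SUP[OF schwartz_bdd_above[OF assms] order_refl, of x]
    by (subst mult.commute)
  have "0 \<le> ?C * weight (0 :: real ^ 'a)" by (rule order_trans[OF norm_ge_zero le])
  then have "0 * weight (0 :: real ^ 'a) \<le> ?C * weight (0 :: real ^ 'a)" by simp
  then have "0 \<le> ?C" using weight_pos by (rule mult_right_le_imp_le)
  then show thesis using le by (rule that)
qed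

lemma schwartz_integrable:
  assumes "\<phi> \<in> schwartz_functions"
  shows "integrable lborel \<phi>"
proof -
  obtain C where C: "\<And>x. norm (\<phi> x) \<le> C * weight x" using schwartz_weight[OF assms] by blast
  show ?thesis
  proof (rule Bochner_Integration.integrable_bound)
    show "integrable lborel (\<lambda>x. C * weight x)" by (intro integrable_mult_right integrable_weight)
    show "\<phi> \<in> borel_measurable lborel" using schwartz_measurable[OF assms] by simp
    show "AE x in lborel. norm (\<phi> x) \<le> norm (C * weight x)"
      using C by (intro AE_I2) (metis abs_ge_self order_trans real_norm_def)
  qed
qed

lemma schwartz_square_integrable:
  assumes "\<phi> \<in> schwartz_functions"
  shows "square_integrable \<phi>"
proof -
  obtain C where C: "0 \<le> C" "\<And>x. norm (\<phi> x) \<le> C * weight x" using schwartz_weight[OF assms] by blast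
  have "(norm (\<phi> x))\<^sup>2 \<le> C\<^sup>2 * weight x" for x
  proof -
    have "(norm (\<phi> x))\<^sup>2 \<le> (C * weight x)\<^sup>2" by (intro power_mono C) auto
    also have "\<dots> \<le> C\<^sup>2 * weight x"
      using weight_le_1[of x] weight_pos[of x]
      by (simp add: power_mult_distrib mult_left_mono power2_eq_square[of "weight x"] mult_le_one)
    finally show ?thesis .
  qed
  then have "(\<integral>\<^sup>+x. ennreal ((norm (\<phi> x))\<^sup>2) \<partial>lborel) \<le> (\<integral>\<^sup>+x. ennreal (C\<^sup>2 * weight (x :: real ^ 'a)) \<partial>lborel)"
    by (intro nn_integral_mono) (auto intro: ennreal_leI)
  also have "\<dots> < \<infinity>"
    using integrable_mult_right[OF integrable_weight, of "C\<^sup>2"] weight_pos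
    by (subst nn_integral_eq_integral) (auto intro!: mult_nonneg_nonneg AE_I2 intro: less_imp_le)
  finally show ?thesis
    using schwartz_measurable[OF assms] by (simp add: square_integrable_def)
qed

section \<open>Test functions\<close>

lemma test_smooth: "\<phi> \<in> test_functions \<Longrightarrow> smooth \<phi>"
  by (simp add: test_functions_def)

lemma test_functionI:
  assumes "smooth \<phi>" "\<And>x. \<phi> x \<noteq> 0 \<Longrightarrow> x \<in> K" "compact K"
  shows "\<phi> \<in> test_functions"
proof -
  have "closure {x. \<phi> x \<noteq> 0} \<subseteq> K"
    using assms by (intro closure_minimal) (auto intro: compact_imp_closed)
  then have "compact (closure {x. \<phi> x \<noteq> 0})"
    using compact_Int_closed[OF assms(3) closed_closure, of "{x. \<phi> x \<noteq> 0}"] by (simp add: inf.absorb2)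
  with assms(1) show ?thesis by (simp add: test_functions_def)
qed

lemma test_support: "\<phi> x \<noteq> 0 \<Longrightarrow> x \<in> closure {x. \<phi> x \<noteq> 0}"
  using closure_subset by force

text \<open>Off the closed support the function vanishes on an open neighbourhood, so its derivative
  vanishes there too. Hence differentiation preserves test functions.\<close>

lemma partial_nonzero_imp_support:
  assumes "partial i \<phi> x \<noteq> 0"
  shows "x \<in> closure {x. \<phi> x \<noteq> 0}"
proof (rule ccontr)
  assume x: "x \<notin> closure {x. \<phi> x \<noteq> 0}"
  have "((\<lambda>x. 0) has_derivative (\<lambda>h. 0)) (at x)" by simp
  then have "(\<phi> has_derivative (\<lambda>h. 0)) (at x)"
  proof (rule has_derivative_transform_within_open)
    show "open (- closure {x. \<phi> x \<noteq> 0})" by (rule open_Compl[OF closed_closure])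
    show "x \<in> - closure {x. \<phi> x \<noteq> 0}" using x by simp
    show "0 = \<phi> y" if "y \<in> - closure {x. \<phi> x \<noteq> 0}" for y
      using that test_support[of \<phi> y] by auto
  qed
  from partial_eqI[OF this] assms show False by simp
qed

lemma test_partial: "\<phi> \<in> test_functions \<Longrightarrow> partial i \<phi> \<in> test_functions"
  by (rule test_functionI[where K = "closure {x. \<phi> x \<noteq> 0}"])
    (auto simp: test_functions_def intro: smooth_partial partial_nonzero_imp_support)

lemma test_mult:
  assumes "smooth f" "\<phi> \<in> test_functions"
  shows "(\<lambda>x. f x * \<phi> x) \<in> test_functions"
proof (rule test_functionI)
  show "smooth (\<lambda>x. f x * \<phi> x)" using assms by (auto simp: test_functions_def intro: smooth_mult)
  show "x \<in> closure {x. \<phi> x \<noteq> 0}" if "f x * \<phi> x \<noteq> 0" for x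
    using that by (intro test_support) auto
  show "compact (closure {x. \<phi> x \<noteq> 0})" using assms by (simp add: test_functions_def)
qed

lemma test_mi_partial: "\<phi> \<in> test_functions \<Longrightarrow> mi_partial \<alpha> \<phi> \<in> test_functions"
proof -
  assume "\<phi> \<in> test_functions"
  then have "partials is \<phi> \<in> test_functions" for "is"
    by (induction "is") (auto intro: test_partial)
  then show ?thesis by (simp add: mi_partial_eq_partials)
qed

lemma test_bounded:
  assumes "\<phi> \<in> test_functions"
  shows "\<exists>C. \<forall>x. norm (\<phi> x) \<le> C"
proof -
  have "compact (\<phi> ` closure {x. \<phi> x \<noteq> 0})"
    using assms by (intro compact_continuous_image smooth_continuous) (auto simp: test_functions_def)
  then obtain C where C: "\<And>y. y \<in> \<phi> ` closure {x. \<phi> x \<noteq> 0} \<Longrightarrow> norm y \<le> C"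
    using compact_imp_bounded[of "\<phi> ` closure {x. \<phi> x \<noteq> 0}"] unfolding bounded_iff by blast
  have "norm (\<phi> x) \<le> max C 0" for x
    using C[of "\<phi> x"] test_support[of \<phi> x] by (cases "\<phi> x = 0") auto
  then show ?thesis by blast
qed

lemma test_subset_schwartz: "test_functions \<subseteq> schwartz_functions"
proof
  fix \<phi> :: "real ^ 'n::finite \<Rightarrow> complex" assume "\<phi> \<in> test_functions"
  then show "\<phi> \<in> schwartz_functions"
  proof (rule schwartz_coinduct)
    fix f :: "real ^ 'n \<Rightarrow> complex" and j assume f: "f \<in> test_functions"
    show "f differentiable (at x)" for x by (rule smooth_differentiable[OF test_smooth[OF f]])
    show "partial j f \<in> test_functions" by (rule test_partial[OF f])
    show "(\<lambda>x. complex_of_real (x $ j) * f x) \<in> test_functions" by (rule test_mult[OF smooth_coord f])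
    show "\<exists>C. \<forall>x. norm (f x) \<le> C" by (rule test_bounded[OF f])
  qed
qed

lemma test_lincomb:
  assumes "\<phi> \<in> test_functions" "\<psi> \<in> test_functions"
  shows "(\<lambda>x. a * \<phi> x + b * \<psi> x) \<in> test_functions"
proof (rule test_functionI)
  show "smooth (\<lambda>x. a * \<phi> x + b * \<psi> x)" using assms by (intro smooth_lincomb test_smooth)
  show "x \<in> closure {x. \<phi> x \<noteq> 0} \<union> closure {x. \<psi> x \<noteq> 0}" if "a * \<phi> x + b * \<psi> x \<noteq> 0" for x
    using that test_support[of \<phi> x] test_support[of \<psi> x] by (cases "\<phi> x = 0") auto
  show "compact (closure {x. \<phi> x \<noteq> 0} \<union> closure {x. \<psi> x \<noteq> 0})"
    using assms by (auto simp: test_functions_def)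
qed

section \<open>Affine changes of variables and Fubini's theorem for bounded kernels\<close>

lemma nn_integral_affine_vec:
  fixes f :: "real ^ 'n::finite \<Rightarrow> ennreal"
  assumes [measurable]: "f \<in> borel_measurable borel" and c: "c \<noteq> 0"
  shows "(\<integral>\<^sup>+x. f x \<partial>lborel) = ennreal (\<bar>c\<bar> ^ CARD('n)) * (\<integral>\<^sup>+x. f (t + c *\<^sub>R x) \<partial>lborel)"
  by (subst lborel_affine[OF c, of t])
    (simp add: nn_integral_density nn_integral_distr nn_integral_cmult)

lemma integral_affine_vec:
  fixes f :: "real ^ 'n::finite \<Rightarrow> complex"
  assumes [measurable]: "f \<in> borel_measurable borel" and c: "c \<noteq> 0"
  shows "(\<integral>x. f x \<partial>lborel) = (\<bar>c\<bar> ^ CARD('n)) *\<^sub>R (\<integral>x. f (t + c *\<^sub>R x) \<partial>lborel)"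
  by (subst lborel_affine[OF c, of t]) (simp add: integral_density integral_distr)

lemma integrable_affine_vec:
  fixes f :: "real ^ 'n::finite \<Rightarrow> complex"
  assumes f: "integrable lborel f" and c: "c \<noteq> 0"
  shows "integrable lborel (\<lambda>x. f (t + c *\<^sub>R x))"
proof (rule integrableI_bounded)
  have [measurable]: "f \<in> borel_measurable borel" using borel_measurable_integrable[OF f] by simp
  show "(\<lambda>x. f (t + c *\<^sub>R x)) \<in> borel_measurable lborel" by measurable
  have "(\<integral>\<^sup>+x. ennreal (norm (f x)) \<partial>lborel) < \<infinity>" using f by (simp add: integrable_iff_bounded)
  then have "ennreal (\<bar>c\<bar> ^ CARD('n)) * (\<integral>\<^sup>+x. ennreal (norm (f (t + c *\<^sub>R x))) \<partial>lborel) < \<infinity>"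
    by (subst (asm) nn_integral_affine_vec[where c = c and t = t]) (simp_all add: c)
  then show "(\<integral>\<^sup>+x. ennreal (norm (f (t + c *\<^sub>R x))) \<partial>lborel) < \<infinity>"
    using c by (auto simp: ennreal_mult_less_top)
qed

lemma nn_integral_translate:
  fixes f :: "real ^ 'n::finite \<Rightarrow> ennreal"
  shows "f \<in> borel_measurable borel \<Longrightarrow> (\<integral>\<^sup>+x. f (x + a) \<partial>lborel) = (\<integral>\<^sup>+x. f x \<partial>lborel)"
  using nn_integral_affine_vec[of f 1 a] by (simp add: add.commute)

lemma integral_translate:
  fixes f :: "real ^ 'n::finite \<Rightarrow> complex"
  shows "f \<in> borel_measurable borel \<Longrightarrow> (\<integral>x. f (x + a) \<partial>lborel) = (\<integral>x. f x \<partial>lborel)"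
  using integral_affine_vec[of f 1 a] by (simp add: add.commute)

lemma integrable_translate:
  fixes f :: "real ^ 'n::finite \<Rightarrow> complex"
  shows "integrable lborel f \<Longrightarrow> integrable lborel (\<lambda>x. f (x + a))"
  using integrable_affine_vec[of f 1 a] by (simp add: add.commute)

lemma nn_integral_reflect:
  fixes f :: "real ^ 'n::finite \<Rightarrow> ennreal"
  shows "f \<in> borel_measurable borel \<Longrightarrow> (\<integral>\<^sup>+x. f (- x) \<partial>lborel) = (\<integral>\<^sup>+x. f x \<partial>lborel)"
  using nn_integral_affine_vec[of f "-1" 0] by simp

lemma integral_reflect_vec:
  fixes f :: "real ^ 'n::finite \<Rightarrow> complex"
  shows "f \<in> borel_measurable borel \<Longrightarrow> (\<integral>x. f (- x) \<partial>lborel) = (\<integral>x. f x \<partial>lborel)"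
  using integral_affine_vec[of f "-1" 0] by simp

text \<open>A bounded kernel makes |f x| * B * |g y| an integrable majorant on the product space.
  The kernels used later are plane waves, with B = 1.\<close>

lemma Fubini_kernel:
  fixes f g :: "real ^ 'n::finite \<Rightarrow> complex"
  assumes f: "integrable lborel f" and g: "integrable lborel g"
    and k [measurable]: "case_prod k \<in> borel_measurable (borel \<Otimes>\<^sub>M borel)"
    and B: "\<And>x y. norm (k x y) \<le> B"
  shows "(\<integral>y. (\<integral>x. f x * k x y \<partial>lborel) * g y \<partial>lborel) = (\<integral>x. f x * (\<integral>y. k x y * g y \<partial>lborel) \<partial>lborel)"
proof -
  have [measurable]: "f \<in> borel_measurable borel" "g \<in> borel_measurable borel"
    using borel_measurable_integrable[OF f] borel_measurable_integrable[OF g] by simp_all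
  have nf: "(\<integral>\<^sup>+x. ennreal (norm (f x)) \<partial>lborel) < \<infinity>" and ng: "(\<integral>\<^sup>+x. ennreal (norm (g x)) \<partial>lborel) < \<infinity>"
    using f g by (auto simp: integrable_iff_bounded)
  have B0: "0 \<le> B" using B[of 0 0] norm_ge_zero order_trans by blast
  have "integrable (lborel \<Otimes>\<^sub>M lborel) (\<lambda>(x, y). f x * k x y * g y)"
  proof (rule integrableI_bounded)
    show "(\<lambda>(x, y). f x * k x y * g y) \<in> borel_measurable (lborel \<Otimes>\<^sub>M lborel)" by measurable
    have "(\<integral>\<^sup>+p. ennreal (norm (case p of (x, y) \<Rightarrow> f x * k x y * g y)) \<partial>(lborel \<Otimes>\<^sub>M lborel)) =
        (\<integral>\<^sup>+x. \<integral>\<^sup>+y. ennreal (norm (f x * k x y * g y)) \<partial>lborel \<partial>lborel)"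
      by (subst lborel.nn_integral_fst[symmetric]) auto
    also have "\<dots> \<le> (\<integral>\<^sup>+x. \<integral>\<^sup>+y. ennreal (norm (f x)) * (ennreal B * ennreal (norm (g y))) \<partial>lborel \<partial>lborel)"
    proof (intro nn_integral_mono)
      fix x y
      have "norm (f x * k x y * g y) \<le> norm (f x) * (B * norm (g y))"
        unfolding norm_mult mult.assoc by (intro mult_left_mono mult_right_mono B) auto
      then show "ennreal (norm (f x * k x y * g y)) \<le> ennreal (norm (f x)) * (ennreal B * ennreal (norm (g y)))"
        by (simp add: B0 flip: ennreal_mult)
    qed
    also have "\<dots> = (\<integral>\<^sup>+x. ennreal (norm (f x)) \<partial>lborel) * (ennreal B * (\<integral>\<^sup>+y. ennreal (norm (g y)) \<partial>lborel))"
      by (simp add: nn_integral_cmult nn_integral_multc)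
    also have "\<dots> < \<infinity>" using nf ng by (simp add: ennreal_mult_less_top)
    finally show "(\<integral>\<^sup>+p. ennreal (norm (case p of (x, y) \<Rightarrow> f x * k x y * g y)) \<partial>(lborel \<Otimes>\<^sub>M lborel)) < \<infinity>" .
  qed
  from lborel_pair.Fubini_integral[OF this]
  show ?thesis by (simp add: mult.assoc flip: integral_mult_left_zero)
qed

lemma norm_integral_le:
  fixes f :: "'a \<Rightarrow> complex"
  assumes "integrable M f" "integrable M g" "\<And>x. norm (f x) \<le> g x"
  shows "norm (\<integral>x. f x \<partial>M) \<le> (\<integral>x. g x \<partial>M)"
  by (rule order_trans[OF integral_norm_bound integral_mono]) (simp_all add: assms)

section \<open>The Fourier transform of Schwartz functions\<close>

definition plane_wave :: "real ^ 'n::finite \<Rightarrow> real ^ 'n \<Rightarrow> complex" where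
  "plane_wave \<xi> x = exp (- (\<i> * of_real (x \<bullet> \<xi>)))"

lemma fourier_plane_wave: "fourier f \<xi> = (\<integral>x. f x * plane_wave \<xi> x \<partial>lborel)"
  by (simp add: fourier_def plane_wave_def)

lemma norm_plane_wave [simp]: "norm (plane_wave \<xi> x) = 1"
  by (simp add: plane_wave_def norm_exp_eq_Re)

lemma plane_wave_commute: "plane_wave \<xi> x = plane_wave x \<xi>"
  by (simp add: plane_wave_def inner_commute)

lemma plane_wave_add: "plane_wave \<xi> (x + y) = plane_wave \<xi> x * plane_wave \<xi> y"
  by (simp add: plane_wave_def inner_add_left algebra_simps flip: exp_add)

lemma plane_wave_minus: "plane_wave \<xi> (- x) = plane_wave (- \<xi>) x"
  by (simp add: plane_wave_def)

lemma cnj_plane_wave: "cnj (plane_wave \<xi> x) = plane_wave (- \<xi>) x"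
  by (simp add: plane_wave_def exp_cnj)

lemma plane_wave_scaleR: "plane_wave (t *\<^sub>R \<xi>) x = plane_wave \<xi> (t *\<^sub>R x)"
  by (simp add: plane_wave_def)

lemma borel_measurable_plane_wave [measurable]:
  "(\<lambda>(\<xi>, x). plane_wave \<xi> x) \<in> borel_measurable (borel \<Otimes>\<^sub>M borel)"
  unfolding plane_wave_def by measurable

lemma borel_measurable_plane_wave1 [measurable]: "plane_wave \<xi> \<in> borel_measurable borel"
  unfolding plane_wave_def by measurable

lemma integrable_mult_plane_wave:
  "integrable lborel f \<Longrightarrow> integrable lborel (\<lambda>x. f x * plane_wave \<xi> x)"
  by (rule Bochner_Integration.integrable_bound[of lborel f]) (auto simp: norm_mult)

lemma borel_measurable_fourier [measurable]:
  assumes [measurable]: "f \<in> borel_measurable borel"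
  shows "fourier f \<in> borel_measurable borel"
  unfolding fourier_def by measurable

lemma norm_fourier_le: "norm (fourier f \<xi>) \<le> (\<integral>x. norm (f x) \<partial>lborel)"
proof -
  have "norm (fourier f \<xi>) \<le> (\<integral>x. norm (f x * plane_wave \<xi> x) \<partial>lborel)"
    unfolding fourier_plane_wave by (rule integral_norm_bound)
  then show ?thesis by (simp add: norm_mult)
qed

text \<open>Fubini for a kernel symmetric in its two arguments. The same identity, with a Schwartz
  function in place of g, later serves as the definition of the transform on L^2.\<close>

lemma fourier_multiplication:
  assumes "integrable lborel f" "integrable lborel g"
  shows "(\<integral>x. fourier f x * g x \<partial>lborel) = (\<integral>x. f x * fourier g x \<partial>lborel)"
proof -
  have m: "case_prod (\<lambda>x y. plane_wave y x :: complex) \<in> borel_measurable (borel \<Otimes>\<^sub>M borel)"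
    by measurable
  have "norm (plane_wave y x) \<le> 1" for x y :: "real ^ 'a" by simp
  from Fubini_kernel[OF assms m this]
  show ?thesis
    unfolding fourier_plane_wave by (subst (2) plane_wave_commute) (simp add: mult.commute)
qed

section \<open>The transform exchanges derivatives and coordinate factors\<close>

lemma has_derivative_plane_wave:
  "(plane_wave \<xi> has_derivative (\<lambda>h. plane_wave \<xi> x * - (\<i> * of_real (h \<bullet> \<xi>)))) (at x)"
proof -
  have "((\<lambda>x. - (\<i> * complex_of_real (x \<bullet> \<xi>))) has_derivative (\<lambda>h. - (\<i> * of_real (h \<bullet> \<xi>)))) (at x)"
    by (intro bounded_linear_imp_has_derivative bounded_linear_minus
        bounded_linear_compose[OF bounded_linear_mult_right]
        bounded_linear_compose[OF bounded_linear_of_real] bounded_linear_inner_left)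
  from has_derivative_compose[OF this DERIV_exp[unfolded has_field_derivative_def]] show ?thesis
    by (simp add: plane_wave_def[abs_def] mult.commute)
qed

lemma partial_plane_wave: "partial j (plane_wave \<xi>) x = - (\<i> * of_real (\<xi> $ j)) * plane_wave \<xi> x"
  by (subst partial_eqI[OF has_derivative_plane_wave]) (simp add: inner_axis' )

lemma differentiable_plane_wave: "plane_wave \<xi> differentiable (at x)"
  using has_derivative_plane_wave differentiable_def by blast

lemma schwartz_plane_wave:
  assumes "\<phi> \<in> schwartz_functions"
  shows "(\<lambda>x. \<phi> x * plane_wave \<xi> x) \<in> schwartz_functions"
proof (rule schwartz_coinduct)
  let ?X = "(\<lambda>\<phi> x. \<phi> x * plane_wave \<xi> x) ` schwartz_functions"
  show "(\<lambda>x. \<phi> x * plane_wave \<xi> x) \<in> ?X" using assms by blast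
  fix f j assume "f \<in> ?X"
  then obtain \<psi> where f: "f = (\<lambda>x. \<psi> x * plane_wave \<xi> x)" and \<psi>: "\<psi> \<in> schwartz_functions" by blast
  note d = smooth_differentiable[OF schwartz_smooth[OF \<psi>]]
  show "f differentiable (at x)" for x
    unfolding f by (intro differentiable_mult d differentiable_plane_wave)
  have eq: "partial j f = (\<lambda>x. (- (\<i> * of_real (\<xi> $ j)) * \<psi> x + 1 * partial j \<psi> x) * plane_wave \<xi> x)"
    unfolding f by (rule ext, subst partial_mult[OF d differentiable_plane_wave])
      (simp add: partial_plane_wave algebra_simps)
  show "partial j f \<in> ?X"
    unfolding eq
    by (rule image_eqI[OF _ schwartz_lincomb[OF \<psi> schwartz_partial[OF \<psi>]]]) (rule refl)
  show "(\<lambda>x. complex_of_real (x $ j) * f x) \<in> ?X"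
    unfolding f mult.assoc[symmetric] by (rule image_eqI[OF refl schwartz_coord[OF \<psi>]])
  obtain C where C: "\<And>x. norm (mi_monomial 0 x *\<^sub>R \<psi> x) \<le> C"
    using schwartz_bounded[OF \<psi>] by blast
  then show "\<exists>C. \<forall>x. norm (f x) \<le> C"
    by (intro exI[of _ C]) (simp add: f norm_mult mi_monomial_def)
qed

text \<open>By translation invariance of the integral and the fundamental theorem of calculus
  on the segments \<open>[x, x + e\<^sub>j]\<close>.\<close>

lemma integral_partial_schwartz:
  fixes \<psi> :: "real ^ 'n::finite \<Rightarrow> complex"
  assumes \<psi>: "\<psi> \<in> schwartz_functions"
  shows "(\<integral>x. partial j \<psi> x \<partial>lborel) = 0"
proof -
  define e :: "real ^ 'n" where "e = axis j 1"
  define g where "g = partial j \<psi>"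
  have g: "g \<in> schwartz_functions" unfolding g_def by (rule schwartz_partial[OF \<psi>])
  note gi = schwartz_integrable[OF g]
  have [measurable]: "g \<in> borel_measurable borel" by (rule schwartz_measurable[OF g])
  have FTC: "(\<integral>s. indicator {0..1::real} s *\<^sub>R g (x + s *\<^sub>R e) \<partial>lborel) = \<psi> (x + e) - \<psi> x" for x
  proof -
    have "has_bochner_integral lborel (\<lambda>s. indicator {0..1::real} s *\<^sub>R g (x + s *\<^sub>R e))
        (\<psi> (x + 1 *\<^sub>R e) - \<psi> (x + 0 *\<^sub>R e))"
    proof (rule has_bochner_integral_FTC_Icc)
      show "((\<lambda>s. \<psi> (x + s *\<^sub>R e)) has_vector_derivative g (x + s *\<^sub>R e)) (at s within {0..1})" for s
        unfolding e_def g_def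
        by (rule has_vector_derivative_line[OF smooth_differentiable[OF schwartz_smooth[OF \<psi>]]])
      show "continuous_on {0..1} (\<lambda>s. g (x + s *\<^sub>R e))"
        by (intro continuous_on_compose2[OF smooth_continuous[OF schwartz_smooth[OF g], of UNIV]]
            continuous_intros subset_UNIV)
    qed simp
    then show ?thesis by (simp add: has_bochner_integral_iff)
  qed
  have "integrable (lborel \<Otimes>\<^sub>M lborel) (\<lambda>(s, x). indicator {0..1::real} s *\<^sub>R g (x + s *\<^sub>R e))"
  proof (rule lborel_pair.Fubini_integrable)
    show "(\<lambda>(s, x). indicator {0..1::real} s *\<^sub>R g (x + s *\<^sub>R e)) \<in> borel_measurable (lborel \<Otimes>\<^sub>M lborel)"
      by measurable
    have "(\<integral>x. norm (g (x + a)) \<partial>lborel) = (\<integral>x. norm (g x) \<partial>lborel)" for a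
    proof -
      have "(\<integral>x. complex_of_real (norm (g (x + a))) \<partial>lborel) = (\<integral>x. complex_of_real (norm (g x)) \<partial>lborel)"
        by (rule integral_translate) measurable
      then show ?thesis by (simp only: integral_complex_of_real of_real_eq_iff)
    qed
    then have "(\<lambda>s. \<integral>x. norm (case (s, x) of (s, x) \<Rightarrow> indicator {0..1::real} s *\<^sub>R g (x + s *\<^sub>R e)) \<partial>lborel) =
        (\<lambda>s. indicator {0..1::real} s *\<^sub>R (\<integral>x. norm (g x) \<partial>lborel))"
      by (simp add: abs_mult)
    then show "integrable lborel (\<lambda>s. \<integral>x. norm (case (s, x) of (s, x) \<Rightarrow>
        indicator {0..1::real} s *\<^sub>R g (x + s *\<^sub>R e)) \<partial>lborel)"
      by simp
    show "AE s in lborel. integrable lborel (\<lambda>x. case (s, x) of (s, x) \<Rightarrow> indicator {0..1::real} s *\<^sub>R g (x + s *\<^sub>R e))"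
      by (intro AE_I2) (simp add: integrable_translate[OF gi] integrable_scaleR_right)
  qed
  from lborel_pair.Fubini_integral[OF this]
  have "(\<integral>x. (\<integral>s. indicator {0..1::real} s *\<^sub>R g (x + s *\<^sub>R e) \<partial>lborel) \<partial>lborel) =
      (\<integral>s. (\<integral>x. indicator {0..1::real} s *\<^sub>R g (x + s *\<^sub>R e) \<partial>lborel) \<partial>lborel)" .
  also have "\<dots> = (\<integral>s. indicator {0..1::real} s *\<^sub>R (\<integral>x. g x \<partial>lborel) \<partial>lborel)"
    by (simp add: integral_translate)
  also have "\<dots> = (\<integral>x. g x \<partial>lborel)" by simp
  finally have "(\<integral>x. g x \<partial>lborel) = (\<integral>x. \<psi> (x + e) - \<psi> x \<partial>lborel)" by (simp add: FTC)
  also have "\<dots> = 0"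
    using schwartz_integrable[OF \<psi>] schwartz_measurable[OF \<psi>]
    by (simp add: integrable_translate integral_translate)
  finally show ?thesis by (simp add: g_def)
qed

lemma fourier_cmult: "fourier (\<lambda>x. c * f x) \<xi> = c * fourier f \<xi>"
  unfolding fourier_plane_wave by (simp add: mult.assoc)

text \<open>Integration by parts without boundary terms: the product of \<phi> with a plane wave is
  Schwartz, so the integral of its partial derivative vanishes.\<close>

lemma fourier_partial:
  assumes "\<phi> \<in> schwartz_functions"
  shows "fourier (partial j \<phi>) \<xi> = \<i> * of_real (\<xi> $ j) * fourier \<phi> \<xi>"
proof -
  note d = smooth_differentiable[OF schwartz_smooth[OF assms]]
  have eq: "partial j (\<lambda>x. \<phi> x * plane_wave \<xi> x) x =
      partial j \<phi> x * plane_wave \<xi> x - \<i> * of_real (\<xi> $ j) * (\<phi> x * plane_wave \<xi> x)" for x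
    by (subst partial_mult[OF d differentiable_plane_wave]) (simp add: partial_plane_wave algebra_simps)
  have "0 = (\<integral>x. partial j \<phi> x * plane_wave \<xi> x - \<i> * of_real (\<xi> $ j) * (\<phi> x * plane_wave \<xi> x) \<partial>lborel)"
    using integral_partial_schwartz[OF schwartz_plane_wave[OF assms, of \<xi>], of j] by (simp only: eq)
  also have "\<dots> = fourier (partial j \<phi>) \<xi> - \<i> * of_real (\<xi> $ j) * fourier \<phi> \<xi>"
    unfolding fourier_plane_wave
    using integrable_mult_plane_wave[OF schwartz_integrable[OF assms], of \<xi>]
      integrable_mult_plane_wave[OF schwartz_integrable[OF schwartz_partial[OF assms]], of j \<xi>]
    by simp
  finally show ?thesis by simp
qed

text \<open>The plane wave is expanded to first order in the frequency. The remainder is at most the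
  second moment of |\<phi>| times |h|^2, which yields the full derivative at once rather than
  separate partial derivatives.\<close>

lemma has_derivative_fourier:
  fixes \<phi> :: "real ^ 'n::finite \<Rightarrow> complex"
  assumes \<phi>: "\<phi> \<in> schwartz_functions"
  shows "(fourier \<phi> has_derivative
    (\<lambda>h. \<Sum>i\<in>UNIV. h $ i *\<^sub>R fourier (\<lambda>x. - \<i> * (of_real (x $ i) * \<phi> x)) \<xi>)) (at \<xi>)"
    (is "(_ has_derivative ?D) _")
proof -
  have [measurable]: "\<phi> \<in> borel_measurable borel" by (rule schwartz_measurable[OF \<phi>])
  let ?F = "\<lambda>i. fourier (\<lambda>x. - \<i> * (of_real (x $ i) * \<phi> x)) \<xi>"
  have co: "(\<lambda>x. of_real (x $ i) * \<phi> x) \<in> schwartz_functions" for i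
    by (rule schwartz_coord[OF \<phi>])
  have int2: "integrable lborel (\<lambda>x. (norm x)\<^sup>2 * norm (\<phi> x))"
  proof -
    have "integrable lborel (\<lambda>x. \<Sum>i\<in>UNIV. norm (of_real (x $ i) * (of_real (x $ i) * \<phi> x)))"
      by (intro Bochner_Integration.integrable_sum integrable_norm schwartz_integrable schwartz_coord \<phi>)
    moreover have "(\<Sum>i\<in>UNIV. norm (of_real (x $ i) * (of_real (x $ i) * \<phi> x))) = (norm x)\<^sup>2 * norm (\<phi> x)" for x
      by (simp add: norm_mult power2_norm_eq_inner inner_vec_def sum_distrib_right)
        (simp add: mult.assoc[symmetric])
    ultimately show ?thesis by simp
  qed
  define M where "M = (\<integral>x. (norm x)\<^sup>2 * norm (\<phi> x) \<partial>lborel)"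
  have D: "?D h = (\<integral>x. \<phi> x * plane_wave \<xi> x * - (\<i> * of_real (x \<bullet> h)) \<partial>lborel)"
    and Di: "integrable lborel (\<lambda>x. \<phi> x * plane_wave \<xi> x * - (\<i> * of_real (x \<bullet> h)))" for h
  proof -
    have eq: "(\<Sum>i\<in>UNIV. complex_of_real (h $ i) * ((- \<i> * (of_real (x $ i) * \<phi> x)) * plane_wave \<xi> x)) =
        \<phi> x * plane_wave \<xi> x * - (\<i> * of_real (x \<bullet> h))" for x
    proof -
      have "(\<Sum>i\<in>UNIV. complex_of_real (h $ i) * ((- \<i> * (of_real (x $ i) * \<phi> x)) * plane_wave \<xi> x)) =
          (\<Sum>i\<in>UNIV. \<phi> x * plane_wave \<xi> x * - (\<i> * of_real (x $ i * h $ i)))"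
        by (intro sum.cong) (simp_all add: algebra_simps)
      also have "\<dots> = \<phi> x * plane_wave \<xi> x * - (\<i> * of_real (x \<bullet> h))"
        by (simp add: inner_vec_def sum_distrib_left sum_negf)
      finally show ?thesis .
    qed
    have i: "integrable lborel (\<lambda>x. complex_of_real (h $ i) * ((- \<i> * (of_real (x $ i) * \<phi> x)) * plane_wave \<xi> x))" for i
      by (intro integrable_mult_right integrable_mult_plane_wave schwartz_integrable co)
    have "?D h = (\<Sum>i\<in>UNIV. \<integral>x. complex_of_real (h $ i) * ((- \<i> * (of_real (x $ i) * \<phi> x)) * plane_wave \<xi> x) \<partial>lborel)"
      unfolding fourier_plane_wave scaleR_conv_of_real by (simp only: integral_mult_right_zero)
    also have "\<dots> = (\<integral>x. \<phi> x * plane_wave \<xi> x * - (\<i> * of_real (x \<bullet> h)) \<partial>lborel)"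
      by (subst Bochner_Integration.integral_sum[symmetric]) (simp_all only: i eq)
    finally show "?D h = (\<integral>x. \<phi> x * plane_wave \<xi> x * - (\<i> * of_real (x \<bullet> h)) \<partial>lborel)" .
    have "integrable lborel (\<lambda>x. \<Sum>i\<in>UNIV. complex_of_real (h $ i) * ((- \<i> * (of_real (x $ i) * \<phi> x)) * plane_wave \<xi> x))"
      by (intro Bochner_Integration.integrable_sum i)
    then show "integrable lborel (\<lambda>x. \<phi> x * plane_wave \<xi> x * - (\<i> * of_real (x \<bullet> h)))"
      by (simp only: eq)
  qed
  have rem: "norm (fourier \<phi> (\<xi> + h) - fourier \<phi> \<xi> - ?D h) \<le> M * (norm h)\<^sup>2" for h
  proof -
    note ip = integrable_mult_plane_wave[OF schwartz_integrable[OF \<phi>]]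
    have "fourier \<phi> (\<xi> + h) - fourier \<phi> \<xi> - ?D h =
        (\<integral>x. \<phi> x * plane_wave (\<xi> + h) x - \<phi> x * plane_wave \<xi> x
          - \<phi> x * plane_wave \<xi> x * - (\<i> * of_real (x \<bullet> h)) \<partial>lborel)"
      unfolding D by (simp only: fourier_plane_wave ip Di Bochner_Integration.integral_diff
          Bochner_Integration.integrable_diff)
    also have "norm \<dots> \<le> (\<integral>x. (norm x)\<^sup>2 * norm (\<phi> x) * (norm h)\<^sup>2 \<partial>lborel)"
    proof (rule norm_integral_le)
      show "integrable lborel (\<lambda>x. \<phi> x * plane_wave (\<xi> + h) x - \<phi> x * plane_wave \<xi> x
          - \<phi> x * plane_wave \<xi> x * - (\<i> * of_real (x \<bullet> h)))"
        by (intro Bochner_Integration.integrable_diff ip Di)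
      show "integrable lborel (\<lambda>x. (norm x)\<^sup>2 * norm (\<phi> x) * (norm h)\<^sup>2)"
        by (intro integrable_mult_left int2)
      fix x
      \<comment> \<open>The remainder of the first order expansion of exp(-i*theta) at theta = x . h
        is quadratic in theta; this is where the second moment \<open>M\<close> comes from.\<close>
      have "norm (plane_wave h x - 1 + \<i> * of_real (x \<bullet> h)) \<le> (x \<bullet> h)\<^sup>2 / 2"
        using iexp_approx1[of "- (x \<bullet> h)" 1] by (simp add: plane_wave_def power2_eq_square algebra_simps)
      also have "\<dots> \<le> (norm x * norm h)\<^sup>2"
        using power_mono[OF Cauchy_Schwarz_ineq2[of x h], of 2] zero_le_power2[of "x \<bullet> h"]
        unfolding power2_abs by linarith
      finally have b: "norm (plane_wave h x - 1 + \<i> * of_real (x \<bullet> h)) \<le> (norm x * norm h)\<^sup>2" .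
      have "\<phi> x * plane_wave (\<xi> + h) x - \<phi> x * plane_wave \<xi> x - \<phi> x * plane_wave \<xi> x * - (\<i> * of_real (x \<bullet> h)) =
          \<phi> x * plane_wave \<xi> x * (plane_wave h x - 1 + \<i> * of_real (x \<bullet> h))"
        by (subst (1 2 3) plane_wave_commute) (simp add: plane_wave_add algebra_simps plane_wave_commute)
      also have "norm \<dots> = norm (\<phi> x) * norm (plane_wave h x - 1 + \<i> * of_real (x \<bullet> h))"
        by (simp add: norm_mult)
      also have "\<dots> \<le> norm (\<phi> x) * (norm x * norm h)\<^sup>2"
        by (intro mult_left_mono b) auto
      finally show "norm (\<phi> x * plane_wave (\<xi> + h) x - \<phi> x * plane_wave \<xi> x
          - \<phi> x * plane_wave \<xi> x * - (\<i> * of_real (x \<bullet> h))) \<le> (norm x)\<^sup>2 * norm (\<phi> x) * (norm h)\<^sup>2"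
        by (simp only: power_mult_distrib mult_ac)
    qed
    also have "\<dots> = M * (norm h)\<^sup>2" by (simp add: M_def)
    finally show ?thesis .
  qed
  show ?thesis
    unfolding has_derivative_at
  proof
    show "bounded_linear ?D"
      by (intro bounded_linear_sum bounded_linear_compose[OF bounded_linear_scaleR_left] bounded_linear_vec_nth)
    show "(\<lambda>h. norm (fourier \<phi> (\<xi> + h) - fourier \<phi> \<xi> - ?D h) / norm h) \<midarrow>0\<rightarrow> 0"
    proof (rule Lim_null_comparison)
      show "\<forall>\<^sub>F h in at 0. norm (norm (fourier \<phi> (\<xi> + h) - fourier \<phi> \<xi> - ?D h) / norm h) \<le> M * norm h"
        unfolding eventually_at_filter
      proof (intro always_eventually allI impI)
        fix h :: "real ^ 'n" assume "h \<noteq> 0"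
        then show "norm (norm (fourier \<phi> (\<xi> + h) - fourier \<phi> \<xi> - ?D h) / norm h) \<le> M * norm h"
          using rem[of h] by (simp add: divide_le_eq power2_eq_square mult.assoc)
      qed
      show "((\<lambda>h. M * norm h) \<longlongrightarrow> 0) (at 0)"
        by (rule tendsto_eq_intros | simp)+
    qed
  qed
qed

lemma partial_fourier:
  "\<phi> \<in> schwartz_functions \<Longrightarrow> partial j (fourier \<phi>) = fourier (\<lambda>x. - \<i> * (of_real (x $ j) * \<phi> x))"
  by (rule ext, subst partial_eqI[OF has_derivative_fourier])
    (simp_all add: axis_def if_distrib[of "\<lambda>c. c *\<^sub>R _"] cong: if_cong)

text \<open>The transforms of Schwartz functions form a family as required by
  \<open>schwartz_coinduct\<close>: derivatives and coordinate factors are exchanged, up to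
  constants, and each member is bounded by the L^1 norm of its preimage.\<close>

lemma schwartz_fourier:
  assumes "\<phi> \<in> schwartz_functions"
  shows "fourier \<phi> \<in> schwartz_functions"
proof (rule schwartz_coinduct)
  let ?X = "fourier ` schwartz_functions"
  show "fourier \<phi> \<in> ?X" using assms by blast
  fix f :: "real ^ 'a \<Rightarrow> complex" and j assume "f \<in> ?X"
  then obtain \<psi> where f: "f = fourier \<psi>" and \<psi>: "\<psi> \<in> schwartz_functions" by blast
  show "f differentiable (at x)" for x
    unfolding f differentiable_def using has_derivative_fourier[OF \<psi>] by blast
  show "partial j f \<in> ?X"
    unfolding f partial_fourier[OF \<psi>] by (intro imageI schwartz_cmult schwartz_coord \<psi>)
  have "(\<lambda>x. complex_of_real (x $ j) * f x) = fourier (\<lambda>x. - \<i> * partial j \<psi> x)"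
    by (rule ext, subst fourier_cmult) (simp add: f fourier_partial[OF \<psi>] flip: mult.assoc)
  also have "\<dots> \<in> ?X" by (intro imageI schwartz_cmult schwartz_partial \<psi>)
  finally show "(\<lambda>x. complex_of_real (x $ j) * f x) \<in> ?X" .
  show "\<exists>C. \<forall>x. norm (f x) \<le> C"
    unfolding f using norm_fourier_le by blast
qed

lemma mi_partial_fourier:
  assumes "\<phi> \<in> schwartz_functions"
  shows "mi_partial \<alpha> (fourier \<phi>) = fourier (\<lambda>x. (- \<i>) ^ mi_order \<alpha> * (of_real (mi_monomial \<alpha> x) * \<phi> x))"
proof -
  \<comment> \<open>The Schwartz property is part of the induction claim because differentiating the
    transform once more depends on it.\<close>
  have "partials js (fourier \<phi>) = fourier (\<lambda>x. (- \<i>) ^ length js * (of_real (prod_list (map (\<lambda>j. x $ j) js)) * \<phi> x)) \<and>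
      (\<lambda>x. of_real (prod_list (map (\<lambda>j. x $ j) js)) * \<phi> x) \<in> schwartz_functions" for js
  proof (induction js)
    case Nil
    show ?case using assms by simp
  next
    case (Cons j js)
    let ?\<psi> = "\<lambda>x. complex_of_real (prod_list (map (\<lambda>j. x $ j) js)) * \<phi> x"
    from Cons have S: "?\<psi> \<in> schwartz_functions"
      and eq: "partials js (fourier \<phi>) = fourier (\<lambda>x. (- \<i>) ^ length js * ?\<psi> x)" by blast+
    have "partials (j # js) (fourier \<phi>) = partial j (fourier (\<lambda>x. (- \<i>) ^ length js * ?\<psi> x))"
      by (simp only: foldr.simps o_apply eq)
    also have "\<dots> = fourier (\<lambda>x. - \<i> * (of_real (x $ j) * ((- \<i>) ^ length js * ?\<psi> x)))"
      by (rule partial_fourier[OF schwartz_cmult[OF S]])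
    also have "\<dots> = fourier (\<lambda>x. (- \<i>) ^ length (j # js) * (of_real (prod_list (map (\<lambda>j. x $ j) (j # js))) * \<phi> x))"
      by (intro arg_cong[of _ _ fourier] ext) (simp add: algebra_simps)
    finally show ?case
      using schwartz_coord[OF S, of j] by (simp add: mult.assoc)
  qed
  then show ?thesis
    by (simp add: mi_partial_eq_partials mi_monomial_eq_prod_list length_mi_list)
qed

section \<open>Gaussians and Fourier inversion\<close>

text \<open>Written as a product of standard normal densities, so that the mass 1 and the transform
  both reduce to known facts about one variable.\<close>

definition gauss :: "real ^ 'n::finite \<Rightarrow> real" where
  "gauss x = (\<Prod>i\<in>UNIV. std_normal_density (x $ i))"

lemma gauss_nonneg: "0 \<le> gauss x"
  by (simp add: gauss_def prod_nonneg)

lemma borel_measurable_gauss [measurable]: "gauss \<in> borel_measurable borel"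
  unfolding gauss_def by measurable

lemma exp_norm_square: "exp (- (norm x)\<^sup>2 / 2) = (\<Prod>i\<in>UNIV. exp (- (x $ i)\<^sup>2 / 2 :: real))"
proof -
  have "- (norm x)\<^sup>2 / 2 = (\<Sum>i\<in>UNIV. - (x $ i)\<^sup>2 / 2)"
    unfolding power2_norm_eq_inner inner_vec_def
    by (simp add: power2_eq_square sum_negf flip: sum_divide_distrib)
  then show ?thesis by (simp add: exp_sum)
qed

lemma gauss_eq: "gauss (x :: real ^ 'n::finite) = exp (- (norm x)\<^sup>2 / 2) / sqrt (2 * pi) ^ CARD('n)"
proof -
  have "gauss x = (\<Prod>i\<in>(UNIV :: 'n set). 1 / sqrt (2 * pi)) * (\<Prod>i\<in>UNIV. exp (- (x $ i)\<^sup>2 / 2))"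
    unfolding gauss_def std_normal_density_def prod.distrib ..
  then show ?thesis
    unfolding exp_norm_square by (simp add: power_divide)
qed

lemma nn_integral_gauss: "(\<integral>\<^sup>+x. ennreal (gauss x) \<partial>lborel) = 1"
proof -
  have "(\<integral>\<^sup>+t. ennreal (std_normal_density t) \<partial>lborel) = ennreal 1"
    by (subst nn_integral_eq_integral) auto
  moreover have "(\<integral>\<^sup>+x. (\<Prod>i\<in>UNIV. ennreal (std_normal_density ((x :: real ^ 'a) $ i))) \<partial>lborel) =
      (\<Prod>i\<in>(UNIV :: 'a set). \<integral>\<^sup>+t. ennreal (std_normal_density t) \<partial>lborel)"
    by (rule nn_integral_lborel_prod_vec) measurable
  ultimately show ?thesis
    unfolding gauss_def by (simp add: prod_ennreal)
qed

lemma integrable_gauss: "integrable lborel (\<lambda>x. complex_of_real (gauss x))"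
  by (rule integrableI_bounded) (simp_all add: gauss_nonneg nn_integral_gauss)

lemma integral_gauss: "(\<integral>x. gauss x \<partial>lborel) = 1"
proof -
  have "integrable lborel gauss"
    by (rule integrableI_bounded) (simp_all add: gauss_nonneg nn_integral_gauss)
  then have "ennreal (\<integral>x. gauss (x :: real ^ 'a) \<partial>lborel) = 1"
    by (subst nn_integral_eq_integral[symmetric]) (simp_all add: gauss_nonneg nn_integral_gauss)
  then show ?thesis by (simp add: ennreal_eq_1)
qed

text \<open>In each coordinate this is the characteristic function of the standard normal
  distribution, evaluated at the negated frequency.\<close>

lemma fourier_gauss: "fourier (\<lambda>x. of_real (gauss x)) \<xi> = of_real (exp (- (norm \<xi>)\<^sup>2 / 2))"
proof -
  define f where "f i t = complex_of_real (std_normal_density t) * iexp (- (\<xi> $ i) * t)" for i t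
  have f_int: "integrable lborel (f i)" for i
    unfolding f_def
    by (rule Bochner_Integration.integrable_bound[of lborel "\<lambda>t. std_normal_density t"])
      (auto simp: norm_mult norm_exp_eq_Re)
  have f1: "(\<integral>t. f i t \<partial>lborel) = complex_of_real (exp (- ((\<xi> $ i)\<^sup>2) / 2))" for i
  proof -
    have "char std_normal_distribution (- (\<xi> $ i)) =
        (\<integral>t. std_normal_density t *\<^sub>R iexp (- (\<xi> $ i) * t) \<partial>lborel)"
      unfolding char_def by (subst integral_density) auto
    then show ?thesis
      by (simp add: char_std_normal_distribution f_def scaleR_conv_of_real)
  qed
  have "fourier (\<lambda>x. of_real (gauss x)) \<xi> = (\<integral>x. (\<Prod>i\<in>UNIV. f i (x $ i)) \<partial>lborel)"
    unfolding fourier_def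
  proof (intro Bochner_Integration.integral_cong refl)
    fix x :: "real ^ 'a"
    have "exp (- (\<i> * complex_of_real (x \<bullet> \<xi>))) = (\<Prod>i\<in>UNIV. iexp (- (\<xi> $ i) * x $ i))"
      by (simp add: inner_vec_def exp_sum[symmetric] sum_distrib_left sum_negf mult_ac)
    then show "complex_of_real (gauss x) * exp (- (\<i> * complex_of_real (x \<bullet> \<xi>))) = (\<Prod>i\<in>UNIV. f i (x $ i))"
      by (simp add: f_def gauss_def prod.distrib)
  qed
  also have "\<dots> = (\<Prod>i\<in>UNIV. complex_of_real (exp (- ((\<xi> $ i)\<^sup>2) / 2)))"
    by (subst integral_lborel_prod_vec) (simp_all only: f_int f1)
  also have "\<dots> = of_real (exp (- (norm \<xi>)\<^sup>2 / 2))"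
    unfolding exp_norm_square of_real_prod ..
  finally show ?thesis .
qed

text \<open>A regulariser in frequency: integrable for t \<noteq> 0, never above 1, and tending to 1
  pointwise as t tends to 0. Unlike \<open>gauss\<close> it is normalised by its value at the origin
  and not by its mass.\<close>

definition damping :: "real \<Rightarrow> real ^ 'n::finite \<Rightarrow> real" where
  "damping t \<xi> = exp (- (norm (t *\<^sub>R \<xi>))\<^sup>2 / 2)"

lemma damping_eq_gauss: "damping t (\<xi> :: real ^ 'n::finite) = sqrt (2 * pi) ^ CARD('n) * gauss (t *\<^sub>R \<xi>)"
  by (simp add: damping_def gauss_eq)

lemma damping_nonneg: "0 \<le> damping t \<xi>" and damping_le_1: "damping t \<xi> \<le> 1"
  by (simp_all add: damping_def)

lemma borel_measurable_damping [measurable]: "damping t \<in> borel_measurable borel"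
  unfolding damping_def by measurable

lemma integrable_damping: "t \<noteq> 0 \<Longrightarrow> integrable lborel (\<lambda>\<xi>. complex_of_real (damping t \<xi>))"
  using integrable_mult_right[OF integrable_affine_vec[OF integrable_gauss, of t 0], where c = "of_real (sqrt (2 * pi) ^ CARD('a))"]
  by (simp add: damping_eq_gauss[abs_def])

definition fourier_const :: "'n::finite itself \<Rightarrow> real" where
  "fourier_const _ = (2 * pi) ^ CARD('n)"

lemma fourier_const_pos: "0 < fourier_const TYPE('n::finite)"
  by (simp add: fourier_const_def)

text \<open>A wide Gaussian has a narrow transform; the power of t is the Jacobian of the dilation.
  One factor sqrt(2*pi)^n comes from rewriting the damping through \<open>gauss\<close>, the other
  from rewriting its transform, and together they give \<open>fourier_const\<close>.\<close>

lemma fourier_damping: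
  fixes w :: "real ^ 'n::finite"
  assumes t: "0 < t"
  shows "t ^ CARD('n) *\<^sub>R fourier (\<lambda>\<xi>. of_real (damping t \<xi>)) w =
    of_real (fourier_const TYPE('n) * gauss ((1 / t) *\<^sub>R w))"
proof -
  define c where "c = sqrt (2 * pi) ^ CARD('n)"
  have c2: "c * c = fourier_const TYPE('n)"
    unfolding c_def fourier_const_def power_mult_distrib[symmetric] by simp
  have [measurable]: "(\<lambda>\<eta>. complex_of_real (c * gauss \<eta>) * plane_wave ((1 / t) *\<^sub>R w) \<eta>) \<in> borel_measurable borel"
    by measurable
  have "complex_of_real c * fourier (\<lambda>\<eta>. of_real (gauss \<eta>)) ((1 / t) *\<^sub>R w) =
      (\<integral>\<eta>. complex_of_real (c * gauss \<eta>) * plane_wave ((1 / t) *\<^sub>R w) \<eta> \<partial>lborel)"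
    by (simp add: fourier_plane_wave mult.assoc)
  also have "\<dots> = t ^ CARD('n) *\<^sub>R
      (\<integral>\<xi>. complex_of_real (c * gauss (t *\<^sub>R \<xi>)) * plane_wave ((1 / t) *\<^sub>R w) (t *\<^sub>R \<xi>) \<partial>lborel)"
    by (subst integral_affine_vec[of _ t 0]) (use t in simp_all)
  also have "\<dots> = t ^ CARD('n) *\<^sub>R fourier (\<lambda>\<xi>. of_real (damping t \<xi>)) w"
    using t by (simp add: fourier_plane_wave damping_eq_gauss c_def flip: plane_wave_scaleR)
  finally have "t ^ CARD('n) *\<^sub>R fourier (\<lambda>\<xi>. of_real (damping t \<xi>)) w =
      complex_of_real c * complex_of_real (exp (- (norm ((1 / t) *\<^sub>R w))\<^sup>2 / 2))"
    by (simp only: fourier_gauss)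
  also have "exp (- (norm ((1 / t) *\<^sub>R w))\<^sup>2 / 2) = c * gauss ((1 / t) *\<^sub>R w)"
    by (simp add: gauss_eq c_def)
  finally show ?thesis by (simp add: mult.assoc flip: c2)
qed

text \<open>A regularised inversion formula. Fubini moves the transform onto the damped plane wave,
  where the frequency -y shifts the resulting Gaussian to centre y; the substitution x = y + t z
  then absorbs the power of t.\<close>

lemma gauss_average:
  fixes f :: "real ^ 'n::finite \<Rightarrow> complex"
  assumes f: "integrable lborel f" and t: "0 < t"
  shows "(\<integral>\<xi>. fourier f \<xi> * (plane_wave (- y) \<xi> * of_real (damping t \<xi>)) \<partial>lborel) =
    of_real (fourier_const TYPE('n)) * (\<integral>z. f (y + t *\<^sub>R z) * of_real (gauss z) \<partial>lborel)"
proof -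
  have [measurable]: "f \<in> borel_measurable borel" using borel_measurable_integrable[OF f] by simp
  define g where "g \<xi> = plane_wave (- y) \<xi> * complex_of_real (damping t \<xi>)" for \<xi>
  have g: "integrable lborel g"
    using integrable_mult_plane_wave[OF integrable_damping, of t "- y"] t by (simp add: g_def[abs_def] mult.commute)
  have k: "case_prod (\<lambda>x \<xi>. plane_wave \<xi> x :: complex) \<in> borel_measurable (borel \<Otimes>\<^sub>M borel)"
    by measurable
  have inner: "(\<integral>\<xi>. plane_wave \<xi> x * g \<xi> \<partial>lborel) = fourier (\<lambda>\<xi>. of_real (damping t \<xi>)) (x - y)" for x
    unfolding fourier_plane_wave g_def
    by (intro Bochner_Integration.integral_cong refl, subst plane_wave_commute)
      (simp add: plane_wave_def algebra_simps flip: exp_add)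
  have "(\<integral>\<xi>. fourier f \<xi> * g \<xi> \<partial>lborel) = (\<integral>x. f x * (\<integral>\<xi>. plane_wave \<xi> x * g \<xi> \<partial>lborel) \<partial>lborel)"
    unfolding fourier_plane_wave by (rule Fubini_kernel[OF f g k, of 1]) simp
  also have "\<dots> = (\<integral>x. f x * fourier (\<lambda>\<xi>. of_real (damping t \<xi>)) (x - y) \<partial>lborel)"
    by (simp only: inner)
  also have "\<dots> = t ^ CARD('n) *\<^sub>R (\<integral>z. f (y + t *\<^sub>R z) * fourier (\<lambda>\<xi>. of_real (damping t \<xi>)) (y + t *\<^sub>R z - y) \<partial>lborel)"
    by (subst integral_affine_vec[of _ t y]) (use t in simp_all)
  also have "\<dots> = (\<integral>z. f (y + t *\<^sub>R z) * (t ^ CARD('n) *\<^sub>R fourier (\<lambda>\<xi>. of_real (damping t \<xi>)) (t *\<^sub>R z)) \<partial>lborel)"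
    by (simp flip: integral_scaleR_right)
  also have "\<dots> = (\<integral>z. of_real (fourier_const TYPE('n)) * (f (y + t *\<^sub>R z) * of_real (gauss z)) \<partial>lborel)"
    using t by (simp add: fourier_damping[OF t] mult_ac)
  finally show ?thesis by (simp add: g_def)
qed

lemma inverse_Suc_scaleR_tendsto: "(\<lambda>k. inverse (real (Suc k)) *\<^sub>R z) \<longlonglongrightarrow> (0 :: real ^ 'n)"
  using tendsto_scaleR[OF LIMSEQ_inverse_real_of_nat tendsto_const, of z] by simp

lemma damping_tendsto: "(\<lambda>k. damping (inverse (real (Suc k))) \<xi>) \<longlonglongrightarrow> 1"
proof -
  have "(\<lambda>k. exp (- (norm (inverse (real (Suc k)) *\<^sub>R \<xi>))\<^sup>2 / 2)) \<longlonglongrightarrow> exp (- (norm (0 :: real ^ 'a))\<^sup>2 / 2)"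
    by (intro tendsto_intros inverse_Suc_scaleR_tendsto) simp
  then show ?thesis by (simp add: damping_def)
qed

text \<open>Both sides are limits of the same damped integrals as t = 1/(k+1) tends to 0: dominated
  convergence removes the damping on one side and concentrates the Gaussian average at -y on the
  other.\<close>

lemma fourier_inversion:
  fixes \<phi> :: "real ^ 'n::finite \<Rightarrow> complex"
  assumes \<phi>: "\<phi> \<in> schwartz_functions"
  shows "fourier (fourier \<phi>) y = of_real (fourier_const TYPE('n)) * \<phi> (- y)"
proof (rule LIMSEQ_unique)
  have [measurable]: "\<phi> \<in> borel_measurable borel" "fourier \<phi> \<in> borel_measurable borel"
    by (rule schwartz_measurable[OF \<phi>], rule schwartz_measurable[OF schwartz_fourier[OF \<phi>]])
  let ?t = "\<lambda>k. inverse (real (Suc k))"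
  let ?I = "\<lambda>k. \<integral>\<xi>. fourier \<phi> \<xi> * (plane_wave y \<xi> * of_real (damping (?t k) \<xi>)) \<partial>lborel"
  show "?I \<longlonglongrightarrow> fourier (fourier \<phi>) y"
    unfolding fourier_plane_wave[of "fourier \<phi>"]
  proof (rule integral_dominated_convergence)
    show "integrable lborel (\<lambda>\<xi>. norm (fourier \<phi> \<xi>))"
      by (intro integrable_norm schwartz_integrable schwartz_fourier \<phi>)
    show "AE \<xi> in lborel. (\<lambda>k. fourier \<phi> \<xi> * (plane_wave y \<xi> * of_real (damping (?t k) \<xi>))) \<longlonglongrightarrow>
        fourier \<phi> \<xi> * plane_wave y \<xi>"
    proof (intro AE_I2)
      fix \<xi>
      have "(\<lambda>k. fourier \<phi> \<xi> * (plane_wave y \<xi> * of_real (damping (?t k) \<xi>))) \<longlonglongrightarrow>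
          fourier \<phi> \<xi> * (plane_wave y \<xi> * of_real 1)"
        by (intro tendsto_intros damping_tendsto)
      then show "(\<lambda>k. fourier \<phi> \<xi> * (plane_wave y \<xi> * of_real (damping (?t k) \<xi>))) \<longlonglongrightarrow>
          fourier \<phi> \<xi> * plane_wave y \<xi>" by simp
    qed
    show "AE \<xi> in lborel. norm (fourier \<phi> \<xi> * (plane_wave y \<xi> * of_real (damping (?t k) \<xi>))) \<le> norm (fourier \<phi> \<xi>)" for k
      by (intro AE_I2) (simp add: norm_mult mult_left_le damping_nonneg damping_le_1)
  qed measurable
  have I: "?I k = of_real (fourier_const TYPE('n)) * (\<integral>z. \<phi> (- y + ?t k *\<^sub>R z) * of_real (gauss z) \<partial>lborel)" for k
    using gauss_average[OF schwartz_integrable[OF \<phi>], of "?t k" "- y"] by simp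
  obtain C where C: "\<And>x. norm (mi_monomial 0 x *\<^sub>R \<phi> x) \<le> C" using schwartz_bounded[OF \<phi>] by blast
  have C': "norm (\<phi> x) \<le> C" for x using C[of x] by (simp add: mi_monomial_def)
  have "(\<lambda>k. \<integral>z. \<phi> (- y + ?t k *\<^sub>R z) * of_real (gauss z) \<partial>lborel) \<longlonglongrightarrow>
      (\<integral>z. \<phi> (- y) * of_real (gauss (z :: real ^ 'n)) \<partial>lborel)"
  proof (rule integral_dominated_convergence)
    show "integrable lborel (\<lambda>z. C * norm (complex_of_real (gauss z)))"
      by (intro integrable_mult_right integrable_norm integrable_gauss)
    show "AE z in lborel. norm (\<phi> (- y + ?t k *\<^sub>R z) * of_real (gauss z)) \<le> C * norm (complex_of_real (gauss z))" for k
      by (intro AE_I2) (simp only: norm_mult, intro mult_right_mono C' norm_ge_zero)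
    show "AE z in lborel. (\<lambda>k. \<phi> (- y + ?t k *\<^sub>R z) * of_real (gauss z)) \<longlonglongrightarrow> \<phi> (- y) * of_real (gauss z)"
    proof (intro AE_I2 tendsto_mult tendsto_const)
      fix z
      have "isCont \<phi> (- y)"
        using smooth_continuous[OF schwartz_smooth[OF \<phi>], of UNIV] by (simp add: continuous_on_eq_continuous_at)
      moreover have "(\<lambda>k. - y + ?t k *\<^sub>R z) \<longlonglongrightarrow> - y"
        using tendsto_add[OF tendsto_const inverse_Suc_scaleR_tendsto, of "- y" z] by simp
      ultimately show "(\<lambda>k. \<phi> (- y + ?t k *\<^sub>R z)) \<longlonglongrightarrow> \<phi> (- y)"
        by (rule isCont_tendsto_compose)
    qed
  qed measurable
  from tendsto_mult[OF tendsto_const this]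
  show "?I \<longlonglongrightarrow> of_real (fourier_const TYPE('n)) * \<phi> (- y)"
    unfolding I by (simp add: integral_gauss)
qed

text \<open>By inversion a reflection is a multiple of the transform applied twice, so no separate
  computation with derivatives is required.\<close>

lemma schwartz_reflect:
  assumes \<phi>: "\<phi> \<in> schwartz_functions"
  shows "(\<lambda>x. \<phi> (- x)) \<in> schwartz_functions"
proof -
  have "(\<lambda>x. inverse (of_real (fourier_const TYPE('a))) * fourier (fourier \<phi>) x) \<in> schwartz_functions"
    by (intro schwartz_cmult schwartz_fourier \<phi>)
  then show ?thesis
    using fourier_const_pos[where 'n = 'a] by (simp add: fourier_inversion[OF \<phi>] mult.assoc[symmetric])
qed

lemma fourier_surj:
  assumes \<phi>: "\<phi> \<in> schwartz_functions"
  obtains \<psi> where "\<psi> \<in> schwartz_functions" "\<phi> = fourier \<psi>"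
proof
  let ?\<psi> = "\<lambda>x. inverse (of_real (fourier_const TYPE('a))) * fourier (\<lambda>x. \<phi> (- x)) x"
  show "?\<psi> \<in> schwartz_functions"
    by (intro schwartz_cmult schwartz_fourier schwartz_reflect \<phi>)
  show "\<phi> = fourier ?\<psi>"
    using fourier_const_pos[where 'n = 'a]
    by (intro ext, subst fourier_cmult)
      (simp add: fourier_inversion[OF schwartz_reflect[OF \<phi>]] mult.assoc[symmetric])
qed

section \<open>The Fourier transform on square integrable functions\<close>

lemma nn_integral_Fatou:
  assumes [measurable]: "\<And>k. u k \<in> borel_measurable M"
    and lim: "AE x in M. (\<lambda>k. u k x) \<longlonglongrightarrow> v x"
    and le: "\<And>k. (\<integral>\<^sup>+x. u k x \<partial>M) \<le> B"
  shows "(\<integral>\<^sup>+x. v x \<partial>M) \<le> B"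
proof -
  have "(\<integral>\<^sup>+x. v x \<partial>M) = (\<integral>\<^sup>+x. liminf (\<lambda>k. u k x) \<partial>M)"
    using lim by (intro nn_integral_cong_AE) (auto simp: lim_imp_Liminf)
  also have "\<dots> \<le> liminf (\<lambda>k. \<integral>\<^sup>+x. u k x \<partial>M)"
    by (rule nn_integral_liminf) measurable
  also have "\<dots> \<le> liminf (\<lambda>k. B)"
    by (intro Liminf_mono always_eventually allI le)
  finally show ?thesis by (simp add: Liminf_const)
qed

text \<open>If f is not integrable, its integral takes the default value 0 and the estimate is
  trivial.\<close>

lemma norm_integral_le_nn_integral:
  fixes f :: "'a \<Rightarrow> complex"
  shows "ennreal (norm (\<integral>x. f x \<partial>M)) \<le> (\<integral>\<^sup>+x. ennreal (norm (f x)) \<partial>M)"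
  by (cases "integrable M f") (simp_all add: integral_norm_bound_ennreal not_integrable_integral_eq)

text \<open>Damping the left-hand side by a Gaussian turns it into a pairing of \<open>f\<close> with its own
  Gaussian average, which is estimated by \<open>2ab \<le> a\<^sup>2 + b\<^sup>2\<close>.\<close>

lemma plancherel_le:
  fixes f :: "real ^ 'n::finite \<Rightarrow> complex"
  assumes f: "integrable lborel f"
  shows "(\<integral>\<^sup>+\<xi>. ennreal ((norm (fourier f \<xi>))\<^sup>2) \<partial>lborel) \<le>
    ennreal (fourier_const TYPE('n)) * (\<integral>\<^sup>+x. ennreal ((norm (f x))\<^sup>2) \<partial>lborel)"
proof -
  have [measurable]: "f \<in> borel_measurable borel" using borel_measurable_integrable[OF f] by simp
  \<comment> \<open>\<open>N\<close> may be infinite: f is only assumed integrable, so the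
    comparison takes place in \<open>ennreal\<close>.\<close>
  define N where "N = (\<integral>\<^sup>+x. ennreal ((norm (f x))\<^sup>2) \<partial>lborel)"
  let ?\<kappa> = "fourier_const TYPE('n)"
  let ?F = "fourier f"
  have J: "(\<integral>\<^sup>+\<xi>. ennreal ((norm (?F \<xi>))\<^sup>2 * damping t \<xi>) \<partial>lborel) \<le> ennreal ?\<kappa> * N" if t: "0 < t" for t
  proof -
    define g where "g \<xi> = ?F \<xi> * complex_of_real (damping t \<xi>)" for \<xi>
    define A where "A = (\<integral>x. norm (f x) \<partial>lborel)"
    have A: "norm (?F \<xi>) \<le> A" for \<xi> unfolding A_def by (rule norm_fourier_le)
    have A0: "0 \<le> A" by (simp add: A_def)
    have dn: "norm (complex_of_real (damping t \<xi>)) = damping t \<xi>" for \<xi> :: "real ^ 'n"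
      by (simp add: damping_nonneg)
    have g: "integrable lborel g"
    proof (rule Bochner_Integration.integrable_bound)
      show "integrable lborel (\<lambda>\<xi> :: real ^ 'n. of_real A * complex_of_real (damping t \<xi>))"
        by (intro integrable_mult_right integrable_damping) (use t in simp)
      show "AE \<xi> in lborel. norm (g \<xi>) \<le> norm (of_real A * complex_of_real (damping t \<xi>))"
        using A A0 by (intro AE_I2) (simp add: g_def norm_mult mult_right_mono)
    qed (unfold g_def, measurable)
    have F2_eq: "cnj (?F \<xi>) * g \<xi> = of_real ((norm (?F \<xi>))\<^sup>2 * damping t \<xi>)" for \<xi>
      by (simp only: g_def of_real_mult complex_norm_square mult_ac)
    have F2: "integrable lborel (\<lambda>\<xi>. cnj (?F \<xi>) * g \<xi>)"
    proof (rule Bochner_Integration.integrable_bound)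
      show "integrable lborel (\<lambda>\<xi>. of_real A * g \<xi>)" by (intro integrable_mult_right g)
      show "AE \<xi> in lborel. norm (cnj (?F \<xi>) * g \<xi>) \<le> norm (of_real A * g \<xi>)"
        using A A0 by (intro AE_I2) (simp add: norm_mult mult_right_mono)
      show "(\<lambda>\<xi>. cnj (?F \<xi>) * g \<xi>) \<in> borel_measurable lborel"
        unfolding F2_eq by measurable
    qed
    have cF: "cnj (?F \<xi>) = (\<integral>y. cnj (f y) * plane_wave (- \<xi>) y \<partial>lborel)" for \<xi>
      unfolding fourier_plane_wave by (simp add: cnj_plane_wave flip: Bochner_Integration.integral_cnj)
    have k: "case_prod (\<lambda>y \<xi>. plane_wave (- \<xi>) y :: complex) \<in> borel_measurable (borel \<Otimes>\<^sub>M borel)"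
      by measurable
    have cf: "integrable lborel (\<lambda>y. cnj (f y))" using f by simp
    have inner: "(\<integral>\<xi>. plane_wave (- \<xi>) y * g \<xi> \<partial>lborel) =
        of_real ?\<kappa> * (\<integral>z. f (y + t *\<^sub>R z) * of_real (gauss z) \<partial>lborel)" for y
    proof -
      have "plane_wave (- \<xi>) y * g \<xi> = ?F \<xi> * (plane_wave (- y) \<xi> * of_real (damping t \<xi>))" for \<xi>
        by (subst plane_wave_minus[symmetric], subst plane_wave_commute) (simp add: g_def mult_ac)
      then show ?thesis by (simp only: gauss_average[OF f t])
    qed
    \<comment> \<open>Of the two factors of |F|^2 only the conjugated one is expanded as an
      integral. After exchanging the order, the frequency integral is the left-hand side of
      \<open>gauss_average\<close>.\<close>
    have eq: "(\<integral>\<xi>. cnj (?F \<xi>) * g \<xi> \<partial>lborel) =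
        (\<integral>y. cnj (f y) * (of_real ?\<kappa> * (\<integral>z. f (y + t *\<^sub>R z) * of_real (gauss z) \<partial>lborel)) \<partial>lborel)"
      unfolding cF inner[symmetric] by (rule Fubini_kernel[OF cf g k, of 1]) simp
    have "(\<integral>\<^sup>+\<xi>. ennreal ((norm (?F \<xi>))\<^sup>2 * damping t \<xi>) \<partial>lborel) =
        (\<integral>\<^sup>+\<xi>. ennreal (norm (cnj (?F \<xi>) * g \<xi>)) \<partial>lborel)"
      by (intro nn_integral_cong) (simp add: F2_eq damping_nonneg norm_mult norm_power)
    also have "\<dots> = ennreal (\<integral>\<xi>. norm (cnj (?F \<xi>) * g \<xi>) \<partial>lborel)"
      by (rule nn_integral_eq_integral) (use F2 in auto)
    also have "(\<integral>\<xi>. norm (cnj (?F \<xi>) * g \<xi>) \<partial>lborel) = norm (\<integral>\<xi>. cnj (?F \<xi>) * g \<xi> \<partial>lborel)"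
    proof -
      have "norm (cnj (?F \<xi>) * g \<xi>) = (norm (?F \<xi>))\<^sup>2 * damping t \<xi>" for \<xi>
        unfolding F2_eq norm_of_real using damping_nonneg[of t \<xi>] by simp
      then show ?thesis
        unfolding F2_eq integral_complex_of_real norm_of_real
        by (simp add: integral_nonneg_AE damping_nonneg)
    qed
    also have "ennreal \<dots> \<le> (\<integral>\<^sup>+y. ennreal (norm (cnj (f y) *
        (of_real ?\<kappa> * (\<integral>z. f (y + t *\<^sub>R z) * of_real (gauss z) \<partial>lborel)))) \<partial>lborel)"
      unfolding eq by (rule norm_integral_le_nn_integral)
    also have "\<dots> = (\<integral>\<^sup>+y. ennreal ?\<kappa> * (ennreal (norm (f y)) *
        ennreal (norm (\<integral>z. f (y + t *\<^sub>R z) * of_real (gauss z) \<partial>lborel))) \<partial>lborel)"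
      using fourier_const_pos[where 'n = 'n]
      by (intro nn_integral_cong) (simp add: norm_mult mult_ac flip: ennreal_mult)
    also have "\<dots> \<le> (\<integral>\<^sup>+y. ennreal ?\<kappa> * (ennreal (norm (f y)) *
        (\<integral>\<^sup>+z. ennreal (norm (f (y + t *\<^sub>R z) * of_real (gauss z))) \<partial>lborel)) \<partial>lborel)"
      by (intro nn_integral_mono mult_left_mono norm_integral_le_nn_integral zero_le)
    also have "\<dots> = ennreal ?\<kappa> * (\<integral>\<^sup>+y. (\<integral>\<^sup>+z. ennreal (norm (f y)) *
        ennreal (norm (f (y + t *\<^sub>R z) * of_real (gauss z))) \<partial>lborel) \<partial>lborel)"
      by (simp add: nn_integral_cmult)
    also have "\<dots> \<le> ennreal ?\<kappa> * (\<integral>\<^sup>+y. (\<integral>\<^sup>+z. ennreal (1/2) * (ennreal ((norm (f y))\<^sup>2) * ennreal (gauss z) +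
        ennreal ((norm (f (y + t *\<^sub>R z)))\<^sup>2) * ennreal (gauss z)) \<partial>lborel) \<partial>lborel)"
    proof (intro mult_left_mono nn_integral_mono zero_le)
      fix y z :: "real ^ 'n"
      have "norm (f y) * norm (f (y + t *\<^sub>R z)) \<le> 1/2 * ((norm (f y))\<^sup>2 + (norm (f (y + t *\<^sub>R z)))\<^sup>2)"
        using sum_squares_bound[of "norm (f y)" "norm (f (y + t *\<^sub>R z))"] by simp
      then have "(norm (f y) * norm (f (y + t *\<^sub>R z))) * gauss z \<le>
          1/2 * ((norm (f y))\<^sup>2 + (norm (f (y + t *\<^sub>R z)))\<^sup>2) * gauss z"
        by (rule mult_right_mono[OF _ gauss_nonneg])
      then show "ennreal (norm (f y)) * ennreal (norm (f (y + t *\<^sub>R z) * of_real (gauss z))) \<le>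
          ennreal (1/2) * (ennreal ((norm (f y))\<^sup>2) * ennreal (gauss z) +
            ennreal ((norm (f (y + t *\<^sub>R z)))\<^sup>2) * ennreal (gauss z))"
        using gauss_nonneg[of z]
        by (simp only: norm_mult norm_of_real abs_of_nonneg ennreal_mult[symmetric] ennreal_plus[symmetric]
            mult_nonneg_nonneg norm_ge_zero zero_le_power2 add_nonneg_nonneg zero_le_divide_1_iff zero_le_numeral)
          (rule ennreal_leI, simp add: algebra_simps)
    qed
    also have "(\<integral>\<^sup>+y. (\<integral>\<^sup>+z. ennreal (1/2) * (ennreal ((norm (f y))\<^sup>2) * ennreal (gauss z) +
        ennreal ((norm (f (y + t *\<^sub>R z)))\<^sup>2) * ennreal (gauss z)) \<partial>lborel) \<partial>lborel) =
      ennreal (1/2) * ((\<integral>\<^sup>+y. (\<integral>\<^sup>+z. ennreal ((norm (f y))\<^sup>2) * ennreal (gauss (z :: real ^ 'n)) \<partial>lborel) \<partial>lborel) +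
        (\<integral>\<^sup>+y. (\<integral>\<^sup>+z. ennreal ((norm (f (y + t *\<^sub>R z)))\<^sup>2) * ennreal (gauss z) \<partial>lborel) \<partial>lborel))"
    proof -
      have [measurable]: "(\<lambda>y. \<integral>\<^sup>+z. ennreal ((norm (f y))\<^sup>2) * ennreal (gauss (z :: real ^ 'n)) \<partial>lborel) \<in> borel_measurable borel"
        "(\<lambda>y. \<integral>\<^sup>+z. ennreal ((norm (f (y + t *\<^sub>R z)))\<^sup>2) * ennreal (gauss z) \<partial>lborel) \<in> borel_measurable borel"
        by measurable
      have pointwise: "(\<integral>\<^sup>+z. ennreal (1/2) * (ennreal ((norm (f y))\<^sup>2) * ennreal (gauss z) +
          ennreal ((norm (f (y + t *\<^sub>R z)))\<^sup>2) * ennreal (gauss z)) \<partial>lborel) =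
        ennreal (1/2) * ((\<integral>\<^sup>+z. ennreal ((norm (f y))\<^sup>2) * ennreal (gauss (z :: real ^ 'n)) \<partial>lborel) +
          (\<integral>\<^sup>+z. ennreal ((norm (f (y + t *\<^sub>R z)))\<^sup>2) * ennreal (gauss z) \<partial>lborel))" for y
        by (subst nn_integral_cmult, measurable, subst nn_integral_add, measurable)
      show ?thesis
        unfolding pointwise by (subst nn_integral_cmult, measurable, subst nn_integral_add, measurable)
    qed
    also have "(\<integral>\<^sup>+y. (\<integral>\<^sup>+z. ennreal ((norm (f y))\<^sup>2) * ennreal (gauss (z :: real ^ 'n)) \<partial>lborel) \<partial>lborel) = N"
      by (simp add: nn_integral_cmult nn_integral_gauss N_def)
    \<comment> \<open>With the y-integral innermost, translation invariance removes the shift t z,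
      so this half equals N as well.\<close>
    also have "(\<integral>\<^sup>+y. (\<integral>\<^sup>+z. ennreal ((norm (f (y + t *\<^sub>R z)))\<^sup>2) * ennreal (gauss z) \<partial>lborel) \<partial>lborel) =
        (\<integral>\<^sup>+z. (\<integral>\<^sup>+y. ennreal ((norm (f (y + t *\<^sub>R z)))\<^sup>2) * ennreal (gauss z) \<partial>lborel) \<partial>lborel)"
      by (rule lborel_pair.Fubini') measurable
    also have "\<dots> = (\<integral>\<^sup>+z. N * ennreal (gauss (z :: real ^ 'n)) \<partial>lborel)"
      unfolding N_def
      by (intro nn_integral_cong, subst nn_integral_multc)
        (simp_all add: nn_integral_translate[of "\<lambda>x. ennreal ((norm (f x))\<^sup>2)"])
    also have "\<dots> = N" by (simp add: nn_integral_cmult nn_integral_gauss)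
    also have "ennreal (1/2) * (N + N) = N"
    proof -
      have "ennreal (1/2) * (N + N) = (ennreal (1/2) * ennreal 2) * N"
        by (simp only: mult_2[symmetric] mult.assoc[symmetric] ennreal_numeral)
      also have "ennreal (1/2) * ennreal 2 = 1"
        by (subst ennreal_mult[symmetric]) simp_all
      finally show ?thesis by simp
    qed
    finally show ?thesis .
  qed
  \<comment> \<open>The bound \<open>J\<close> does not depend on t, so the damping can be removed
    by Fatou's lemma.\<close>
  show ?thesis
    unfolding N_def[symmetric]
  proof (rule nn_integral_Fatou)
    show "(\<integral>\<^sup>+\<xi>. ennreal ((norm (?F \<xi>))\<^sup>2 * damping (inverse (real (Suc k))) \<xi>) \<partial>lborel) \<le> ennreal ?\<kappa> * N" for k
      by (rule J) simp
    show "AE \<xi> in lborel. (\<lambda>k. ennreal ((norm (?F \<xi>))\<^sup>2 * damping (inverse (real (Suc k))) \<xi>)) \<longlonglongrightarrow> ennreal ((norm (?F \<xi>))\<^sup>2)"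
    proof (intro AE_I2 tendsto_ennrealI)
      fix \<xi> :: "real ^ 'n"
      show "(\<lambda>k. (norm (?F \<xi>))\<^sup>2 * damping (inverse (real (Suc k))) \<xi>) \<longlonglongrightarrow> (norm (?F \<xi>))\<^sup>2"
        using tendsto_mult[OF tendsto_const damping_tendsto, of "(norm (?F \<xi>))\<^sup>2" \<xi>] by simp
    qed
  qed measurable
qed

section \<open>Square integrable functions and fast convergence\<close>

definition l2sq :: "(real ^ 'n::finite \<Rightarrow> complex) \<Rightarrow> ennreal" where
  "l2sq f = (\<integral>\<^sup>+x. ennreal ((norm (f x))\<^sup>2) \<partial>lborel)"

lemma square_integrable_measurable: "square_integrable f \<Longrightarrow> f \<in> borel_measurable borel"
  by (simp add: square_integrable_def)

lemma square_integrable_l2sq: "square_integrable f \<longleftrightarrow> f \<in> borel_measurable borel \<and> l2sq f < \<infinity>"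
  by (simp add: square_integrable_def l2sq_def)

lemma square_integrable_integrable:
  assumes "square_integrable f"
  shows "integrable lborel (\<lambda>x. (norm (f x))\<^sup>2)"
proof (rule integrableI_bounded)
  have [measurable]: "f \<in> borel_measurable borel" by (rule square_integrable_measurable[OF assms])
  show "(\<lambda>x. (norm (f x))\<^sup>2) \<in> borel_measurable lborel" by measurable
  show "(\<integral>\<^sup>+x. ennreal (norm ((norm (f x))\<^sup>2)) \<partial>lborel) < \<infinity>"
    using assms by (simp add: square_integrable_def)
qed

lemma l2sq_eq_integral:
  "square_integrable f \<Longrightarrow> l2sq f = ennreal (\<integral>x. (norm (f x))\<^sup>2 \<partial>lborel)"
  unfolding l2sq_def by (intro nn_integral_eq_integral square_integrable_integrable) auto

text \<open>A weighted form of 2ab \<le> a^2 + b^2. The free parameter replaces the Cauchy-Schwarz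
  inequality: with c = 2^k it turns squared norms of size 4^-k into bounds of size 2^-k.\<close>

lemma norm_mult_le_sum_squares:
  fixes a b :: complex
  assumes "0 < (c :: real)"
  shows "norm (a * b) \<le> c * (norm a)\<^sup>2 + inverse c * (norm b)\<^sup>2"
proof -
  have "0 \<le> c * (norm a - inverse c * norm b)\<^sup>2" using assms by simp
  also have "\<dots> = c * (norm a)\<^sup>2 + inverse c * (norm b)\<^sup>2 - 2 * norm (a * b)"
    using assms by (simp add: power2_eq_square field_simps norm_mult)
  finally show ?thesis using norm_ge_zero[of "a * b"] by linarith
qed

lemma integrable_mult_L2:
  assumes f: "square_integrable f" and g: "square_integrable g"
  shows "integrable lborel (\<lambda>x. f x * g x)"
proof (rule Bochner_Integration.integrable_bound)
  have [measurable]: "f \<in> borel_measurable borel" "g \<in> borel_measurable borel"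
    using f g by (auto intro: square_integrable_measurable)
  show "integrable lborel (\<lambda>x. 1 * (norm (f x))\<^sup>2 + inverse 1 * (norm (g x))\<^sup>2)"
    by (intro Bochner_Integration.integrable_add integrable_mult_right square_integrable_integrable f g)
  show "AE x in lborel. norm (f x * g x) \<le> norm (1 * (norm (f x))\<^sup>2 + inverse 1 * (norm (g x))\<^sup>2)"
    using norm_mult_le_sum_squares[of 1] by (intro AE_I2) (simp only: real_norm_def, rule order_trans[OF _ abs_ge_self], simp)
  show "(\<lambda>x. f x * g x) \<in> borel_measurable lborel" by measurable
qed

lemma norm_add_sq_le: "(norm (a + b :: complex))\<^sup>2 \<le> 2 * (norm a)\<^sup>2 + 2 * (norm b)\<^sup>2"
proof -
  have "(norm (a + b))\<^sup>2 \<le> (norm a + norm b)\<^sup>2" by (intro power_mono norm_triangle_ineq) auto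
  also have "\<dots> \<le> 2 * (norm a)\<^sup>2 + 2 * (norm b)\<^sup>2"
    using sum_squares_bound[of "norm a" "norm b"] by (simp add: power2_sum)
  finally show ?thesis .
qed

lemma l2sq_add_le:
  assumes [measurable]: "f \<in> borel_measurable borel" "g \<in> borel_measurable borel"
  shows "l2sq (\<lambda>x. f x + g x) \<le> 2 * l2sq f + 2 * l2sq g"
proof -
  have "l2sq (\<lambda>x. f x + g x) \<le> (\<integral>\<^sup>+x. 2 * ennreal ((norm (f x))\<^sup>2) + 2 * ennreal ((norm (g x))\<^sup>2) \<partial>lborel)"
    unfolding l2sq_def
  proof (rule nn_integral_mono)
    fix x
    have "ennreal ((norm (f x + g x))\<^sup>2) \<le> ennreal (2 * (norm (f x))\<^sup>2 + 2 * (norm (g x))\<^sup>2)"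
      by (rule ennreal_leI[OF norm_add_sq_le])
    then show "ennreal ((norm (f x + g x))\<^sup>2) \<le> 2 * ennreal ((norm (f x))\<^sup>2) + 2 * ennreal ((norm (g x))\<^sup>2)"
      by (simp add: ennreal_mult)
  qed
  then show ?thesis by (simp add: nn_integral_add nn_integral_cmult l2sq_def)
qed

lemma l2sq_cmult:
  assumes [measurable]: "f \<in> borel_measurable borel"
  shows "l2sq (\<lambda>x. c * f x) = ennreal ((norm c)\<^sup>2) * l2sq f"
  by (simp add: l2sq_def norm_mult power_mult_distrib ennreal_mult nn_integral_cmult)

lemma square_integrable_add:
  assumes "square_integrable f" "square_integrable g"
  shows "square_integrable (\<lambda>x. f x + g x)"
  using l2sq_add_le[of f g] assms
  by (auto simp: square_integrable_l2sq ennreal_mult_less_top intro: order.strict_trans1)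

lemma square_integrable_cmult: "square_integrable f \<Longrightarrow> square_integrable (\<lambda>x. c * f x)"
  by (auto simp: square_integrable_l2sq l2sq_cmult ennreal_mult_less_top)

lemma square_integrable_diff:
  "square_integrable f \<Longrightarrow> square_integrable g \<Longrightarrow> square_integrable (\<lambda>x. f x - g x)"
  using square_integrable_add[of f "\<lambda>x. (-1) * g x"] square_integrable_cmult[of g "-1"] by simp

lemma square_integrable_bounded_mult:
  assumes f: "square_integrable f" and [measurable]: "g \<in> borel_measurable borel"
    and B: "\<And>x. norm (g x) \<le> B"
  shows "square_integrable (\<lambda>x. g x * f x)"
proof -
  have [measurable]: "f \<in> borel_measurable borel" by (rule square_integrable_measurable[OF f])
  have B0: "0 \<le> B" using norm_ge_zero B by (rule order_trans)
  have "l2sq (\<lambda>x. g x * f x) \<le> l2sq (\<lambda>x. of_real B * f x)"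
    unfolding l2sq_def using B B0
    by (intro nn_integral_mono ennreal_leI power_mono) (auto simp: norm_mult intro!: mult_right_mono)
  also have "\<dots> < \<infinity>" using square_integrable_cmult[OF f, of "of_real B"] by (simp add: square_integrable_l2sq)
  finally show ?thesis by (simp add: square_integrable_l2sq)
qed

text \<open>Taking the weight 2^k in the previous inequality, the part with u contributes B * 2^k *
  4^-k and the part with v contributes 2^-k times its squared norm; both decay like 2^-k.\<close>

lemma pairing_tendsto_0:
  assumes u: "\<And>k. square_integrable (u k)" and v: "square_integrable v"
    and le: "\<And>k. l2sq (u k) \<le> ennreal (B * (1/4) ^ k)" and B: "0 \<le> B"
  shows "(\<lambda>k. \<integral>x. u k x * v x \<partial>lborel) \<longlonglongrightarrow> 0"
proof (rule Lim_null_comparison)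
  define N where "N = (\<integral>x. (norm (v x))\<^sup>2 \<partial>lborel)"
  have bound: "norm (\<integral>x. u k x * v x \<partial>lborel) \<le> (B + N) * (1/2) ^ k" for k
  proof -
    have "norm (\<integral>x. u k x * v x \<partial>lborel) \<le>
        (\<integral>x. 2 ^ k * (norm (u k x))\<^sup>2 + inverse (2 ^ k) * (norm (v x))\<^sup>2 \<partial>lborel)"
      by (intro norm_integral_le integrable_mult_L2 u v norm_mult_le_sum_squares
          Bochner_Integration.integrable_add integrable_mult_right square_integrable_integrable) simp
    also have "\<dots> = 2 ^ k * (\<integral>x. (norm (u k x))\<^sup>2 \<partial>lborel) + inverse (2 ^ k) * N"
      using square_integrable_integrable[OF u] square_integrable_integrable[OF v] by (simp add: N_def)
    also have "\<dots> \<le> 2 ^ k * (B * (1/4) ^ k) + inverse (2 ^ k) * N"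
      using le[of k] B unfolding l2sq_eq_integral[OF u]
      by (intro add_right_mono mult_left_mono) (auto simp: ennreal_le_iff)
    also have "\<dots> = (B + N) * (1/2) ^ k"
    proof -
      have "(4::real) ^ k = 2 ^ k * 2 ^ k" by (simp flip: power_mult_distrib)
      then show ?thesis by (simp add: field_simps power_one_over)
    qed
    finally show ?thesis .
  qed
  show "\<forall>\<^sub>F k in sequentially. norm (\<integral>x. u k x * v x \<partial>lborel) \<le> (B + N) * (1/2) ^ k"
    by (intro always_eventually allI bound)
  show "(\<lambda>k. (B + N) * (1/2) ^ k) \<longlonglongrightarrow> 0"
    by (intro tendsto_mult_right_zero LIMSEQ_realpow_zero) auto
qed

text \<open>Summability of \<open>2\<^sup>k \<bar>d\<^sub>k\<bar>\<^sup>2\<close> almost everywhere gives summability of \<open>\<bar>d\<^sub>k\<bar> \<le> 2\<^sup>k \<bar>d\<^sub>k\<bar>\<^sup>2 + 2\<^sup>-\<^sup>k\<close>.\<close>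

lemma L2_fast_Cauchy_convergent:
  fixes g :: "nat \<Rightarrow> real ^ 'n::finite \<Rightarrow> complex"
  assumes [measurable]: "\<And>k. g k \<in> borel_measurable borel"
    and le: "\<And>k. l2sq (\<lambda>x. g (Suc k) x - g k x) \<le> ennreal (B * (1/4) ^ k)" and B: "0 \<le> B"
  shows "AE x in lborel. convergent (\<lambda>k. g k x)"
proof -
  define d where "d k x = g (Suc k) x - g k x" for k x
  have [measurable]: "d k \<in> borel_measurable borel" for k unfolding d_def by measurable
  have "(\<integral>\<^sup>+x. (\<Sum>k. ennreal (2 ^ k * (norm (d k x))\<^sup>2)) \<partial>lborel) =
      (\<Sum>k. \<integral>\<^sup>+x. ennreal (2 ^ k * (norm (d k x))\<^sup>2) \<partial>lborel)"
    by (rule nn_integral_suminf) measurable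
  \<comment> \<open>The rate 4^-k in the hypothesis leaves a summable 2^-k after the loss of the
    factor 2^k.\<close>
  also have "\<dots> \<le> (\<Sum>k. ennreal (B * (1/2) ^ k))"
  proof (intro suminf_le allI summableI)
    fix k
    have "(\<integral>\<^sup>+x. ennreal (2 ^ k * (norm (d k x))\<^sup>2) \<partial>lborel) = ennreal (2 ^ k) * l2sq (d k)"
      by (simp add: ennreal_mult nn_integral_cmult l2sq_def)
    also have "\<dots> \<le> ennreal (2 ^ k) * ennreal (B * (1/4) ^ k)"
      using le[of k] by (intro mult_left_mono) (auto simp: d_def[abs_def])
    also have "\<dots> = ennreal (2 ^ k * (B * (1/4) ^ k))"
      using B by (intro ennreal_mult[symmetric]) auto
    also have "2 ^ k * (B * (1/4) ^ k) = B * (1/2) ^ k"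
      by (simp add: power_mult_distrib[symmetric] mult.left_commute)
    finally show "(\<integral>\<^sup>+x. ennreal (2 ^ k * (norm (d k x))\<^sup>2) \<partial>lborel) \<le> ennreal (B * (1/2) ^ k)" .
  qed
  also have "\<dots> = ennreal (\<Sum>k. B * (1/2) ^ k)"
    using B by (intro suminf_ennreal2 summable_mult summable_geometric) auto
  also have "\<dots> < \<infinity>" by simp
  finally have "AE x in lborel. (\<Sum>k. ennreal (2 ^ k * (norm (d k x))\<^sup>2)) \<noteq> \<infinity>"
    by (intro nn_integral_PInf_AE) auto
  then show ?thesis
  proof eventually_elim
    case (elim x)
    then have "summable (\<lambda>k. 2 ^ k * (norm (d k x))\<^sup>2)"
      by (intro summable_suminf_not_top) auto
    then have "summable (\<lambda>k. 2 ^ k * (norm (d k x))\<^sup>2 + (1/2) ^ k)"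
      by (intro summable_add summable_geometric) auto
    then have "summable (\<lambda>k. d k x)"
    proof (rule summable_comparison_test'[where N = 0])
      fix k
      show "norm (d k x) \<le> 2 ^ k * (norm (d k x))\<^sup>2 + (1/2) ^ k"
        using norm_mult_le_sum_squares[of "2 ^ k" "d k x" 1] by (simp add: power_one_over inverse_eq_divide)
    qed
    then have "convergent (\<lambda>n. \<Sum>k<n. d k x)" by (simp add: summable_iff_convergent)
    then have "convergent (\<lambda>n. (\<Sum>k<n. d k x) + g 0 x)" by (intro convergent_add convergent_const)
    moreover have "(\<Sum>k<n. d k x) + g 0 x = g n x" for n
      using sum_lessThan_telescope[of "\<lambda>k. g k x" n] by (simp add: d_def)
    ultimately show ?case by simp
  qed
qed

text \<open>A relation, since g is determined up to null sets only. The pairing condition says that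
  g represents the tempered transform of f; a function integrable as well as square integrable meets
  it with its classical transform, by \<open>fourier_multiplication\<close>.\<close>

definition L2_fourier :: "(real ^ 'n::finite \<Rightarrow> complex) \<Rightarrow> (real ^ 'n \<Rightarrow> complex) \<Rightarrow> bool" where
  "L2_fourier f g \<longleftrightarrow> square_integrable f \<and> square_integrable g \<and>
    (\<forall>\<phi>\<in>schwartz_functions. (\<integral>x. f x * fourier \<phi> x \<partial>lborel) = (\<integral>x. g x * \<phi> x \<partial>lborel))"

lemma fourier_diff:
  assumes "integrable lborel f" "integrable lborel g"
  shows "fourier (\<lambda>x. f x - g x) \<xi> = fourier f \<xi> - fourier g \<xi>"
  unfolding fourier_plane_wave
  using integrable_mult_plane_wave[OF assms(1)] integrable_mult_plane_wave[OF assms(2)]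
  by (simp add: left_diff_distrib)

text \<open>The tails tend to 0 by dominated convergence. Radii are selected to reach the rate 4^-k,
  as \<open>L2_fast_Cauchy_convergent\<close> and \<open>pairing_tendsto_0\<close> demand.\<close>

lemma truncation_radii:
  fixes f :: "real ^ 'n::finite \<Rightarrow> complex"
  assumes f: "square_integrable f"
  obtains m :: "nat \<Rightarrow> nat" where
    "\<And>k. (\<integral>\<^sup>+x. ennreal ((norm (f x))\<^sup>2) * indicator {x. real (m k) \<le> norm x} x \<partial>lborel) \<le> ennreal ((1/4) ^ k)"
proof -
  have [measurable]: "f \<in> borel_measurable borel" by (rule square_integrable_measurable[OF f])
  let ?T = "\<lambda>m::nat. \<integral>\<^sup>+x. ennreal ((norm (f x))\<^sup>2) * indicator {x. real m \<le> norm x} x \<partial>lborel"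
  have "?T \<longlonglongrightarrow> (\<integral>\<^sup>+(x :: real ^ 'n). 0 \<partial>lborel)"
  proof (rule nn_integral_dominated_convergence)
    show "(\<integral>\<^sup>+x. ennreal ((norm (f x))\<^sup>2) \<partial>lborel) < \<infinity>" using f by (simp add: square_integrable_def)
    show "AE x in lborel. ennreal ((norm (f x))\<^sup>2) * indicator {x. real m \<le> norm x} x \<le> ennreal ((norm (f x))\<^sup>2)" for m
      by (intro AE_I2) (auto split: split_indicator)
    show "AE x in lborel. (\<lambda>m. ennreal ((norm (f x))\<^sup>2) * indicator {x. real m \<le> norm x} x) \<longlonglongrightarrow> 0"
    proof (intro AE_I2 tendsto_eventually)
      fix x :: "real ^ 'n"
      obtain M where M: "norm x < real M" using reals_Archimedean2 by blast
      show "\<forall>\<^sub>F m in sequentially. ennreal ((norm (f x))\<^sup>2) * indicator {x. real m \<le> norm x} x = 0"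
        using eventually_ge_at_top[of M] by eventually_elim (use M in \<open>auto split: split_indicator\<close>)
    qed
  qed measurable
  then have T0: "?T \<longlonglongrightarrow> 0" by simp
  have "\<exists>m. ?T m \<le> ennreal ((1/4) ^ k)" for k
  proof -
    have "\<forall>\<^sub>F m in sequentially. ?T m < ennreal ((1/4) ^ k)"
      by (rule order_tendstoD(2)[OF T0]) simp
    then obtain m where "?T m < ennreal ((1/4) ^ k)" using eventually_happens by force
    then show ?thesis by (intro exI[of _ m]) simp
  qed
  then have "\<exists>m. \<forall>k. ?T (m k) \<le> ennreal ((1/4) ^ k)" by (rule choice[OF allI])
  then show thesis using that by blast
qed

text \<open>The transform of \<open>f\<close> is the limit of the transforms of its truncations to balls.\<close>

lemma L2_fourier_exists_le:
  fixes f :: "real ^ 'n::finite \<Rightarrow> complex"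
  assumes f: "square_integrable f"
  shows "\<exists>g. L2_fourier f g \<and> l2sq g \<le> ennreal (fourier_const TYPE('n)) * l2sq f"
proof -
  have [measurable]: "f \<in> borel_measurable borel" by (rule square_integrable_measurable[OF f])
  let ?\<kappa> = "fourier_const TYPE('n)"
  have \<kappa>0: "0 \<le> ?\<kappa>" using fourier_const_pos[where 'n = 'n] by simp
  obtain m where m: "\<And>k. (\<integral>\<^sup>+x. ennreal ((norm (f x))\<^sup>2) * indicator {x. real (m k) \<le> norm x} x \<partial>lborel)
      \<le> ennreal ((1/4) ^ k)"
    using truncation_radii[OF f] by blast
  define h where "h k x = indicator {x. norm x < real (m k)} x * f x" for k x
  define g where "g k = fourier (h k)" for k
  have h_sq: "square_integrable (h k)" for k
    unfolding h_def by (rule square_integrable_bounded_mult[OF f, where B = 1]) (auto split: split_indicator)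
  have [measurable]: "h k \<in> borel_measurable borel" "g k \<in> borel_measurable borel" for k
    unfolding g_def h_def by measurable
  have h_int: "integrable lborel (h k)" for k
  proof -
    let ?A = "{x :: real ^ 'n. norm x < real (m k)}"
    have "emeasure lborel ?A < \<infinity>"
      using emeasure_bounded_finite[of ?A] by (auto simp: bounded_iff intro: less_imp_le)
    moreover have "ennreal ((norm (indicator ?A x :: complex))\<^sup>2) = indicator ?A x" for x
      by (simp split: split_indicator)
    ultimately have "square_integrable (\<lambda>x :: real ^ 'n. indicator ?A x)"
      by (simp add: square_integrable_def)
    from integrable_mult_L2[OF this f] show ?thesis by (simp add: h_def[abs_def])
  qed
  have tail: "l2sq (\<lambda>x. f x - h k x) \<le> ennreal ((1/4) ^ k)" for k
  proof -
    have "l2sq (\<lambda>x. f x - h k x) = (\<integral>\<^sup>+x. ennreal ((norm (f x))\<^sup>2) * indicator {x. real (m k) \<le> norm x} x \<partial>lborel)"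
      unfolding l2sq_def h_def by (intro nn_integral_cong) (auto split: split_indicator)
    with m show ?thesis by simp
  qed
  \<comment> \<open>The difference of two truncations is a difference of two tails of f. Each tail
    is at most 4^-k in squared norm, and the squared triangle inequality doubles both, hence the
    4.\<close>
  have diff: "l2sq (\<lambda>x. g l x - g k x) \<le> ennreal (4 * ?\<kappa> * (1/4) ^ k)" if "k \<le> l" for k l
  proof -
    have "l2sq (\<lambda>x. g l x - g k x) = l2sq (fourier (\<lambda>x. h l x - h k x))"
    proof -
      have "fourier (\<lambda>x. h l x - h k x) = (\<lambda>x. g l x - g k x)"
        unfolding g_def by (rule ext, rule fourier_diff[OF h_int h_int])
      then show ?thesis by simp
    qed
    also have "\<dots> \<le> ennreal ?\<kappa> * l2sq (\<lambda>x. h l x - h k x)"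
      unfolding l2sq_def by (intro plancherel_le Bochner_Integration.integrable_diff h_int)
    also have "\<dots> \<le> ennreal ?\<kappa> * (2 * l2sq (\<lambda>x. f x - h k x) + 2 * l2sq (\<lambda>x. (-1) * (f x - h l x)))"
      using l2sq_add_le[of "\<lambda>x. f x - h k x" "\<lambda>x. (-1) * (f x - h l x)"]
      by (intro mult_left_mono) simp_all
    also have "\<dots> \<le> ennreal ?\<kappa> * (2 * ennreal ((1/4) ^ k) + 2 * ennreal ((1/4) ^ k))"
    proof (intro mult_left_mono add_mono tail)
      have "l2sq (\<lambda>x. (-1) * (f x - h l x)) = l2sq (\<lambda>x. f x - h l x)"
        by (subst l2sq_cmult) simp_all
      also have "\<dots> \<le> ennreal ((1/4) ^ l)" by (rule tail)
      also have "\<dots> \<le> ennreal ((1/4) ^ k)" using that by (intro ennreal_leI power_decreasing) auto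
      finally show "l2sq (\<lambda>x. (-1) * (f x - h l x)) \<le> ennreal ((1/4) ^ k)" .
    qed auto
    also have "2 * ennreal ((1/4) ^ k) + 2 * ennreal ((1/4) ^ k) = ennreal (4 * (1/4) ^ k)"
    proof -
      have "2 * ennreal ((1/4) ^ k) = ennreal (2 * (1/4) ^ k)" by (simp add: ennreal_mult)
      then show ?thesis by (simp flip: ennreal_plus)
    qed
    also have "ennreal ?\<kappa> * ennreal (4 * (1/4) ^ k) = ennreal (4 * ?\<kappa> * (1/4) ^ k)"
      using \<kappa>0 by (simp add: mult_ac flip: ennreal_mult)
    finally show ?thesis .
  qed
  define G where "G x = lim (\<lambda>k. g k x)" for x
  have [measurable]: "G \<in> borel_measurable borel" unfolding G_def by measurable
  have "AE x in lborel. convergent (\<lambda>k. g k x)"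
    using \<kappa>0 by (intro L2_fast_Cauchy_convergent[where B = "4 * ?\<kappa>"] diff) auto
  then have lim: "AE x in lborel. (\<lambda>k. g k x) \<longlonglongrightarrow> G x"
    by eventually_elim (simp add: convergent_LIMSEQ_iff G_def)
  have G_diff: "l2sq (\<lambda>x. G x - g k x) \<le> ennreal (4 * ?\<kappa> * (1/4) ^ k)" for k
    unfolding l2sq_def
  proof (rule nn_integral_Fatou)
    show "AE x in lborel. (\<lambda>l. ennreal ((norm (g (l + k) x - g k x))\<^sup>2)) \<longlonglongrightarrow> ennreal ((norm (G x - g k x))\<^sup>2)"
      using lim
    proof eventually_elim
      case (elim x)
      then show ?case by (intro tendsto_ennrealI tendsto_intros LIMSEQ_ignore_initial_segment)
    qed
    show "(\<integral>\<^sup>+x. ennreal ((norm (g (l + k) x - g k x))\<^sup>2) \<partial>lborel) \<le> ennreal (4 * ?\<kappa> * (1/4) ^ k)" for l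
      using diff[of k "l + k"] by (simp add: l2sq_def)
  qed measurable
  have G_le: "l2sq G \<le> ennreal ?\<kappa> * l2sq f"
    unfolding l2sq_def[of G]
  proof (rule nn_integral_Fatou)
    show "AE x in lborel. (\<lambda>k. ennreal ((norm (g k x))\<^sup>2)) \<longlonglongrightarrow> ennreal ((norm (G x))\<^sup>2)"
      using lim by eventually_elim (intro tendsto_ennrealI tendsto_intros)
    show "(\<integral>\<^sup>+x. ennreal ((norm (g k x))\<^sup>2) \<partial>lborel) \<le> ennreal ?\<kappa> * l2sq f" for k
    proof -
      have "(\<integral>\<^sup>+x. ennreal ((norm (g k x))\<^sup>2) \<partial>lborel) \<le> ennreal ?\<kappa> * l2sq (h k)"
        unfolding g_def l2sq_def by (rule plancherel_le[OF h_int])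
      also have "\<dots> \<le> ennreal ?\<kappa> * l2sq f"
        unfolding l2sq_def h_def
        by (intro mult_left_mono nn_integral_mono ennreal_leI) (auto split: split_indicator)
      finally show ?thesis .
    qed
  qed measurable
  also have "\<dots> < \<infinity>" using f by (simp add: square_integrable_l2sq ennreal_mult_less_top)
  finally have G_sq: "square_integrable G" by (simp add: square_integrable_l2sq)
  have g_sq: "square_integrable (g k)" for k
  proof -
    have "l2sq (g k) \<le> ennreal ?\<kappa> * l2sq (h k)"
      unfolding g_def l2sq_def by (rule plancherel_le[OF h_int])
    also have "\<dots> < \<infinity>" using h_sq[of k] by (simp add: square_integrable_l2sq ennreal_mult_less_top)
    finally show ?thesis by (simp add: square_integrable_l2sq)
  qed
  \<comment> \<open>For the integrable truncations the multiplication formula is available, and both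
    pairings are limits of the truncated ones.\<close>
  have "(\<integral>x. f x * fourier \<phi> x \<partial>lborel) = (\<integral>x. G x * \<phi> x \<partial>lborel)" if \<phi>: "\<phi> \<in> schwartz_functions" for \<phi>
  proof (rule LIMSEQ_unique)
    note \<phi>2 = schwartz_square_integrable[OF \<phi>] and F2 = schwartz_square_integrable[OF schwartz_fourier[OF \<phi>]]
    have "(\<lambda>k. \<integral>x. (f x - h k x) * fourier \<phi> x \<partial>lborel) \<longlonglongrightarrow> 0"
      using tail by (intro pairing_tendsto_0[where B = 1] square_integrable_diff f h_sq F2) auto
    moreover have "(\<integral>x. (f x - h k x) * fourier \<phi> x \<partial>lborel) =
        (\<integral>x. f x * fourier \<phi> x \<partial>lborel) - (\<integral>x. h k x * fourier \<phi> x \<partial>lborel)" for k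
      by (simp add: left_diff_distrib integrable_mult_L2 f h_sq F2)
    ultimately have "(\<lambda>k. (\<integral>x. f x * fourier \<phi> x \<partial>lborel) - (\<integral>x. h k x * fourier \<phi> x \<partial>lborel)) \<longlonglongrightarrow> 0"
      by simp
    from tendsto_diff[OF tendsto_const[of "\<integral>x. f x * fourier \<phi> x \<partial>lborel"] this]
    show "(\<lambda>k. \<integral>x. h k x * fourier \<phi> x \<partial>lborel) \<longlonglongrightarrow> (\<integral>x. f x * fourier \<phi> x \<partial>lborel)"
      by simp
    have "(\<lambda>k. \<integral>x. (G x - g k x) * \<phi> x \<partial>lborel) \<longlonglongrightarrow> 0"
      using \<kappa>0 by (intro pairing_tendsto_0[where B = "4 * ?\<kappa>"] square_integrable_diff G_sq g_sq \<phi>2 G_diff) auto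
    moreover have "(\<integral>x. (G x - g k x) * \<phi> x \<partial>lborel) = (\<integral>x. G x * \<phi> x \<partial>lborel) - (\<integral>x. h k x * fourier \<phi> x \<partial>lborel)" for k
    proof -
      have "(\<integral>x. (G x - g k x) * \<phi> x \<partial>lborel) = (\<integral>x. G x * \<phi> x \<partial>lborel) - (\<integral>x. g k x * \<phi> x \<partial>lborel)"
        by (simp add: left_diff_distrib integrable_mult_L2 G_sq g_sq \<phi>2)
      then show ?thesis
        unfolding g_def by (simp only: fourier_multiplication[OF h_int schwartz_integrable[OF \<phi>]])
    qed
    ultimately have "(\<lambda>k. (\<integral>x. G x * \<phi> x \<partial>lborel) - (\<integral>x. h k x * fourier \<phi> x \<partial>lborel)) \<longlonglongrightarrow> 0"
      by simp
    from tendsto_diff[OF tendsto_const[of "\<integral>x. G x * \<phi> x \<partial>lborel"] this]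
    show "(\<lambda>k. \<integral>x. h k x * fourier \<phi> x \<partial>lborel) \<longlonglongrightarrow> (\<integral>x. G x * \<phi> x \<partial>lborel)"
      by simp
  qed
  with f G_sq have "L2_fourier f G" by (simp add: L2_fourier_def)
  with G_le show ?thesis by blast
qed

section \<open>The fundamental lemma of the calculus of variations\<close>

text \<open>The function t^-j * exp(-1/t), extended by 0 to t \<le> 0. The exponent j is carried
  along because differentiation leads from j to a combination of j + 1 and j + 2, so the whole
  family is closed under derivatives.\<close>

definition flat :: "nat \<Rightarrow> real \<Rightarrow> real" where
  "flat j t = (if 0 < t then inverse t ^ j / exp (inverse t) else 0)"

lemma flat_tendsto_0: "(flat j \<longlongrightarrow> 0) (at 0)"
proof -
  have "((\<lambda>t. inverse t ^ j / exp (inverse t)) \<longlongrightarrow> (0::real)) (at_right 0)"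
    by (rule filterlim_compose[OF tendsto_power_div_exp_0 filterlim_inverse_at_top_right])
  then have "(flat j \<longlongrightarrow> 0) (at_right 0)"
    by (rule Lim_transform_eventually) (auto simp: flat_def eventually_at_filter)
  moreover have "(flat j \<longlongrightarrow> 0) (at_left 0)"
    by (rule tendsto_eventually) (auto simp: flat_def eventually_at_filter)
  ultimately show ?thesis by (intro filterlim_split_at)
qed

lemma DERIV_flat: "(flat j has_real_derivative (- real j * flat (Suc j) t + flat (Suc (Suc j)) t)) (at t)"
proof -
  consider "t > 0" | "t < 0" | "t = 0" by linarith
  then show ?thesis
  proof cases
    case 1
    have "((\<lambda>t. inverse t ^ j * exp (- inverse t)) has_real_derivative
        (real j * (- (inverse t ^ Suc (Suc 0)) * inverse t ^ (j - Suc 0))) * exp (- inverse t)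
          + exp (- inverse t) * - (- (inverse t ^ Suc (Suc 0))) * inverse t ^ j) (at t)"
      using 1 by (intro DERIV_mult DERIV_power DERIV_inverse DERIV_fun_exp DERIV_minus) auto
    also have "(real j * (- (inverse t ^ Suc (Suc 0)) * inverse t ^ (j - Suc 0))) * exp (- inverse t)
          + exp (- inverse t) * - (- (inverse t ^ Suc (Suc 0))) * inverse t ^ j =
        - real j * flat (Suc j) t + flat (Suc (Suc j)) t"
      using 1 by (cases j) (simp_all add: flat_def exp_minus divide_inverse algebra_simps)
    finally show ?thesis
      by (rule has_field_derivative_transform_within_open[where S = "{0<..}"])
        (use 1 in \<open>auto simp: flat_def exp_minus divide_inverse\<close>)
  next
    case 2
    have "((\<lambda>t. 0) has_real_derivative (- real j * flat (Suc j) t + flat (Suc (Suc j)) t)) (at t)"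
      using 2 by (simp add: flat_def)
    then show ?thesis
      by (rule has_field_derivative_transform_within_open[where S = "{..<0}"])
        (use 2 in \<open>auto simp: flat_def\<close>)
  next
    case 3
    \<comment> \<open>At the origin the difference quotient of \<open>flat j\<close> is
      \<open>flat (Suc j)\<close>, which tends to 0.\<close>
    have "((\<lambda>h. (flat j (0 + h) - flat j 0) / h) \<longlongrightarrow> 0) (at 0)"
      by (rule Lim_transform_eventually[OF flat_tendsto_0[of "Suc j"]])
        (auto simp: flat_def eventually_at_filter field_simps)
    then show ?thesis using 3 by (simp add: DERIV_def flat_def)
  qed
qed

lemma smooth_flat: "smooth (\<lambda>x. complex_of_real (flat j (c * x $ l + d)))"
proof -
  have der: "((\<lambda>x. complex_of_real (flat j (c * x $ l + d))) has_derivative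
      (\<lambda>h. complex_of_real (c * h $ l * (- real j * flat (Suc j) (c * x $ l + d) + flat (Suc (Suc j)) (c * x $ l + d))))) (at x)"
    for j and x :: "real ^ 'a"
  proof -
    have "((\<lambda>x. c * x $ l + d) has_derivative (\<lambda>h. c * h $ l + 0)) (at x)"
      by (intro has_derivative_add has_derivative_const bounded_linear_imp_has_derivative
          bounded_linear_compose[OF bounded_linear_mult_right] bounded_linear_vec_nth)
    from DERIV_compose_FDERIV[OF DERIV_flat this, of j]
    have "((\<lambda>x. flat j (c * x $ l + d)) has_derivative
      (\<lambda>h. c * h $ l * (- real j * flat (Suc j) (c * x $ l + d) + flat (Suc (Suc j)) (c * x $ l + d)))) (at x)"
      by simp
    from bounded_linear.has_derivative[OF bounded_linear_of_real this] show ?thesis .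
  qed
  have "C_k k (\<lambda>x :: real ^ 'a. complex_of_real (flat j (c * x $ l + d)))" for k j
  proof (induction k arbitrary: j)
    case 0
    show ?case
      unfolding C_k.simps continuous_on_eq_continuous_at[OF open_UNIV]
      using has_derivative_continuous[OF der[of j]] by blast
  next
    case (Suc k)
    define r where "r i = (if i = l then c else 0)" for i
    have eq: "partial i (\<lambda>x. complex_of_real (flat j (c * x $ l + d))) =
        (\<lambda>x. of_real (r i * - real j) * of_real (flat (Suc j) (c * x $ l + d))
          + of_real (r i) * of_real (flat (Suc (Suc j)) (c * x $ l + d)))" for i
      by (rule ext, subst partial_eqI[OF der]) (auto simp: axis_def r_def algebra_simps)
    have const: "C_k k (\<lambda>x :: real ^ 'a. a)" for a
      using smooth_const unfolding smooth_def by blast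
    have "(\<lambda>x. complex_of_real (flat j (c * x $ l + d))) differentiable (at x)" for x :: "real ^ 'a"
      using der[of j x] unfolding differentiable_def by blast
    then show ?case
      unfolding C_k.simps(2) eq
      by (intro conjI allI C_k_add C_k_mult const Suc.IH)
  qed
  then show ?thesis by (simp add: smooth_def)
qed

lemma flat_nonneg: "0 \<le> flat j t"
  by (simp add: flat_def)

lemma flat_0_le_1: "flat 0 t \<le> 1"
  by (simp add: flat_def)

lemma flat_tendsto_1:
  assumes "0 < s"
  shows "(\<lambda>k. flat 0 (real (Suc k) * s)) \<longlonglongrightarrow> 1"
proof -
  have "(\<lambda>k. inverse (exp (inverse (real (Suc k)) * inverse s))) \<longlonglongrightarrow> inverse (exp (0 * inverse s))"
    by (intro tendsto_intros LIMSEQ_inverse_real_of_nat) simp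
  then show ?thesis
    using assms by (simp add: flat_def divide_inverse)
qed

text \<open>Each factor is exp(-1/((k+1)*s)), where s > 0 is the distance to one face of the box.
  Stretching by k + 1 sends it to 1 inside, while the support stays in the closed box for all
  k.\<close>

definition box_bump :: "real ^ 'n::finite \<Rightarrow> real ^ 'n \<Rightarrow> nat \<Rightarrow> real ^ 'n \<Rightarrow> real" where
  "box_bump a b k x = (\<Prod>i\<in>UNIV. flat 0 (real (Suc k) * (x $ i - a $ i)) * flat 0 (real (Suc k) * (b $ i - x $ i)))"

lemma box_bump_bounds: "0 \<le> box_bump a b k x" "box_bump a b k x \<le> 1"
  unfolding box_bump_def
  by (auto intro!: prod_nonneg prod_le_1 mult_nonneg_nonneg mult_le_one simp: flat_nonneg flat_0_le_1)

lemma box_bump_nonzero: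
  assumes "box_bump a b k x \<noteq> 0"
  shows "x \<in> box a b"
  unfolding mem_box_cart
proof
  fix i
  have "flat 0 (real (Suc k) * (x $ i - a $ i)) \<noteq> 0" "flat 0 (real (Suc k) * (b $ i - x $ i)) \<noteq> 0"
    using assms by (auto simp: box_bump_def)
  then have "0 < real (Suc k) * (x $ i - a $ i)" "0 < real (Suc k) * (b $ i - x $ i)"
    unfolding flat_def by (metis (full_types))+
  then show "a $ i < x $ i \<and> x $ i < b $ i"
    by (simp add: zero_less_mult_iff)
qed

lemma box_bump_test: "(\<lambda>x. complex_of_real (box_bump a b k x)) \<in> test_functions"
proof (rule test_functionI)
  have eq: "real (Suc k) * (x $ i - a $ i) = real (Suc k) * x $ i + - (real (Suc k) * a $ i)"
    "real (Suc k) * (b $ i - x $ i) = - real (Suc k) * x $ i + real (Suc k) * b $ i" for x i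
    by (simp_all add: algebra_simps)
  have "smooth (\<lambda>x. complex_of_real (flat 0 (real (Suc k) * (x $ i - a $ i))) *
      complex_of_real (flat 0 (real (Suc k) * (b $ i - x $ i))))" for i
    unfolding eq by (intro smooth_mult smooth_flat)
  from smooth_prod[OF finite this] show "smooth (\<lambda>x. complex_of_real (box_bump a b k x))"
    unfolding box_bump_def of_real_prod of_real_mult .
  show "x \<in> cbox a b" if "complex_of_real (box_bump a b k x) \<noteq> 0" for x
    using box_bump_nonzero[of a b k x] that box_subset_cbox by auto
  show "compact (cbox a b)" by (rule compact_cbox)
qed

lemma box_bump_tendsto: "(\<lambda>k. box_bump a b k x) \<longlonglongrightarrow> indicator (box a b) x"
proof (cases "x \<in> box a b")
  case True
  have "(\<lambda>k. box_bump a b k x) \<longlonglongrightarrow> (\<Prod>i\<in>(UNIV :: 'a set). 1 * 1)"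
    unfolding box_bump_def using True
    by (intro tendsto_prod tendsto_mult flat_tendsto_1) (auto simp: mem_box_cart)
  with True show ?thesis by simp
next
  case False
  then have "box_bump a b k x = 0" for k using box_bump_nonzero by blast
  with False show ?thesis by simp
qed

text \<open>The positive and negative parts of u are densities of two measures that agree on open
  boxes, an intersection stable generator of the Borel sets, so the densities agree almost
  everywhere. At each point one of the two parts is 0, hence both are.\<close>

lemma AE_zero_if_box_integrals_zero:
  fixes u :: "real ^ 'n::finite \<Rightarrow> real"
  assumes [measurable]: "u \<in> borel_measurable borel"
    and int: "\<And>a b. integrable lborel (\<lambda>x. indicator (box a b) x * u x)"
    and zero: "\<And>a b. (\<integral>x. indicator (box a b) x * u x \<partial>lborel) = 0"
  shows "AE x in lborel. u x = 0"
proof -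
  define p q where "p x = max 0 (u x)" and "q x = max 0 (- u x)" for x
  have [measurable]: "p \<in> borel_measurable borel" "q \<in> borel_measurable borel"
    unfolding p_def q_def by measurable
  have int_p: "integrable lborel (\<lambda>x. indicator (box a b) x * p x)"
    and int_q: "integrable lborel (\<lambda>x. indicator (box a b) x * q x)" for a b
    by (rule Bochner_Integration.integrable_bound[OF int[of a b]]; auto simp: p_def q_def split: split_indicator)+
  have em: "emeasure (density lborel (\<lambda>x. ennreal (f x))) (box a b) = ennreal (\<integral>x. indicator (box a b) x * f x \<partial>lborel)"
    if [measurable]: "f \<in> borel_measurable borel" and "\<And>x. 0 \<le> f x"
      and "integrable lborel (\<lambda>x. indicator (box a b) x * f x)" for f a b
  proof -
    have "emeasure (density lborel (\<lambda>x. ennreal (f x))) (box a b) =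
        (\<integral>\<^sup>+x. ennreal (indicator (box a b) x * f x) \<partial>lborel)"
      by (subst emeasure_density) (auto intro!: nn_integral_cong split: split_indicator)
    also have "\<dots> = ennreal (\<integral>x. indicator (box a b) x * f x \<partial>lborel)"
      using that by (intro nn_integral_eq_integral) auto
    finally show ?thesis .
  qed
  have eq: "(\<integral>x. indicator (box a b) x * p x \<partial>lborel) = (\<integral>x. indicator (box a b) x * q x \<partial>lborel)" for a b
  proof -
    have "(\<integral>x. indicator (box a b) x * p x \<partial>lborel) - (\<integral>x. indicator (box a b) x * q x \<partial>lborel) =
        (\<integral>x. indicator (box a b) x * u x \<partial>lborel)"
      unfolding Bochner_Integration.integral_diff[OF int_p int_q, symmetric]
      by (intro Bochner_Integration.integral_cong) (auto simp: p_def q_def split: split_indicator)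
    with zero[of a b] show ?thesis by simp
  qed
  have "density lborel (\<lambda>x. ennreal (p x)) = density lborel (\<lambda>x. ennreal (q x))"
  proof (rule measure_eqI_generator_eq)
    let ?E = "range (\<lambda>(a, b). box a b :: (real ^ 'n) set)"
    show "Int_stable ?E" by (auto simp: Int_stable_def box_Int_box)
    show "?E \<subseteq> Pow UNIV" by simp
    show "sets (density lborel (\<lambda>x. ennreal (p x))) = sigma_sets UNIV ?E"
      "sets (density lborel (\<lambda>x. ennreal (q x))) = sigma_sets UNIV ?E"
      by (simp_all add: borel_eq_box)
    let ?A = "\<lambda>n::nat. box (- (real n *\<^sub>R One)) (real n *\<^sub>R One) :: (real ^ 'n) set"
    show "range ?A \<subseteq> ?E" "(\<Union>i. ?A i) = UNIV" unfolding UN_box_eq_UNIV by auto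
    show "emeasure (density lborel (\<lambda>x. ennreal (p x))) (?A i) \<noteq> \<infinity>" for i
      by (subst em) (auto simp: p_def[abs_def] int_p[unfolded p_def])
    show "emeasure (density lborel (\<lambda>x. ennreal (p x))) X = emeasure (density lborel (\<lambda>x. ennreal (q x))) X"
      if "X \<in> ?E" for X
    proof -
      obtain a b where X: "X = box a b" using \<open>X \<in> ?E\<close> by auto
      have "0 \<le> p x" "0 \<le> q x" for x by (simp_all add: p_def q_def)
      then show ?thesis unfolding X by (simp add: em int_p int_q eq)
    qed
  qed
  then have "AE x in lborel. ennreal (p x) = ennreal (q x)"
    by (intro sigma_finite_measure.density_unique[OF sigma_finite_lborel]) measurable
  then show ?thesis
    by eventually_elim (auto simp: p_def q_def max_def split: if_splits)
qed

lemma locally_integrable_test: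
  assumes f: "locally_integrable f" and \<phi>: "\<phi> \<in> test_functions"
  shows "integrable lborel (\<lambda>x. f x * \<phi> x)"
proof -
  have [measurable]: "f \<in> borel_measurable borel" "\<phi> \<in> borel_measurable borel"
    using f schwartz_measurable test_subset_schwartz \<phi> by (auto simp: locally_integrable_def)
  obtain C where C: "\<And>x. norm (\<phi> x) \<le> C" using test_bounded[OF \<phi>] by blast
  let ?K = "closure {x. \<phi> x \<noteq> 0}"
  have "integrable lborel (\<lambda>x. of_real C * (indicator ?K x *\<^sub>R f x))"
    using f \<phi> by (intro integrable_mult_right)
      (auto simp: locally_integrable_def test_functions_def set_integrable_def)
  then show ?thesis
  proof (rule Bochner_Integration.integrable_bound)
    show "AE x in lborel. norm (f x * \<phi> x) \<le> norm (of_real C * (indicator ?K x *\<^sub>R f x))"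
    proof (intro AE_I2)
      fix x
      have "norm (f x * \<phi> x) \<le> C * norm (f x)"
        using mult_right_mono[OF C norm_ge_zero, of x "f x"] by (simp add: norm_mult mult.commute)
      moreover have "\<phi> x = 0" if "x \<notin> ?K" using that test_support[of \<phi> x] by blast
      moreover have "0 \<le> C" by (rule order_trans[OF norm_ge_zero C])
      ultimately show "norm (f x * \<phi> x) \<le> norm (of_real C * (indicator ?K x *\<^sub>R f x))"
        by (auto simp: norm_mult split: split_indicator)
    qed
  qed measurable
qed

text \<open>Indicators of boxes are bounded pointwise limits of test functions.\<close>

lemma locally_integrable_AE_eq:
  fixes f g :: "real ^ 'n::finite \<Rightarrow> complex"
  assumes f: "locally_integrable f" and g: "locally_integrable g"
    and eq: "\<And>\<phi>. \<phi> \<in> test_functions \<Longrightarrow> (\<integral>x. f x * \<phi> x \<partial>lborel) = (\<integral>x. g x * \<phi> x \<partial>lborel)"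
  shows "AE x in lborel. f x = g x"
proof -
  define h where "h x = f x - g x" for x
  have [measurable]: "f \<in> borel_measurable borel" "g \<in> borel_measurable borel"
    using f g by (auto simp: locally_integrable_def)
  have [measurable]: "h \<in> borel_measurable borel" unfolding h_def by measurable
  have zero: "(\<integral>x. h x * \<phi> x \<partial>lborel) = 0" if "\<phi> \<in> test_functions" for \<phi>
    using locally_integrable_test[OF f that] locally_integrable_test[OF g that] eq[OF that]
    by (simp add: h_def left_diff_distrib)
  have K: "integrable lborel (\<lambda>x. indicator K x *\<^sub>R h x)" if "compact K" for K
  proof -
    have "integrable lborel (\<lambda>x. indicator K x *\<^sub>R f x - indicator K x *\<^sub>R g x)"
      using f g that unfolding locally_integrable_def set_integrable_def
      by (intro Bochner_Integration.integrable_diff) auto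
    then show ?thesis by (simp add: h_def scaleR_diff_right)
  qed
  have box_int: "integrable lborel (\<lambda>x. of_real (indicator (box a b) x) * h x)" for a b
    by (rule Bochner_Integration.integrable_bound[OF K[OF compact_cbox[of a b]]])
      (use box_subset_cbox[of a b] in \<open>auto split: split_indicator\<close>)
  have box: "(\<integral>x. of_real (indicator (box a b) x) * h x \<partial>lborel) = 0" for a b
  proof -
    have "(\<lambda>k. \<integral>x. h x * of_real (box_bump a b k x) \<partial>lborel) \<longlonglongrightarrow> (\<integral>x. of_real (indicator (box a b) x) * h x \<partial>lborel)"
    proof (rule integral_dominated_convergence)
      show "integrable lborel (\<lambda>x. norm (indicator (cbox a b) x *\<^sub>R h x))"
        by (intro integrable_norm K compact_cbox)
      show "AE x in lborel. norm (h x * of_real (box_bump a b k x)) \<le> norm (indicator (cbox a b) x *\<^sub>R h x)" for k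
      proof (intro AE_I2)
        fix x
        have "box_bump a b k x = 0" if "x \<notin> cbox a b"
          using that box_bump_nonzero[of a b k x] box_subset_cbox by blast
        then show "norm (h x * of_real (box_bump a b k x)) \<le> norm (indicator (cbox a b) x *\<^sub>R h x)"
          using box_bump_bounds[of a b k x] by (auto simp: norm_mult mult_left_le split: split_indicator)
      qed
      show "AE x in lborel. (\<lambda>k. h x * of_real (box_bump a b k x)) \<longlonglongrightarrow> of_real (indicator (box a b) x) * h x"
      proof (intro AE_I2)
        fix x
        have "(\<lambda>k. h x * of_real (box_bump a b k x)) \<longlonglongrightarrow> h x * of_real (indicator (box a b) x)"
          by (intro tendsto_intros box_bump_tendsto)
        then show "(\<lambda>k. h x * of_real (box_bump a b k x)) \<longlonglongrightarrow> of_real (indicator (box a b) x) * h x"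
          by (simp add: mult.commute)
      qed
      show "(\<lambda>x. h x * of_real (box_bump a b k x)) \<in> borel_measurable lborel" for k
        unfolding box_bump_def flat_def by measurable
    qed measurable
    then show ?thesis
      by (simp add: zero[OF box_bump_test] LIMSEQ_const_iff)
  qed
  \<comment> \<open>Splitting into positive and negative parts requires real values, so real and
    imaginary parts are treated separately.\<close>
  have "AE x in lborel. Re (h x) = 0"
  proof (rule AE_zero_if_box_integrals_zero)
    show "integrable lborel (\<lambda>x. indicator (box a b) x * Re (h x))" for a b
      using integrable_Re[OF box_int[of a b]] by simp
    show "(\<integral>x. indicator (box a b) x * Re (h x) \<partial>lborel) = 0" for a b
      using arg_cong[OF box[of a b], of Re] integral_Re[OF box_int[of a b]] by simp
  qed measurable
  moreover have "AE x in lborel. Im (h x) = 0"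
  proof (rule AE_zero_if_box_integrals_zero)
    show "integrable lborel (\<lambda>x. indicator (box a b) x * Im (h x))" for a b
      using integrable_Im[OF box_int[of a b]] by simp
    show "(\<integral>x. indicator (box a b) x * Im (h x) \<partial>lborel) = 0" for a b
      using arg_cong[OF box[of a b], of Im] integral_Im[OF box_int[of a b]] by simp
  qed measurable
  ultimately show ?thesis
    by eventually_elim (simp add: h_def complex_eq_iff)
qed

lemma square_integrable_locally_integrable:
  fixes f :: "real ^ 'n::finite \<Rightarrow> complex"
  assumes f: "square_integrable f"
  shows "locally_integrable f"
  unfolding locally_integrable_def set_integrable_def
proof (intro conjI allI impI)
  show "f \<in> borel_measurable borel" by (rule square_integrable_measurable[OF f])
  fix K :: "(real ^ 'n) set" assume K: "compact K"
  then have [measurable]: "K \<in> sets borel" by (simp add: borel_compact)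
  have "ennreal ((norm (indicator K x :: complex))\<^sup>2) = indicator K x" for x
    by (simp split: split_indicator)
  then have "square_integrable (\<lambda>x. indicator K x)"
    using emeasure_compact_finite[OF K] by (simp add: square_integrable_def)
  from integrable_mult_L2[OF this f] have "integrable lborel (\<lambda>x. indicator K x * f x)" .
  moreover have "indicator K x * f x = indicator K x *\<^sub>R f x" for x
    by (simp split: split_indicator)
  ultimately show "integrable lborel (\<lambda>x. indicator K x *\<^sub>R f x)" by simp
qed

section \<open>Plancherel's theorem\<close>

lemma l2sq_cong_AE: "AE x in lborel. f x = g x \<Longrightarrow> l2sq f = l2sq g"
  unfolding l2sq_def by (intro nn_integral_cong_AE) auto

lemma L2_fourierD:
  assumes "L2_fourier f g"
  shows "square_integrable f" "square_integrable g"
    "\<phi> \<in> schwartz_functions \<Longrightarrow> (\<integral>x. f x * fourier \<phi> x \<partial>lborel) = (\<integral>x. g x * \<phi> x \<partial>lborel)"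
  using assms by (auto simp: L2_fourier_def)

lemma L2_fourier_unique:
  assumes "L2_fourier f g" "L2_fourier f h"
  shows "AE x in lborel. g x = h x"
proof (rule locally_integrable_AE_eq)
  show "locally_integrable g" "locally_integrable h"
    using L2_fourierD(2)[OF assms(1)] L2_fourierD(2)[OF assms(2)]
    by (auto intro: square_integrable_locally_integrable)
  show "(\<integral>x. g x * \<phi> x \<partial>lborel) = (\<integral>x. h x * \<phi> x \<partial>lborel)" if "\<phi> \<in> test_functions" for \<phi>
    using L2_fourierD(3)[OF assms(1), of \<phi>] L2_fourierD(3)[OF assms(2), of \<phi>] that test_subset_schwartz by auto
qed

lemma square_integrable_reflect:
  assumes f: "square_integrable f"
  shows "square_integrable (\<lambda>x. f (- x))"
proof -
  have [measurable]: "f \<in> borel_measurable borel" by (rule square_integrable_measurable[OF f])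
  show ?thesis
    using f nn_integral_reflect[of "\<lambda>x. ennreal ((norm (f x))\<^sup>2)"] by (simp add: square_integrable_def)
qed

lemma square_integrable_translate:
  assumes f: "square_integrable f"
  shows "square_integrable (\<lambda>x. f (x + a))"
proof -
  have [measurable]: "f \<in> borel_measurable borel" by (rule square_integrable_measurable[OF f])
  show ?thesis
    using f nn_integral_translate[of "\<lambda>x. ennreal ((norm (f x))\<^sup>2)"] by (simp add: square_integrable_def)
qed

text \<open>Testing the pairing against \<open>fourier \<phi>\<close> in place of \<phi> puts a
  double transform next to f, which inversion for Schwartz functions evaluates.\<close>

lemma L2_fourier_flip:
  fixes f g :: "real ^ 'n::finite \<Rightarrow> complex"
  assumes "L2_fourier f g"
  shows "L2_fourier g (\<lambda>x. of_real (fourier_const TYPE('n)) * f (- x))"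
  unfolding L2_fourier_def
proof (intro conjI ballI)
  note f = L2_fourierD(1)[OF assms]
  have [measurable]: "f \<in> borel_measurable borel" by (rule square_integrable_measurable[OF f])
  show "square_integrable g" by (rule L2_fourierD(2)[OF assms])
  show "square_integrable (\<lambda>x. of_real (fourier_const TYPE('n)) * f (- x))"
    by (intro square_integrable_cmult square_integrable_reflect f)
  fix \<phi> :: "real ^ 'n \<Rightarrow> complex" assume \<phi>: "\<phi> \<in> schwartz_functions"
  have [measurable]: "\<phi> \<in> borel_measurable borel" by (rule schwartz_measurable[OF \<phi>])
  have "(\<integral>x. g x * fourier \<phi> x \<partial>lborel) = (\<integral>x. f x * fourier (fourier \<phi>) x \<partial>lborel)"
    using L2_fourierD(3)[OF assms schwartz_fourier[OF \<phi>]] by simp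
  also have "\<dots> = (\<integral>x. (of_real (fourier_const TYPE('n)) * f x) * \<phi> (- x) \<partial>lborel)"
    by (simp add: fourier_inversion[OF \<phi>] mult_ac)
  also have "\<dots> = (\<integral>x. (of_real (fourier_const TYPE('n)) * f (- x)) * \<phi> (- (- x)) \<partial>lborel)"
    by (rule integral_reflect_vec[symmetric]) measurable
  finally show "(\<integral>x. g x * fourier \<phi> x \<partial>lborel) = (\<integral>x. (of_real (fourier_const TYPE('n)) * f (- x)) * \<phi> x \<partial>lborel)"
    by simp
qed

lemma fourier_reflect:
  fixes \<phi> :: "real ^ 'n::finite \<Rightarrow> complex"
  assumes [measurable]: "\<phi> \<in> borel_measurable borel"
  shows "fourier (\<lambda>x. \<phi> (- x)) \<xi> = fourier \<phi> (- \<xi>)"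
proof -
  have "fourier \<phi> (- \<xi>) = (\<integral>x. \<phi> (- x) * plane_wave (- \<xi>) (- x) \<partial>lborel)"
    unfolding fourier_plane_wave by (rule integral_reflect_vec[symmetric]) measurable
  then show ?thesis by (simp add: fourier_plane_wave plane_wave_minus)
qed

text \<open>The preimage is the inverse transform: the transform k of g, reflected and divided by
  the constant. Its pairing is checked by applying \<open>L2_fourier_flip\<close> to k.\<close>

lemma L2_fourier_surj:
  fixes g :: "real ^ 'n::finite \<Rightarrow> complex"
  assumes "square_integrable g"
  shows "\<exists>f. L2_fourier f g"
proof -
  let ?\<kappa> = "complex_of_real (fourier_const TYPE('n))"
  have \<kappa>: "?\<kappa> \<noteq> 0" using fourier_const_pos[where 'n = 'n] by simp
  obtain k where k: "L2_fourier g k" using L2_fourier_exists_le[OF assms] by blast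
  have [measurable]: "g \<in> borel_measurable borel" "k \<in> borel_measurable borel"
    by (auto intro!: square_integrable_measurable L2_fourierD[OF k])
  have "L2_fourier (\<lambda>x. inverse ?\<kappa> * k (- x)) g"
    unfolding L2_fourier_def
  proof (intro conjI ballI)
    show "square_integrable (\<lambda>x. inverse ?\<kappa> * k (- x))"
      by (intro square_integrable_cmult square_integrable_reflect L2_fourierD[OF k])
    show "square_integrable g" by fact
    fix \<phi> :: "real ^ 'n \<Rightarrow> complex" assume \<phi>: "\<phi> \<in> schwartz_functions"
    have [measurable]: "\<phi> \<in> borel_measurable borel" "fourier \<phi> \<in> borel_measurable borel"
      by (auto intro!: schwartz_measurable schwartz_fourier \<phi>)
    have "(\<integral>x. k (- x) * fourier \<phi> x \<partial>lborel) = (\<integral>x. k (- x) * fourier \<phi> (- (- x)) \<partial>lborel)" by simp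
    also have "\<dots> = (\<integral>x. k x * fourier \<phi> (- x) \<partial>lborel)"
      by (rule integral_reflect_vec) measurable
    also have "\<dots> = (\<integral>x. k x * fourier (\<lambda>x. \<phi> (- x)) x \<partial>lborel)" by (simp add: fourier_reflect)
    also have "\<dots> = (\<integral>x. (?\<kappa> * g (- x)) * \<phi> (- x) \<partial>lborel)"
      by (rule L2_fourierD(3)[OF L2_fourier_flip[OF k] schwartz_reflect[OF \<phi>]])
    also have "\<dots> = (\<integral>x. (?\<kappa> * g x) * \<phi> x \<partial>lborel)"
      by (rule integral_reflect_vec[of "\<lambda>x. (?\<kappa> * g x) * \<phi> x"]) measurable
    also have "\<dots> = ?\<kappa> * (\<integral>x. g x * \<phi> x \<partial>lborel)" by (simp add: mult.assoc)
    finally show "(\<integral>x. inverse ?\<kappa> * k (- x) * fourier \<phi> x \<partial>lborel) = (\<integral>x. g x * \<phi> x \<partial>lborel)"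
      using \<kappa> by (simp add: mult.assoc)
  qed
  then show ?thesis by blast
qed

lemma plancherel:
  fixes f g :: "real ^ 'n::finite \<Rightarrow> complex"
  assumes fg: "L2_fourier f g"
  shows "l2sq g = ennreal (fourier_const TYPE('n)) * l2sq f"
proof (rule antisym)
  let ?\<kappa> = "fourier_const TYPE('n)"
  have \<kappa>: "0 < ?\<kappa>" by (rule fourier_const_pos)
  \<comment> \<open>The existence lemma bounds one particular transform; uniqueness up to null sets
    transfers the bound to any other.\<close>
  have le: "l2sq h \<le> ennreal ?\<kappa> * l2sq f" if "L2_fourier f h" for f h :: "real ^ 'n \<Rightarrow> complex"
    using L2_fourier_exists_le[OF L2_fourierD(1)[OF that]] l2sq_cong_AE[OF L2_fourier_unique[OF that]]
    by force
  show "l2sq g \<le> ennreal ?\<kappa> * l2sq f" by (rule le[OF fg])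
  have [measurable]: "f \<in> borel_measurable borel"
    by (rule square_integrable_measurable[OF L2_fourierD(1)[OF fg]])
  have "l2sq (\<lambda>x. of_real ?\<kappa> * f (- x)) = ennreal (?\<kappa>\<^sup>2) * l2sq (\<lambda>x. f (- x))"
    using \<kappa> by (subst l2sq_cmult) simp_all
  also have "l2sq (\<lambda>x. f (- x)) = l2sq f"
    unfolding l2sq_def by (rule nn_integral_reflect[of "\<lambda>x. ennreal ((norm (f x))\<^sup>2)"]) measurable
  also have "ennreal (?\<kappa>\<^sup>2) = ennreal ?\<kappa> * ennreal ?\<kappa>"
    using \<kappa> by (simp add: power2_eq_square ennreal_mult)
  \<comment> \<open>The upper bound for the double transform contains the constant squared on the
    left and once on the right; a positive finite factor cancels.\<close>
  finally have "ennreal ?\<kappa> * (ennreal ?\<kappa> * l2sq f) \<le> ennreal ?\<kappa> * l2sq g"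
    using le[OF L2_fourier_flip[OF fg]] by (simp add: mult.assoc)
  then show "ennreal ?\<kappa> * l2sq f \<le> l2sq g"
    using \<kappa> by (subst (asm) ennreal_mult_le_mult_iff) auto
qed

text \<open>With the sign convention in force, \<open>plane_wave (- a) \<xi>\<close> is exp(i
  a.\<xi>). On the test side the same factor shifts the transform of \<phi> by a.\<close>

lemma L2_fourier_translate:
  fixes f g :: "real ^ 'n::finite \<Rightarrow> complex"
  assumes fg: "L2_fourier f g"
  shows "L2_fourier (\<lambda>x. f (x + a)) (\<lambda>\<xi>. plane_wave (- a) \<xi> * g \<xi>)"
  unfolding L2_fourier_def
proof (intro conjI ballI)
  show "square_integrable (\<lambda>x. f (x + a))"
    by (rule square_integrable_translate[OF L2_fourierD(1)[OF fg]])
  show "square_integrable (\<lambda>\<xi>. plane_wave (- a) \<xi> * g \<xi>)"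
    by (rule square_integrable_bounded_mult[OF L2_fourierD(2)[OF fg], where B = 1]) auto
  fix \<phi> :: "real ^ 'n \<Rightarrow> complex" assume \<phi>: "\<phi> \<in> schwartz_functions"
  have [measurable]: "f \<in> borel_measurable borel" "fourier \<phi> \<in> borel_measurable borel"
    by (rule square_integrable_measurable[OF L2_fourierD(1)[OF fg]],
        rule schwartz_measurable[OF schwartz_fourier[OF \<phi>]])
  have F: "fourier \<phi> (x - a) = fourier (\<lambda>y. \<phi> y * plane_wave (- a) y) x" for x
    unfolding fourier_plane_wave
    by (intro Bochner_Integration.integral_cong refl)
      (simp add: plane_wave_def inner_diff_right algebra_simps flip: exp_add)
  have "(\<integral>x. f (x + a) * fourier \<phi> x \<partial>lborel) = (\<integral>x. f (x + a) * fourier \<phi> (x + a - a) \<partial>lborel)" by simp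
  also have "\<dots> = (\<integral>x. f x * fourier \<phi> (x - a) \<partial>lborel)"
    by (rule integral_translate) measurable
  also have "\<dots> = (\<integral>x. g x * (\<phi> x * plane_wave (- a) x) \<partial>lborel)"
    unfolding F by (rule L2_fourierD(3)[OF fg schwartz_plane_wave[OF \<phi>]])
  finally show "(\<integral>x. f (x + a) * fourier \<phi> x \<partial>lborel) = (\<integral>x. plane_wave (- a) x * g x * \<phi> x \<partial>lborel)"
    by (simp add: mult_ac)
qed

lemma L2_fourier_diff:
  assumes 1: "L2_fourier f g" and 2: "L2_fourier f' g'"
  shows "L2_fourier (\<lambda>x. f x - f' x) (\<lambda>x. g x - g' x)"
  unfolding L2_fourier_def
proof (intro conjI ballI)
  note s = L2_fourierD(1)[OF 1] L2_fourierD(2)[OF 1] L2_fourierD(1)[OF 2] L2_fourierD(2)[OF 2]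
  show "square_integrable (\<lambda>x. f x - f' x)" "square_integrable (\<lambda>x. g x - g' x)"
    by (intro square_integrable_diff s)+
  fix \<phi> :: "real ^ 'a \<Rightarrow> complex" assume \<phi>: "\<phi> \<in> schwartz_functions"
  note \<phi>s = schwartz_square_integrable[OF \<phi>] schwartz_square_integrable[OF schwartz_fourier[OF \<phi>]]
  show "(\<integral>x. (f x - f' x) * fourier \<phi> x \<partial>lborel) = (\<integral>x. (g x - g' x) * \<phi> x \<partial>lborel)"
    by (simp add: left_diff_distrib integrable_mult_L2 s \<phi>s L2_fourierD(3)[OF 1 \<phi>] L2_fourierD(3)[OF 2 \<phi>])
qed

section \<open>Density of test functions in Schwartz space\<close>

lemma has_derivative_dilate:
  fixes f :: "real ^ 'n::finite \<Rightarrow> complex"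
  assumes "f differentiable (at (c *\<^sub>R x))"
  shows "((\<lambda>x. f (c *\<^sub>R x)) has_derivative (\<lambda>h. \<Sum>i\<in>UNIV. (c *\<^sub>R h) $ i *\<^sub>R partial i f (c *\<^sub>R x))) (at x)"
proof -
  have "((\<lambda>x :: real ^ 'n. c *\<^sub>R x) has_derivative (\<lambda>h. c *\<^sub>R h)) (at x)"
    by (intro bounded_linear_imp_has_derivative bounded_linear_scaleR_right)
  from has_derivative_compose[OF this has_derivative_partials[OF assms]] show ?thesis .
qed

lemma partial_dilate:
  assumes "smooth f"
  shows "partial i (\<lambda>x. f (c *\<^sub>R x)) = (\<lambda>x. of_real c * partial i f (c *\<^sub>R x))"
  by (rule ext, subst partial_eqI[OF has_derivative_dilate[OF smooth_differentiable[OF assms]]])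
    (simp add: axis_def if_distrib[of "\<lambda>t. c * t"] if_distrib[of "\<lambda>t. t *\<^sub>R _"] cong: if_cong,
      simp add: scaleR_conv_of_real)

lemma smooth_dilate:
  fixes f :: "real ^ 'n::finite \<Rightarrow> complex"
  assumes "smooth f"
  shows "smooth (\<lambda>x. f (c *\<^sub>R x))"
proof -
  \<comment> \<open>Every derivative produces a factor c, so the family must be closed under scalars
    to be closed under partials.\<close>
  let ?X = "{\<lambda>x. a * g (c *\<^sub>R x) | a g. smooth (g :: real ^ 'n \<Rightarrow> complex)}"
  have "smooth (\<lambda>x. 1 * f (c *\<^sub>R x))"
  proof (rule smooth_coinduct[of _ ?X])
    show "(\<lambda>x. 1 * f (c *\<^sub>R x)) \<in> ?X" using assms by blast
    fix h assume "h \<in> ?X"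
    then obtain a g where h: "h = (\<lambda>x. a * g (c *\<^sub>R x))" and g: "smooth (g :: real ^ 'n \<Rightarrow> complex)" by blast
    have d: "(\<lambda>x. g (c *\<^sub>R x)) differentiable (at x)" for x
      using has_derivative_dilate[OF smooth_differentiable[OF g]] unfolding differentiable_def by blast
    show "h differentiable (at x)" for x
      unfolding h by (intro differentiable_mult d) simp
    have "partial i h = (\<lambda>x. (a * of_real c) * partial i g (c *\<^sub>R x))" for i
      unfolding h by (rule ext, subst partial_cmult[OF d]) (simp add: partial_dilate[OF g] mult.assoc)
    then show "partial i h \<in> ?X" for i using smooth_partial[OF g] by blast
  qed
  then show ?thesis by simp
qed

lemma partials_dilate:
  assumes "smooth f"
  shows "partials is (\<lambda>x. f (c *\<^sub>R x)) = (\<lambda>x. of_real c ^ length is * partials is f (c *\<^sub>R x))"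
proof (induction "is")
  case (Cons i "is")
  note sm = smooth_partials[OF assms, of "is"]
  have "partials (i # is) (\<lambda>x. f (c *\<^sub>R x)) = partial i (\<lambda>x. of_real c ^ length is * partials is f (c *\<^sub>R x))"
    by (simp only: foldr.simps o_apply Cons.IH)
  also have "\<dots> = (\<lambda>x. of_real c ^ length is * partial i (\<lambda>x. partials is f (c *\<^sub>R x)) x)"
    by (rule ext, rule partial_cmult[OF smooth_differentiable[OF smooth_dilate[OF sm]]])
  also have "\<dots> = (\<lambda>x. of_real c ^ length (i # is) * partials (i # is) f (c *\<^sub>R x))"
    by (simp add: partial_dilate[OF sm] mult_ac)
  finally show ?case .
qed simp

text \<open>Normalised to have the value 1 at the origin, without a plateau around it. Hence 1 -
  cutoff(x/(k+1)) is merely of size |x|/(k+1), and the factor |x| is left to the decay of the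
  Schwartz function.\<close>

definition cutoff :: "real ^ 'n::finite \<Rightarrow> complex" where
  "cutoff x = inverse (of_real (box_bump (- 1) 1 0 (0 :: real ^ 'n))) * of_real (box_bump (- 1) 1 0 x)"

lemma cutoff_test: "cutoff \<in> test_functions"
  unfolding cutoff_def[abs_def] by (rule test_mult[OF smooth_const box_bump_test])

lemma cutoff_0: "cutoff (0 :: real ^ 'n::finite) = 1"
proof -
  have "box_bump (- 1) 1 0 (0 :: real ^ 'n) \<noteq> 0"
    by (simp add: box_bump_def flat_def)
  then show ?thesis by (simp add: cutoff_def)
qed

lemma cutoff_Lipschitz:
  obtains B where "0 \<le> B" "\<And>x. norm (1 - cutoff x) \<le> B * norm (x :: real ^ 'n::finite)"
proof -
  have "\<exists>C. \<forall>x. norm (partial i cutoff (x :: real ^ 'n)) \<le> C" for i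
    by (rule test_bounded[OF test_partial[OF cutoff_test]])
  then obtain C where C: "\<And>i x. norm (partial i cutoff (x :: real ^ 'n)) \<le> C i" by metis
  have C0: "0 \<le> C i" for i by (rule order_trans[OF norm_ge_zero C])
  define B where "B = (\<Sum>i\<in>UNIV. C i)"
  have "norm (cutoff (0 :: real ^ 'n) - cutoff x) \<le> B * norm (0 - x)" for x :: "real ^ 'n"
  proof (rule differentiable_bound[OF convex_UNIV])
    show "(cutoff has_derivative (\<lambda>h. \<Sum>i\<in>UNIV. h $ i *\<^sub>R partial i cutoff x)) (at x within UNIV)" for x :: "real ^ 'n"
      by (rule has_derivative_partials[OF smooth_differentiable[OF test_smooth[OF cutoff_test]]])
    show "onorm (\<lambda>h. \<Sum>i\<in>UNIV. h $ i *\<^sub>R partial i cutoff x) \<le> B" for x :: "real ^ 'n"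
    proof (rule onorm_le)
      fix h :: "real ^ 'n"
      have "norm (\<Sum>i\<in>UNIV. h $ i *\<^sub>R partial i cutoff x) \<le> (\<Sum>i\<in>UNIV. C i * norm h)"
      proof (rule sum_norm_le)
        fix i
        have "\<bar>h $ i\<bar> * norm (partial i cutoff x) \<le> norm h * C i"
          by (intro mult_mono component_le_norm_cart C) auto
        then show "norm (h $ i *\<^sub>R partial i cutoff x) \<le> C i * norm h" by (simp add: mult.commute)
      qed
      then show "norm (\<Sum>i\<in>UNIV. h $ i *\<^sub>R partial i cutoff x) \<le> B * norm h"
        by (simp add: B_def sum_distrib_right)
    qed
  qed auto
  then have "norm (1 - cutoff x) \<le> B * norm x" for x :: "real ^ 'n" by (simp add: cutoff_0)
  moreover have "0 \<le> B" unfolding B_def by (intro sum_nonneg C0)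
  ultimately show thesis by (rule that[rotated])
qed

definition cutoff_rest :: "nat \<Rightarrow> real ^ 'n::finite \<Rightarrow> complex" where
  "cutoff_rest k x = 1 - cutoff (inverse (real (Suc k)) *\<^sub>R x)"

lemma smooth_cutoff_rest: "smooth (cutoff_rest k)"
  using smooth_lincomb[OF smooth_const[of 1] smooth_dilate[OF test_smooth[OF cutoff_test]], of 1 "-1" "inverse (real (Suc k))"]
  by (simp add: cutoff_rest_def[abs_def])

text \<open>Captures decay at rate 1/(k+1) of all derivatives, with linear growth in x permitted
  because of the undifferentiated remainder of the cutoff. Stability under partial derivatives is
  what the product rule induction requires.\<close>

definition vanishing :: "(nat \<Rightarrow> real ^ 'n::finite \<Rightarrow> complex) \<Rightarrow> bool" where
  "vanishing \<eta> \<longleftrightarrow> (\<forall>k. smooth (\<eta> k)) \<and>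
    (\<forall>is. \<exists>C. \<forall>k x. norm (partials is (\<eta> k) x) \<le> C * (1 + norm x) * inverse (real (Suc k)))"

lemma vanishing_partial:
  assumes "vanishing \<eta>"
  shows "vanishing (\<lambda>k. partial i (\<eta> k))"
  unfolding vanishing_def
proof (intro conjI allI)
  show "smooth (partial i (\<eta> k))" for k using assms by (simp add: vanishing_def smooth_partial)
  show "\<exists>C. \<forall>k x. norm (partials is (partial i (\<eta> k)) x) \<le> C * (1 + norm x) * inverse (real (Suc k))" for "is"
  proof -
    have "\<exists>C. \<forall>k x. norm (partials (is @ [i]) (\<eta> k) x) \<le> C * (1 + norm x) * inverse (real (Suc k))"
      using assms unfolding vanishing_def by blast
    then show ?thesis by simp
  qed
qed

lemma vanishing_cutoff_rest: "vanishing (cutoff_rest :: nat \<Rightarrow> real ^ 'n::finite \<Rightarrow> complex)"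
  unfolding vanishing_def
proof (intro conjI allI)
  show "smooth (cutoff_rest k :: real ^ 'n \<Rightarrow> complex)" for k by (rule smooth_cutoff_rest)
  fix "is" :: "'n list"
  let ?c = "\<lambda>k::nat. inverse (real (Suc k))"
  show "\<exists>C. \<forall>k x. norm (partials is (cutoff_rest k) x) \<le> C * (1 + norm x) * ?c k"
  proof (cases "is" rule: rev_cases)
    case Nil
    obtain B where B: "0 \<le> B" "\<And>x. norm (1 - cutoff x) \<le> B * norm (x :: real ^ 'n)"
      using cutoff_Lipschitz by blast
    have "norm (cutoff_rest k x) \<le> B * (1 + norm x) * ?c k" for k and x :: "real ^ 'n"
    proof -
      have "norm (cutoff_rest k x) \<le> B * norm (?c k *\<^sub>R x)" unfolding cutoff_rest_def by (rule B)
      also have "\<dots> = B * norm x * ?c k" by simp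
      also have "\<dots> \<le> B * (1 + norm x) * ?c k" by (intro mult_right_mono mult_left_mono B) auto
      finally show ?thesis .
    qed
    with Nil show ?thesis by auto
  next
    case (snoc js i)
    note sm = test_smooth[OF cutoff_test]
    have "partials is cutoff \<in> test_functions"
      by (induction "is") (auto intro: test_partial cutoff_test)
    then obtain C where C: "\<And>x. norm (partials is cutoff (x :: real ^ 'n)) \<le> C"
      using test_bounded by blast
    have C0: "0 \<le> C" by (rule order_trans[OF norm_ge_zero C])
    have eq: "partials is (cutoff_rest k) = (\<lambda>x. - (of_real (?c k) ^ length is * partials is cutoff (?c k *\<^sub>R x)))" for k
    proof -
      have "cutoff_rest k = (\<lambda>x. 1 + (-1) * cutoff (?c k *\<^sub>R x))"
        by (simp add: cutoff_rest_def[abs_def])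
      then have "partials is (cutoff_rest k) = partials is (\<lambda>x. 1 + (-1) * cutoff (?c k *\<^sub>R x))"
        by (rule arg_cong)
      also have "\<dots> = (\<lambda>x. partials is (\<lambda>x. 1) x + partials is (\<lambda>x. (-1) * cutoff (?c k *\<^sub>R x)) x)"
        by (rule partials_add[OF smooth_const smooth_cmult[OF smooth_dilate[OF sm]]])
      also have "\<dots> = (\<lambda>x. partials is (\<lambda>x. 1) x + (-1) * partials is (\<lambda>x. cutoff (?c k *\<^sub>R x)) x)"
        by (simp only: partials_cmult[OF smooth_dilate[OF sm]])
      finally have "partials is (cutoff_rest k) =
          (\<lambda>x. partials is (\<lambda>x. 1) x + (-1) * partials is (\<lambda>x. cutoff (?c k *\<^sub>R x)) x)" .
      moreover have zero: "partials js (\<lambda>x :: real ^ 'n. 0) = (\<lambda>x. 0)" for js by (induction js) auto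
      have "partials is (\<lambda>x. 1) = (\<lambda>x. 0)" using snoc zero by simp
      ultimately show ?thesis by (simp only: partials_dilate[OF sm]) simp
    qed
    have "norm (partials is (cutoff_rest k) x) \<le> C * (1 + norm x) * ?c k" for k x
    proof -
      \<comment> \<open>Each derivative of the dilated cutoff contributes a factor 1/(k+1), and at
        least one derivative is present here.\<close>
      have "?c k ^ length is \<le> ?c k ^ 1"
        using snoc by (intro power_decreasing) (auto simp: inverse_le_1_iff)
      then have "norm (partials is (cutoff_rest k) x) \<le> ?c k * C"
        unfolding eq norm_minus_cancel norm_mult norm_power norm_of_real
        by (intro mult_mono C) auto
      also have "\<dots> \<le> ?c k * (C * (1 + norm x))"
        using C0 by (intro mult_left_mono) (auto simp: mult_le_cancel_left1)
      finally show ?thesis by (simp add: mult_ac)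
    qed
    then show ?thesis by blast
  qed
qed

text \<open>Absorbs the linear growth permitted by \<open>vanishing\<close>: |x| is at most the sum
  of the |x_i|, and coordinate factors stay within the Schwartz space.\<close>

lemma schwartz_bounded_norm:
  fixes \<phi> :: "real ^ 'n::finite \<Rightarrow> complex"
  assumes \<phi>: "\<phi> \<in> schwartz_functions"
  obtains C where "\<And>x. (1 + norm x) * norm (mi_monomial \<beta> x *\<^sub>R \<phi> x) \<le> C"
proof -
  obtain C where C: "\<And>x. norm (mi_monomial \<beta> x *\<^sub>R \<phi> x) \<le> C" using schwartz_bounded[OF \<phi>] by blast
  have "\<exists>D. \<forall>x. norm (mi_monomial \<beta> x *\<^sub>R (of_real (x $ i) * \<phi> x)) \<le> D" for i
    using schwartz_bounded[OF schwartz_coord[OF \<phi>]] by metis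
  then obtain D where D: "\<And>i x. norm (mi_monomial \<beta> x *\<^sub>R (of_real (x $ i) * \<phi> x)) \<le> D i" by metis
  have "(1 + norm x) * norm (mi_monomial \<beta> x *\<^sub>R \<phi> x) \<le> C + (\<Sum>i\<in>UNIV. D i)" for x
  proof -
    have "norm x * norm (mi_monomial \<beta> x *\<^sub>R \<phi> x) \<le> (\<Sum>i\<in>UNIV. \<bar>x $ i\<bar>) * norm (mi_monomial \<beta> x *\<^sub>R \<phi> x)"
      by (intro mult_right_mono norm_le_l1_cart) auto
    also have "\<dots> = (\<Sum>i\<in>UNIV. norm (mi_monomial \<beta> x *\<^sub>R (of_real (x $ i) * \<phi> x)))"
      unfolding sum_distrib_right by (intro sum.cong) (simp_all add: norm_mult mult_ac)
    also have "\<dots> \<le> (\<Sum>i\<in>UNIV. D i)" by (intro sum_mono D)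
    finally show ?thesis using C[of x] by (simp add: distrib_right)
  qed
  then show thesis by (rule that)
qed

text \<open>The Leibniz rule without binomial coefficients: the innermost derivative falls on \<phi>
  or on \<eta>, and the induction hypothesis, general in both, covers either term.\<close>

lemma vanishing_product:
  fixes \<phi> :: "real ^ 'n::finite \<Rightarrow> complex"
  assumes "\<phi> \<in> schwartz_functions" "vanishing \<eta>"
  shows "\<exists>C. \<forall>k x. norm (mi_monomial \<beta> x *\<^sub>R partials is (\<lambda>x. \<phi> x * \<eta> k x) x) \<le> C * inverse (real (Suc k))"
  using assms
proof (induction "is" arbitrary: \<phi> \<eta> rule: rev_induct)
  case Nil
  obtain A where A: "\<And>x. (1 + norm x) * norm (mi_monomial \<beta> x *\<^sub>R \<phi> x) \<le> A"
    using schwartz_bounded_norm[OF Nil(1)] by blast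
  have "\<exists>C. \<forall>k x. norm (partials [] (\<eta> k) x) \<le> C * (1 + norm x) * inverse (real (Suc k))"
    using Nil(2) unfolding vanishing_def by blast
  then obtain C where C: "\<And>k x. norm (\<eta> k x) \<le> C * (1 + norm x) * inverse (real (Suc k))" by auto
  have "0 \<le> C * (1 + norm (0 :: real ^ 'n)) * inverse (real (Suc 0))" by (rule order_trans[OF norm_ge_zero C])
  then have C0: "0 \<le> C" by simp
  have "norm (mi_monomial \<beta> x *\<^sub>R (\<phi> x * \<eta> k x)) \<le> (C * A) * inverse (real (Suc k))" for k x
  proof -
    have "norm (mi_monomial \<beta> x *\<^sub>R (\<phi> x * \<eta> k x)) = norm (mi_monomial \<beta> x *\<^sub>R \<phi> x) * norm (\<eta> k x)"
      by (simp add: norm_mult)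
    also have "\<dots> \<le> norm (mi_monomial \<beta> x *\<^sub>R \<phi> x) * (C * (1 + norm x) * inverse (real (Suc k)))"
      by (intro mult_left_mono C) auto
    also have "\<dots> = C * ((1 + norm x) * norm (mi_monomial \<beta> x *\<^sub>R \<phi> x)) * inverse (real (Suc k))"
      by (simp only: mult_ac)
    also have "\<dots> \<le> C * A * inverse (real (Suc k))"
      by (intro mult_right_mono mult_left_mono A C0) auto
    finally show ?thesis .
  qed
  then show ?case by auto
next
  case (snoc i "is")
  note sm = schwartz_smooth[OF snoc.prems(1)]
  have \<eta>sm: "smooth (\<eta> k)" for k using snoc.prems(2) by (simp add: vanishing_def)
  obtain C where C: "\<And>k x. norm (mi_monomial \<beta> x *\<^sub>R partials is (\<lambda>x. \<phi> x * partial i (\<eta> k) x) x) \<le> C * inverse (real (Suc k))"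
    using snoc.IH[OF snoc.prems(1) vanishing_partial[OF snoc.prems(2)], of i] by blast
  obtain D where D: "\<And>k x. norm (mi_monomial \<beta> x *\<^sub>R partials is (\<lambda>x. partial i \<phi> x * \<eta> k x) x) \<le> D * inverse (real (Suc k))"
    using snoc.IH[OF schwartz_partial[OF snoc.prems(1)] snoc.prems(2), of i] by blast
  have eq: "partials (is @ [i]) (\<lambda>x. \<phi> x * \<eta> k x) =
      (\<lambda>x. partials is (\<lambda>x. \<phi> x * partial i (\<eta> k) x) x + partials is (\<lambda>x. partial i \<phi> x * \<eta> k x) x)" for k
  proof -
    have "partial i (\<lambda>x. \<phi> x * \<eta> k x) = (\<lambda>x. \<phi> x * partial i (\<eta> k) x + partial i \<phi> x * \<eta> k x)"
      by (rule ext, rule partial_mult[OF smooth_differentiable[OF sm] smooth_differentiable[OF \<eta>sm]])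
    then show ?thesis
      by (simp add: partials_add smooth_mult sm \<eta>sm smooth_partial)
  qed
  have "norm (mi_monomial \<beta> x *\<^sub>R partials (is @ [i]) (\<lambda>x. \<phi> x * \<eta> k x) x) \<le> (C + D) * inverse (real (Suc k))" for k x
    unfolding eq scaleR_add_right distrib_right by (rule norm_triangle_mono[OF C D])
  then show ?case by blast
qed

definition schwartz_norm :: "nat \<Rightarrow> (real ^ 'n::finite \<Rightarrow> complex) \<Rightarrow> real" where
  "schwartz_norm N \<phi> = (\<Sum>\<alpha> | mi_order \<alpha> \<le> N. \<Sum>\<beta> | mi_order \<beta> \<le> N.
     SUP x. cmod (mi_monomial \<beta> x *\<^sub>R mi_partial \<alpha> \<phi> x))"

lemma schwartz_seminorm_nonneg:
  assumes "\<phi> \<in> schwartz_functions"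
  shows "0 \<le> (SUP x. cmod (mi_monomial \<beta> x *\<^sub>R mi_partial \<alpha> \<phi> x))"
  by (rule order_trans[OF norm_ge_zero
        cSUP_upper[OF UNIV_I[of 0] schwartz_bdd_above[OF schwartz_mi_partial[OF assms]]]])

lemma schwartz_norm_nonneg: "\<phi> \<in> schwartz_functions \<Longrightarrow> 0 \<le> schwartz_norm N \<phi>"
  unfolding schwartz_norm_def by (intro sum_nonneg schwartz_seminorm_nonneg)

lemma schwartz_norm_vanishing:
  fixes \<phi> :: "real ^ 'n::finite \<Rightarrow> complex"
  assumes \<phi>: "\<phi> \<in> schwartz_functions" and \<eta>: "vanishing \<eta>"
  shows "\<exists>M. \<forall>k. schwartz_norm N (\<lambda>x. \<phi> x * \<eta> k x) \<le> M * inverse (real (Suc k))"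
proof -
  have ex: "\<exists>C. \<forall>k x. norm (mi_monomial \<beta> x *\<^sub>R mi_partial \<alpha> (\<lambda>x. \<phi> x * \<eta> k x) x) \<le> C * inverse (real (Suc k))" for \<alpha> \<beta>
    unfolding mi_partial_eq_partials by (rule vanishing_product[OF assms])
  define C where "C \<alpha> \<beta> = (SOME c. \<forall>k x. norm (mi_monomial \<beta> x *\<^sub>R mi_partial \<alpha> (\<lambda>x. \<phi> x * \<eta> k x) x) \<le> c * inverse (real (Suc k)))" for \<alpha> \<beta>
  have C: "norm (mi_monomial \<beta> x *\<^sub>R mi_partial \<alpha> (\<lambda>x. \<phi> x * \<eta> k x) x) \<le> C \<alpha> \<beta> * inverse (real (Suc k))" for \<alpha> \<beta> k x
    using someI_ex[OF ex[of \<beta> \<alpha>]] unfolding C_def by blast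
  have "schwartz_norm N (\<lambda>x. \<phi> x * \<eta> k x) \<le>
      (\<Sum>\<alpha> | mi_order \<alpha> \<le> N. \<Sum>\<beta> | mi_order \<beta> \<le> N. C \<alpha> \<beta> * inverse (real (Suc k)))" for k
    unfolding schwartz_norm_def by (intro sum_mono cSUP_least C) simp
  then show ?thesis
    by (intro exI[of _ "\<Sum>\<alpha> | mi_order \<alpha> \<le> N. \<Sum>\<beta> | mi_order \<beta> \<le> N. C \<alpha> \<beta>"] allI)
      (simp only: sum_distrib_right)
qed

lemma functional_diff:
  assumes "T \<in> linear_functionals F" "\<phi> \<in> F" "\<psi> \<in> F"
  shows "T (\<lambda>x. \<phi> x - \<psi> x) = T \<phi> - T \<psi>"
proof -
  have "T (\<lambda>x. 1 * \<phi> x + (-1) * \<psi> x) = 1 * T \<phi> + (-1) * T \<psi>"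
    using assms unfolding linear_functionals_def by blast
  then show ?thesis by simp
qed

text \<open>\<phi> is split into its product with a dilated cutoff, on which both functionals agree,
  and a remainder \<open>r k\<close> whose Schwartz norms are O(1/k). The difference of the two
  values at \<phi> does not depend on k, so it is 0.\<close>

lemma tempered_eq_if_eq_on_tests:
  fixes T U :: "'n::finite functional"
  assumes T: "T \<in> tempered_distributions" and U: "U \<in> tempered_distributions"
    and eq: "\<And>\<phi>. \<phi> \<in> test_functions \<Longrightarrow> T \<phi> = U \<phi>" and \<phi>: "\<phi> \<in> schwartz_functions"
  shows "T \<phi> = U \<phi>"
proof -
  have lin: "T \<in> linear_functionals schwartz_functions" "U \<in> linear_functionals schwartz_functions"
    using T U by (auto simp: tempered_distributions_def)
  define r where "r k x = \<phi> x * cutoff_rest k x" for k x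
  \<comment> \<open>This difference is \<phi> times the dilated cutoff, so it is supported in the
    (k+1)-fold dilate of the support of \<open>cutoff\<close>.\<close>
  have test: "(\<lambda>x. \<phi> x - r k x) \<in> test_functions" for k
  proof (rule test_functionI)
    have "smooth (\<lambda>x. \<phi> x * cutoff (inverse (real (Suc k)) *\<^sub>R x))"
      by (intro smooth_mult smooth_dilate schwartz_smooth[OF \<phi>] test_smooth[OF cutoff_test])
    then show "smooth (\<lambda>x. \<phi> x - r k x)"
      by (simp add: r_def cutoff_rest_def algebra_simps)
    let ?K = "closure {x. cutoff (x :: real ^ 'n) \<noteq> 0}"
    have "compact ?K" using cutoff_test unfolding test_functions_def by blast
    then show "compact ((\<lambda>x. real (Suc k) *\<^sub>R x) ` ?K)" by (rule compact_scaling)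
    fix x assume "\<phi> x - r k x \<noteq> 0"
    then have "cutoff (inverse (real (Suc k)) *\<^sub>R x) \<noteq> 0"
      by (auto simp: r_def cutoff_rest_def algebra_simps)
    then have "inverse (real (Suc k)) *\<^sub>R x \<in> ?K" by (rule test_support)
    then show "x \<in> (\<lambda>x. real (Suc k) *\<^sub>R x) ` ?K"
      by (rule image_eqI[rotated]) simp
  qed
  have r: "r k \<in> schwartz_functions" for k
  proof -
    have "(\<lambda>x. 1 * \<phi> x + (-1) * (\<phi> x - r k x)) \<in> schwartz_functions"
      using test test_subset_schwartz by (intro schwartz_lincomb \<phi>) auto
    then show ?thesis by simp
  qed
  have same: "T \<phi> - U \<phi> = T (r k) - U (r k)" for k
  proof -
    have "T \<phi> - T (r k) = U \<phi> - U (r k)"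
      using eq[OF test[of k]] unfolding functional_diff[OF lin(1) \<phi> r] functional_diff[OF lin(2) \<phi> r] .
    then show ?thesis by (simp add: algebra_simps)
  qed
  have van: "\<exists>M. \<forall>k. schwartz_norm N (r k) \<le> M * inverse (real (Suc k))" for N
    unfolding r_def by (rule schwartz_norm_vanishing[OF \<phi> vanishing_cutoff_rest])
  have small: "\<exists>M. \<forall>k. cmod (S (r k)) \<le> M * inverse (real (Suc k))" if S: "S \<in> tempered_distributions" for S
  proof -
    obtain C N where CN: "\<And>\<phi>. \<phi> \<in> schwartz_functions \<Longrightarrow> cmod (S \<phi>) \<le> C * schwartz_norm N \<phi>"
      using S unfolding tempered_distributions_def schwartz_norm_def by blast
    obtain M where M: "\<And>k. schwartz_norm N (r k) \<le> M * inverse (real (Suc k))" using van by blast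
    have "cmod (S (r k)) \<le> (\<bar>C\<bar> * M) * inverse (real (Suc k))" for k
    proof -
      have "cmod (S (r k)) \<le> C * schwartz_norm N (r k)" by (rule CN[OF r])
      \<comment> \<open>The constant of a tempered distribution is not assumed nonnegative, and
        multiplying the next estimate by it requires a sign.\<close>
      also have "\<dots> \<le> \<bar>C\<bar> * schwartz_norm N (r k)"
        by (intro mult_right_mono schwartz_norm_nonneg r) auto
      also have "\<dots> \<le> \<bar>C\<bar> * (M * inverse (real (Suc k)))" by (intro mult_left_mono M) auto
      finally show ?thesis by (simp add: mult.assoc)
    qed
    then show ?thesis by blast
  qed
  obtain M where M: "\<And>k. cmod (T (r k)) \<le> M * inverse (real (Suc k))" using small[OF T] by blast
  obtain M' where M': "\<And>k. cmod (U (r k)) \<le> M' * inverse (real (Suc k))" using small[OF U] by blast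
  have "cmod (T \<phi> - U \<phi>) \<le> 0"
  proof (rule LIMSEQ_le_const)
    show "(\<lambda>k. (M + M') * inverse (real (Suc k))) \<longlonglongrightarrow> 0"
      by (rule tendsto_mult_right_zero[OF LIMSEQ_inverse_real_of_nat])
    have "cmod (T \<phi> - U \<phi>) \<le> (M + M') * inverse (real (Suc k))" for k
      unfolding same[of k] distrib_right
      by (rule order_trans[OF norm_triangle_ineq4 add_mono[OF M M']])
    then show "\<exists>N. \<forall>k\<ge>N. cmod (T \<phi> - U \<phi>) \<le> (M + M') * inverse (real (Suc k))" by blast
  qed
  then show ?thesis by simp
qed

text \<open>The tempered extension of the distributional derivative of f, defined on all Schwartz
  functions so that it can be evaluated on transforms.\<close>

definition L2_deriv :: "(real ^ 'n::finite \<Rightarrow> complex) \<Rightarrow> nat ^ 'n \<Rightarrow> 'n functional" where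
  "L2_deriv f \<alpha> = (\<lambda>\<phi>\<in>schwartz_functions. (-1) ^ mi_order \<alpha> * (\<integral>x. f x * mi_partial \<alpha> \<phi> x \<partial>lborel))"

text \<open>The derivative of \<phi> is at most \<open>weight\<close> times a sum of seminorms, and
  f times \<open>weight\<close> is integrable because both factors are square integrable.\<close>

lemma L2_deriv_tempered:
  fixes f :: "real ^ 'n::finite \<Rightarrow> complex"
  assumes f: "square_integrable f"
  shows "L2_deriv f \<alpha> \<in> tempered_distributions"
proof -
  have int: "integrable lborel (\<lambda>x. f x * mi_partial \<alpha> \<phi> x)" if "\<phi> \<in> schwartz_functions" for \<phi>
    by (rule integrable_mult_L2[OF f schwartz_square_integrable[OF schwartz_mi_partial[OF that]]])
  have "L2_deriv f \<alpha> \<in> linear_functionals schwartz_functions"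
    unfolding linear_functionals_def
  proof (intro CollectI conjI ballI allI)
    show "L2_deriv f \<alpha> \<in> extensional schwartz_functions" by (simp add: L2_deriv_def)
    fix \<phi> \<psi> :: "real ^ 'n \<Rightarrow> complex" and a b
    assume \<phi>: "\<phi> \<in> schwartz_functions" and \<psi>: "\<psi> \<in> schwartz_functions"
    have "(\<integral>x. f x * mi_partial \<alpha> (\<lambda>x. a * \<phi> x + b * \<psi> x) x \<partial>lborel) =
        (\<integral>x. a * (f x * mi_partial \<alpha> \<phi> x) + b * (f x * mi_partial \<alpha> \<psi> x) \<partial>lborel)"
      unfolding mi_partial_lincomb[OF schwartz_smooth[OF \<phi>] schwartz_smooth[OF \<psi>]]
      by (simp add: algebra_simps)
    also have "\<dots> = a * (\<integral>x. f x * mi_partial \<alpha> \<phi> x \<partial>lborel) + b * (\<integral>x. f x * mi_partial \<alpha> \<psi> x \<partial>lborel)"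
      using int[OF \<phi>] int[OF \<psi>] by simp
    finally show "L2_deriv f \<alpha> (\<lambda>x. a * \<phi> x + b * \<psi> x) = a * L2_deriv f \<alpha> \<phi> + b * L2_deriv f \<alpha> \<psi>"
      by (simp add: L2_deriv_def \<phi> \<psi> schwartz_lincomb distrib_left mult.left_commute)
  qed
  moreover have "\<exists>C N. \<forall>\<phi>\<in>schwartz_functions. cmod (L2_deriv f \<alpha> \<phi>) \<le> C * schwartz_norm N \<phi>"
  proof -
    have [measurable]: "f \<in> borel_measurable borel" by (rule square_integrable_measurable[OF f])
    have sq_w: "square_integrable (\<lambda>x :: real ^ 'n. complex_of_real (weight x))"
    proof -
      have "(\<integral>\<^sup>+x. ennreal ((norm (complex_of_real (weight (x :: real ^ 'n))))\<^sup>2) \<partial>lborel) \<le> (\<integral>\<^sup>+x. ennreal (norm (weight (x :: real ^ 'n))) \<partial>lborel)"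
        by (intro nn_integral_mono ennreal_leI)
          (simp add: power2_eq_square abs_of_pos[OF weight_pos] mult_left_le[OF weight_le_1 less_imp_le[OF weight_pos]])
      also have "\<dots> < \<infinity>" using integrable_weight by (simp add: integrable_iff_bounded)
      finally show ?thesis by (simp add: square_integrable_def)
    qed
    have iw: "integrable lborel (\<lambda>x. norm (f x) * weight x)"
      using integrable_norm[OF integrable_mult_L2[OF f sq_w]]
      by (simp add: norm_mult abs_of_pos[OF weight_pos])
    define I where "I = (\<integral>x. norm (f x) * weight x \<partial>lborel)"
    have I0: "0 \<le> I" 
      unfolding I_def by (intro integral_nonneg_AE AE_I2 mult_nonneg_nonneg norm_ge_zero less_imp_le[OF weight_pos])
    \<comment> \<open>The first entry puts \<alpha> into the range of derivatives counted by the
      norm; the second is the degree of the polynomial inverse to \<open>weight\<close>.\<close>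
    define N where "N = max (mi_order \<alpha>) (2 * CARD('n))"
    have "cmod (L2_deriv f \<alpha> \<phi>) \<le> I * schwartz_norm N \<phi>" if \<phi>: "\<phi> \<in> schwartz_functions" for \<phi>
    proof -
      define P where "P = (\<Sum>\<beta> | mi_order \<beta> \<le> N. SUP x. norm (mi_monomial \<beta> x *\<^sub>R mi_partial \<alpha> \<phi> x))"
      have "cmod (L2_deriv f \<alpha> \<phi>) = norm (\<integral>x. f x * mi_partial \<alpha> \<phi> x \<partial>lborel)"
        by (simp add: L2_deriv_def \<phi> norm_mult norm_power)
      also have "\<dots> \<le> (\<integral>x. norm (f x) * weight x * P \<partial>lborel)"
      proof (rule norm_integral_le[OF int[OF \<phi>]])
        show "integrable lborel (\<lambda>x. norm (f x) * weight x * P)" by (intro integrable_mult_left iw)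
        fix x
        have "norm (mi_partial \<alpha> \<phi> x) \<le> weight x * P"
          unfolding P_def by (rule norm_le_weight_SUP[OF schwartz_bdd_above[OF schwartz_mi_partial[OF \<phi>]]])
            (simp add: N_def)
        then show "norm (f x * mi_partial \<alpha> \<phi> x) \<le> norm (f x) * weight x * P"
          by (simp add: norm_mult mult.assoc mult_left_mono)
      qed
      also have "\<dots> = I * P" by (simp add: I_def)
      also have "P \<le> schwartz_norm N \<phi>"
        unfolding P_def schwartz_norm_def
        by (rule member_le_sum[of \<alpha>], simp add: N_def, intro sum_nonneg schwartz_seminorm_nonneg \<phi>,
            rule finite_mi_order_le)
      finally show ?thesis using I0 by (simp add: mult_left_mono)
    qed
    then show ?thesis by blast
  qed
  ultimately show ?thesis
    by (simp add: tempered_distributions_def schwartz_norm_def)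
qed

section \<open>Derivatives of square integrable functions on the Fourier side\<close>

lemma mi_order_eq_0_iff: "mi_order \<alpha> = 0 \<longleftrightarrow> \<alpha> = 0"
  by (auto simp: mi_order_def vec_eq_iff)

lemma mi_order_0 [simp]: "mi_order 0 = 0"
  by (simp add: mi_order_eq_0_iff)

lemma mi_partial_0 [simp]:
  fixes \<phi> :: "real ^ 'n::finite \<Rightarrow> complex"
  shows "mi_partial 0 \<phi> = \<phi>"
proof -
  have "mi_list (0 :: nat ^ 'n) = []"
    using length_mi_list[of "0 :: nat ^ 'n"] mi_order_eq_0_iff[of "0 :: nat ^ 'n"] by simp
  then show ?thesis by (simp add: mi_partial_eq_partials)
qed

definition symbol :: "nat ^ 'n::finite \<Rightarrow> real ^ 'n \<Rightarrow> complex" where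
  "symbol \<alpha> \<xi> = \<i> ^ mi_order \<alpha> * of_real (mi_monomial \<alpha> \<xi>)"

lemma norm_symbol: "norm (symbol \<alpha> \<xi>) = \<bar>mi_monomial \<alpha> \<xi>\<bar>"
  by (simp add: symbol_def norm_mult norm_power)

lemma continuous_symbol: "continuous_on S (symbol \<alpha>)"
  unfolding symbol_def[abs_def] mi_monomial_def by (intro continuous_intros)

lemma borel_measurable_symbol [measurable]: "symbol \<alpha> \<in> borel_measurable borel"
  by (rule borel_measurable_continuous_onI[OF continuous_symbol])

lemma locally_integrable_continuous_mult:
  fixes f g :: "real ^ 'n::finite \<Rightarrow> complex"
  assumes f: "locally_integrable f" and g: "continuous_on UNIV g"
  shows "locally_integrable (\<lambda>x. g x * f x)"
  unfolding locally_integrable_def set_integrable_def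
proof (intro conjI allI impI)
  have [measurable]: "f \<in> borel_measurable borel" "g \<in> borel_measurable borel"
    using f borel_measurable_continuous_onI[OF g] by (auto simp: locally_integrable_def)
  show "(\<lambda>x. g x * f x) \<in> borel_measurable borel" by measurable
  fix K :: "(real ^ 'n) set" assume K: "compact K"
  then have [measurable]: "K \<in> sets borel" by (simp add: borel_compact)
  have "compact (g ` K)" by (rule compact_continuous_image[OF continuous_on_subset[OF g] K]) simp
  then obtain B where B: "\<And>x. x \<in> K \<Longrightarrow> norm (g x) \<le> B"
    using compact_imp_bounded[of "g ` K"] unfolding bounded_iff by blast
  have "integrable lborel (\<lambda>x. of_real B * (indicator K x *\<^sub>R f x))"
    using f K by (intro integrable_mult_right) (auto simp: locally_integrable_def set_integrable_def)
  then show "integrable lborel (\<lambda>x. indicator K x *\<^sub>R (g x * f x))"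
  proof (rule Bochner_Integration.integrable_bound)
    show "AE x in lborel. norm (indicator K x *\<^sub>R (g x * f x)) \<le> norm (of_real B * (indicator K x *\<^sub>R f x))"
    proof (intro AE_I2)
      fix x
      show "norm (indicator K x *\<^sub>R (g x * f x)) \<le> norm (of_real B * (indicator K x *\<^sub>R f x))"
        using B[of x] mult_right_mono[of "norm (g x)" "\<bar>B\<bar>" "norm (f x)"]
        by (auto simp: norm_mult split: split_indicator)
    qed
  qed measurable
qed

text \<open>Differentiating \<open>fourier \<psi>\<close> multiplies \<psi> by (-i)^|\<alpha>| times
  a monomial; the sign (-1)^|\<alpha>| of the distributional derivative turns this into
  i^|\<alpha>|, the factor in \<open>symbol\<close>.\<close>

lemma L2_deriv_fourier:
  assumes fg: "L2_fourier f g" and \<psi>: "\<psi> \<in> schwartz_functions"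
  shows "L2_deriv f \<alpha> (fourier \<psi>) = (\<integral>\<xi>. symbol \<alpha> \<xi> * g \<xi> * \<psi> \<xi> \<partial>lborel)"
proof -
  let ?m = "mi_order \<alpha>"
  have "L2_deriv f \<alpha> (fourier \<psi>) =
      (-1) ^ ?m * (\<integral>x. f x * fourier (\<lambda>x. (- \<i>) ^ ?m * (of_real (mi_monomial \<alpha> x) * \<psi> x)) x \<partial>lborel)"
    by (simp add: L2_deriv_def schwartz_fourier[OF \<psi>] mi_partial_fourier[OF \<psi>])
  also have "\<dots> = (-1) ^ ?m * (\<integral>\<xi>. g \<xi> * ((- \<i>) ^ ?m * (of_real (mi_monomial \<alpha> \<xi>) * \<psi> \<xi>)) \<partial>lborel)"
    by (simp only: L2_fourierD(3)[OF fg schwartz_cmult[OF schwartz_mi_monomial[OF \<psi>]]])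
  also have "\<dots> = (\<integral>\<xi>. (-1) ^ ?m * (g \<xi> * ((- \<i>) ^ ?m * (of_real (mi_monomial \<alpha> \<xi>) * \<psi> \<xi>))) \<partial>lborel)"
    by simp
  also have "\<dots> = (\<integral>\<xi>. symbol \<alpha> \<xi> * g \<xi> * \<psi> \<xi> \<partial>lborel)"
  proof (intro Bochner_Integration.integral_cong refl)
    fix \<xi>
    have "(-1) ^ ?m * (- \<i>) ^ ?m = \<i> ^ ?m" by (simp flip: power_mult_distrib)
    then show "(-1) ^ ?m * (g \<xi> * ((- \<i>) ^ ?m * (of_real (mi_monomial \<alpha> \<xi>) * \<psi> \<xi>))) = symbol \<alpha> \<xi> * g \<xi> * \<psi> \<xi>"
      by (simp add: symbol_def mult.assoc[symmetric] mult.commute[of "g \<xi>"])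
  qed
  finally show ?thesis .
qed

lemma L2_deriv_test:
  "\<phi> \<in> test_functions \<Longrightarrow> L2_deriv f \<alpha> \<phi> = dist_deriv \<alpha> (regular_dist f) \<phi>"
  using test_subset_schwartz test_mi_partial[of \<phi> \<alpha>]
  by (auto simp: L2_deriv_def dist_deriv_def regular_dist_def)

lemma tempered_to_dist_L2_deriv: "tempered_to_dist (L2_deriv f \<alpha>) = dist_deriv \<alpha> (regular_dist f)"
proof
  show "tempered_to_dist (L2_deriv f \<alpha>) \<phi> = dist_deriv \<alpha> (regular_dist f) \<phi>" for \<phi>
    using L2_deriv_test[of \<phi> f \<alpha>]
    by (cases "\<phi> \<in> test_functions") (simp_all add: tempered_to_dist_def dist_deriv_def)
qed

text \<open>\<open>H_tilde\<close> supplies an unspecified tempered extension of the derivative;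
  density identifies it with the explicit one.\<close>

lemma tempered_eq_L2_deriv:
  assumes f: "square_integrable f" and T: "T \<in> tempered_distributions"
    and eq: "tempered_to_dist T = dist_deriv \<alpha> (regular_dist f)" and \<phi>: "\<phi> \<in> schwartz_functions"
  shows "T \<phi> = L2_deriv f \<alpha> \<phi>"
proof (rule tempered_eq_if_eq_on_tests[OF T L2_deriv_tempered[OF f] _ \<phi>])
  fix \<phi> :: "real ^ 'a \<Rightarrow> complex" assume "\<phi> \<in> test_functions"
  then show "T \<phi> = L2_deriv f \<alpha> \<phi>"
    using fun_cong[OF eq, of \<phi>] by (simp add: L2_deriv_test tempered_to_dist_def)
qed

lemma symbol_mult_locally_integrable:
  "L2_fourier f g \<Longrightarrow> locally_integrable (\<lambda>\<xi>. symbol \<alpha> \<xi> * g \<xi>)"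
  by (intro locally_integrable_continuous_mult square_integrable_locally_integrable continuous_symbol L2_fourierD(2))

lemma dist_deriv_eq_regular_iff:
  assumes fg: "L2_fourier f g" and hk: "L2_fourier h k"
  shows "dist_deriv \<alpha> (regular_dist f) = regular_dist h \<longleftrightarrow> (AE \<xi> in lborel. k \<xi> = symbol \<alpha> \<xi> * g \<xi>)"
proof
  assume L: "dist_deriv \<alpha> (regular_dist f) = regular_dist h"
  \<comment> \<open>Viewing h as its own derivative of order 0 makes both sides functionals of the
    form \<open>L2_deriv\<close>, so uniqueness of tempered extensions applies.\<close>
  have h0: "dist_deriv 0 (regular_dist h) = regular_dist h"
    by (auto simp: dist_deriv_def regular_dist_def mi_order_eq_0_iff)
  show "AE \<xi> in lborel. k \<xi> = symbol \<alpha> \<xi> * g \<xi>"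
  proof (rule locally_integrable_AE_eq)
    show "locally_integrable k" by (rule square_integrable_locally_integrable[OF L2_fourierD(2)[OF hk]])
    show "locally_integrable (\<lambda>\<xi>. symbol \<alpha> \<xi> * g \<xi>)" by (rule symbol_mult_locally_integrable[OF fg])
    fix \<psi> :: "real ^ 'a \<Rightarrow> complex" assume "\<psi> \<in> test_functions"
    then have \<psi>: "\<psi> \<in> schwartz_functions" using test_subset_schwartz by blast
    have "L2_deriv h 0 (fourier \<psi>) = L2_deriv f \<alpha> (fourier \<psi>)"
      by (rule tempered_eq_L2_deriv[OF L2_fourierD(1)[OF fg] L2_deriv_tempered[OF L2_fourierD(1)[OF hk]]])
        (simp_all add: tempered_to_dist_L2_deriv L h0 schwartz_fourier[OF \<psi>])
    moreover have "L2_deriv h 0 (fourier \<psi>) = (\<integral>x. k x * \<psi> x \<partial>lborel)"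
      by (simp add: L2_deriv_def schwartz_fourier[OF \<psi>] L2_fourierD(3)[OF hk \<psi>] mi_order_eq_0_iff)
    ultimately show "(\<integral>x. k x * \<psi> x \<partial>lborel) = (\<integral>\<xi>. symbol \<alpha> \<xi> * g \<xi> * \<psi> \<xi> \<partial>lborel)"
      by (simp add: L2_deriv_fourier[OF fg \<psi>])
  qed
next
  assume AE: "AE \<xi> in lborel. k \<xi> = symbol \<alpha> \<xi> * g \<xi>"
  have [measurable]: "k \<in> borel_measurable borel" "g \<in> borel_measurable borel"
    by (rule square_integrable_measurable[OF L2_fourierD(2)[OF hk]],
        rule square_integrable_measurable[OF L2_fourierD(2)[OF fg]])
  have "dist_deriv \<alpha> (regular_dist f) \<phi> = regular_dist h \<phi>" if \<phi>: "\<phi> \<in> test_functions" for \<phi>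
  proof -
    have "\<phi> \<in> schwartz_functions" using \<phi> test_subset_schwartz by blast
    \<comment> \<open>Writing the test function as a transform moves the claim to the frequency
      side, where the hypothesis on g and k lives.\<close>
    then obtain \<psi> where \<psi>: "\<psi> \<in> schwartz_functions" "\<phi> = fourier \<psi>" by (rule fourier_surj)
    have [measurable]: "\<psi> \<in> borel_measurable borel" by (rule schwartz_measurable[OF \<psi>(1)])
    have "dist_deriv \<alpha> (regular_dist f) \<phi> = L2_deriv f \<alpha> (fourier \<psi>)"
      using L2_deriv_test[OF \<phi>] \<psi>(2) by simp
    also have "\<dots> = (\<integral>\<xi>. symbol \<alpha> \<xi> * g \<xi> * \<psi> \<xi> \<partial>lborel)" by (rule L2_deriv_fourier[OF fg \<psi>(1)])
    also have "\<dots> = (\<integral>\<xi>. k \<xi> * \<psi> \<xi> \<partial>lborel)"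
      by (rule integral_cong_AE) (use AE in auto)
    also have "\<dots> = regular_dist h \<phi>"
      using L2_fourierD(3)[OF hk \<psi>(1)] \<phi> \<psi>(2) by (simp add: regular_dist_def)
    finally show ?thesis .
  qed
  then show "dist_deriv \<alpha> (regular_dist f) = regular_dist h"
    by (intro ext) (auto simp: dist_deriv_def regular_dist_def restrict_def)
qed

text \<open>If the derivative is a function h in L^2, its transform is the product with the symbol.
  Conversely, surjectivity of the L^2 transform produces the h whose transform is that
  product.\<close>

lemma dist_deriv_in_L2_iff:
  assumes fg: "L2_fourier f g"
  shows "dist_deriv \<alpha> (regular_dist f) \<in> L2_space \<longleftrightarrow> square_integrable (\<lambda>\<xi>. symbol \<alpha> \<xi> * g \<xi>)"
proof
  have [measurable]: "g \<in> borel_measurable borel"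
    by (rule square_integrable_measurable[OF L2_fourierD(2)[OF fg]])
  assume "dist_deriv \<alpha> (regular_dist f) \<in> L2_space"
  then obtain h where h: "square_integrable h" "dist_deriv \<alpha> (regular_dist f) = regular_dist h"
    by (auto simp: L2_space_def)
  obtain k where k: "L2_fourier h k" using L2_fourier_exists_le[OF h(1)] by blast
  have "l2sq k = l2sq (\<lambda>\<xi>. symbol \<alpha> \<xi> * g \<xi>)"
    by (rule l2sq_cong_AE) (use dist_deriv_eq_regular_iff[OF fg k] h(2) in blast)
  then show "square_integrable (\<lambda>\<xi>. symbol \<alpha> \<xi> * g \<xi>)"
    using L2_fourierD(2)[OF k] by (simp add: square_integrable_l2sq)
next
  assume "square_integrable (\<lambda>\<xi>. symbol \<alpha> \<xi> * g \<xi>)"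
  from L2_fourier_surj[OF this] obtain h where h: "L2_fourier h (\<lambda>\<xi>. symbol \<alpha> \<xi> * g \<xi>)" by blast
  have "dist_deriv \<alpha> (regular_dist f) = regular_dist h"
    by (simp add: dist_deriv_eq_regular_iff[OF fg h])
  then show "dist_deriv \<alpha> (regular_dist f) \<in> L2_space"
    using L2_fourierD(1)[OF h] by (auto simp: L2_space_def)
qed

section \<open>Homogeneous spaces on the Fourier side\<close>

definition homogeneous_norm :: "real \<Rightarrow> (real ^ 'n::finite \<Rightarrow> complex) \<Rightarrow> ennreal" where
  "homogeneous_norm t g = (\<integral>\<^sup>+\<xi>. ennreal (norm \<xi> powr (2 * t) * (cmod (g \<xi>))\<^sup>2) \<partial>lborel)"

lemma homogeneous_norm_cong_AE:
  "AE \<xi> in lborel. f \<xi> = g \<xi> \<Longrightarrow> homogeneous_norm t f = homogeneous_norm t g"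
  unfolding homogeneous_norm_def by (intro nn_integral_cong_AE) auto

text \<open>Here symbol times g need not be square integrable, but it is locally integrable, and
  that suffices to compare it with the density g' supplied by \<open>H_tilde\<close> by testing
  against test functions.\<close>

lemma dist_deriv_in_H_tilde_iff:
  assumes fg: "L2_fourier f g"
  shows "dist_deriv \<alpha> (regular_dist f) \<in> H_tilde s \<longleftrightarrow> homogeneous_norm s (\<lambda>\<xi>. symbol \<alpha> \<xi> * g \<xi>) < \<infinity>"
proof
  assume "dist_deriv \<alpha> (regular_dist f) \<in> H_tilde s"
  then obtain T g' where T: "T \<in> tempered_distributions"
    and eq: "tempered_to_dist T = dist_deriv \<alpha> (regular_dist f)"
    and g': "locally_integrable g'" "tempered_to_dist (fourier_tempered T) = regular_dist g'"
      "homogeneous_norm s g' < \<infinity>"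
    unfolding H_tilde_def homogeneous_norm_def by auto
  have "AE \<xi> in lborel. g' \<xi> = symbol \<alpha> \<xi> * g \<xi>"
  proof (rule locally_integrable_AE_eq[OF g'(1) symbol_mult_locally_integrable[OF fg]])
    fix \<psi> :: "real ^ 'a \<Rightarrow> complex" assume test: "\<psi> \<in> test_functions"
    then have \<psi>: "\<psi> \<in> schwartz_functions" using test_subset_schwartz by blast
    have "(\<integral>x. g' x * \<psi> x \<partial>lborel) = T (fourier \<psi>)"
      using fun_cong[OF g'(2), of \<psi>] test \<psi>
      by (simp add: tempered_to_dist_def fourier_tempered_def regular_dist_def)
    also have "\<dots> = L2_deriv f \<alpha> (fourier \<psi>)"
      by (rule tempered_eq_L2_deriv[OF L2_fourierD(1)[OF fg] T eq schwartz_fourier[OF \<psi>]])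
    finally show "(\<integral>x. g' x * \<psi> x \<partial>lborel) = (\<integral>\<xi>. symbol \<alpha> \<xi> * g \<xi> * \<psi> \<xi> \<partial>lborel)"
      by (simp add: L2_deriv_fourier[OF fg \<psi>])
  qed
  with g'(3) show "homogeneous_norm s (\<lambda>\<xi>. symbol \<alpha> \<xi> * g \<xi>) < \<infinity>"
    by (simp add: homogeneous_norm_cong_AE)
next
  assume fin: "homogeneous_norm s (\<lambda>\<xi>. symbol \<alpha> \<xi> * g \<xi>) < \<infinity>"
  have "tempered_to_dist (fourier_tempered (L2_deriv f \<alpha>)) = regular_dist (\<lambda>\<xi>. symbol \<alpha> \<xi> * g \<xi>)"
  proof
    fix \<psi> :: "real ^ 'a \<Rightarrow> complex"
    show "tempered_to_dist (fourier_tempered (L2_deriv f \<alpha>)) \<psi> = regular_dist (\<lambda>\<xi>. symbol \<alpha> \<xi> * g \<xi>) \<psi>"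
      using test_subset_schwartz L2_deriv_fourier[OF fg, of \<psi> \<alpha>]
      by (cases "\<psi> \<in> test_functions")
        (auto simp: tempered_to_dist_def fourier_tempered_def regular_dist_def)
  qed
  then show "dist_deriv \<alpha> (regular_dist f) \<in> H_tilde s"
    unfolding H_tilde_def tempered_to_dist_L2_deriv[symmetric]
    using fin L2_deriv_tempered[OF L2_fourierD(1)[OF fg]] symbol_mult_locally_integrable[OF fg]
    unfolding homogeneous_norm_def by blast
qed

lemma regular_dist_distribution:
  fixes f :: "real ^ 'n::finite \<Rightarrow> complex"
  assumes f: "locally_integrable f"
  shows "regular_dist f \<in> distributions"
proof -
  have "regular_dist f \<in> linear_functionals test_functions"
    unfolding linear_functionals_def
  proof (intro CollectI conjI ballI allI)
    show "regular_dist f \<in> extensional test_functions" by (simp add: regular_dist_def)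
    fix \<phi> \<psi> :: "real ^ 'n \<Rightarrow> complex" and a b
    assume \<phi>: "\<phi> \<in> test_functions" and \<psi>: "\<psi> \<in> test_functions"
    have "(\<integral>x. f x * (a * \<phi> x + b * \<psi> x) \<partial>lborel) = (\<integral>x. a * (f x * \<phi> x) + b * (f x * \<psi> x) \<partial>lborel)"
      by (simp add: algebra_simps)
    then show "regular_dist f (\<lambda>x. a * \<phi> x + b * \<psi> x) = a * regular_dist f \<phi> + b * regular_dist f \<psi>"
      using locally_integrable_test[OF f \<phi>] locally_integrable_test[OF f \<psi>]
      by (simp add: regular_dist_def \<phi> \<psi> test_lincomb)
  qed
  moreover have "\<exists>C N. \<forall>\<phi>\<in>test_functions. closure {x. \<phi> x \<noteq> 0} \<subseteq> K \<longrightarrow>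
      cmod (regular_dist f \<phi>) \<le> C * (\<Sum>\<alpha> | mi_order \<alpha> \<le> N. SUP x. cmod (mi_partial \<alpha> \<phi> x))"
    if K: "compact K" for K
  \<comment> \<open>The witnesses stay open until the last estimate fixes them: C is the integral of
    |f| over K, and N = 0.\<close>
  proof (intro exI ballI impI)
    fix \<phi> :: "real ^ 'n \<Rightarrow> complex"
    assume \<phi>: "\<phi> \<in> test_functions" and supp: "closure {x. \<phi> x \<noteq> 0} \<subseteq> K"
    define S where "S = (SUP x. cmod (\<phi> x))"
    obtain B where "\<And>x. norm (\<phi> x) \<le> B" using test_bounded[OF \<phi>] by blast
    then have S: "cmod (\<phi> x) \<le> S" for x
      unfolding S_def by (intro cSUP_upper) (auto simp: bdd_above_def)
    have "cmod (regular_dist f \<phi>) = norm (\<integral>x. f x * \<phi> x \<partial>lborel)" by (simp add: regular_dist_def \<phi>)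
    also have "\<dots> \<le> (\<integral>x. norm (indicator K x *\<^sub>R f x) * S \<partial>lborel)"
    proof (rule norm_integral_le[OF locally_integrable_test[OF f \<phi>]])
      show "integrable lborel (\<lambda>x. norm (indicator K x *\<^sub>R f x) * S)"
        using f K by (intro integrable_mult_left integrable_norm) (auto simp: locally_integrable_def set_integrable_def)
      show "norm (f x * \<phi> x) \<le> norm (indicator K x *\<^sub>R f x) * S" for x
        using S[of x] supp test_support[of \<phi> x]
        by (cases "\<phi> x = 0") (auto simp: norm_mult mult_left_mono split: split_indicator)
    qed
    also have "\<dots> = (\<integral>x. norm (indicator K x *\<^sub>R f x) \<partial>lborel) * (\<Sum>\<alpha> | mi_order \<alpha> \<le> 0. SUP x. cmod (mi_partial \<alpha> \<phi> x))"
      by (simp add: mi_order_eq_0_iff S_def)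
    finally show "cmod (regular_dist f \<phi>) \<le>
        (\<integral>x. norm (indicator K x *\<^sub>R f x) \<partial>lborel) * (\<Sum>\<alpha> | mi_order \<alpha> \<le> 0. SUP x. cmod (mi_partial \<alpha> \<phi> x))" .
  qed
  ultimately show ?thesis by (simp add: distributions_def)
qed

section \<open>Comparison of symbols with powers of the norm\<close>

lemma abs_mi_monomial_le: "\<bar>mi_monomial \<alpha> \<xi>\<bar> \<le> norm \<xi> ^ mi_order \<alpha>"
proof -
  have "\<bar>mi_monomial \<alpha> \<xi>\<bar> = (\<Prod>i\<in>UNIV. \<bar>\<xi> $ i\<bar> ^ (\<alpha> $ i))"
    by (simp add: mi_monomial_def abs_prod power_abs)
  also have "\<dots> \<le> (\<Prod>i\<in>UNIV. norm \<xi> ^ (\<alpha> $ i))"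
    by (intro prod_mono conjI power_mono component_le_norm_cart) auto
  also have "\<dots> = norm \<xi> ^ mi_order \<alpha>" by (simp add: mi_order_def power_sum)
  finally show ?thesis .
qed

lemma mi_order_axis: "mi_order (axis i m) = m"
  by (simp add: mi_order_def axis_def)

lemma mi_monomial_axis: "mi_monomial (axis i m) \<xi> = (\<xi> $ i) ^ m"
proof -
  have "mi_monomial (axis i m) \<xi> = (\<Prod>j\<in>UNIV. if j = i then (\<xi> $ i) ^ m else 1)"
    unfolding mi_monomial_def by (intro prod.cong) (auto simp: axis_def)
  then show ?thesis by simp
qed

text \<open>For a coordinate j of largest modulus, |\<xi>|^2 is at most n times the square of
  \<xi>_j; the m-th power of this involves the single pure power monomial in direction j.\<close>

lemma norm_power_le_sum_monomials:
  fixes \<xi> :: "real ^ 'n::finite"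
  shows "norm \<xi> ^ (2 * m) \<le> real CARD('n) ^ m * (\<Sum>i\<in>UNIV. (norm (symbol (axis i m) \<xi>))\<^sup>2)"
proof -
  obtain j where j: "\<And>i. \<bar>\<xi> $ i\<bar> \<le> \<bar>\<xi> $ j\<bar>"
  proof -
    have "Max (range (\<lambda>i. \<bar>\<xi> $ i\<bar>)) \<in> range (\<lambda>i. \<bar>\<xi> $ i\<bar>)" by (intro Max_in) auto
    then obtain j where j: "Max (range (\<lambda>i. \<bar>\<xi> $ i\<bar>)) = \<bar>\<xi> $ j\<bar>" by blast
    have "\<bar>\<xi> $ i\<bar> \<le> \<bar>\<xi> $ j\<bar>" for i unfolding j[symmetric] by (intro Max_ge) auto
    then show thesis by (rule that)
  qed
  have "(norm \<xi>)\<^sup>2 = (\<Sum>i\<in>UNIV. (\<xi> $ i)\<^sup>2)"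
    unfolding power2_norm_eq_inner inner_vec_def by (simp add: power2_eq_square)
  also have "\<dots> \<le> (\<Sum>i\<in>(UNIV :: 'n set). (\<xi> $ j)\<^sup>2)"
    using j by (intro sum_mono) (simp add: abs_le_square_iff)
  finally have "(norm \<xi>)\<^sup>2 \<le> real CARD('n) * (\<xi> $ j)\<^sup>2" by simp
  then have "((norm \<xi>)\<^sup>2) ^ m \<le> (real CARD('n) * (\<xi> $ j)\<^sup>2) ^ m" by (rule power_mono) simp
  also have "\<dots> = real CARD('n) ^ m * (norm (symbol (axis j m) \<xi>))\<^sup>2"
    by (simp add: norm_symbol mi_monomial_axis power_mult_distrib mult.commute flip: power_mult)
  also have "\<dots> \<le> real CARD('n) ^ m * (\<Sum>i\<in>UNIV. (norm (symbol (axis i m) \<xi>))\<^sup>2)"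
    by (intro mult_left_mono member_le_sum) auto
  finally show ?thesis by (simp add: power_mult)
qed

text \<open>Pure powers of the coordinates bound |\<xi>|^(2*m) from above, and conversely every
  symbol of order m is at most |\<xi>|^m in modulus.\<close>

lemma homogeneous_norm_symbol_iff:
  fixes g :: "real ^ 'n::finite \<Rightarrow> complex"
  assumes [measurable]: "g \<in> borel_measurable borel"
  shows "(\<forall>\<alpha>. mi_order \<alpha> = m \<longrightarrow> homogeneous_norm s (\<lambda>\<xi>. symbol \<alpha> \<xi> * g \<xi>) < \<infinity>) \<longleftrightarrow>
    homogeneous_norm (real m + s) g < \<infinity>"
proof -
  \<comment> \<open>At the origin both sides are 0, even for exponent 0, because
    \<open>0 powr x = 0\<close>.\<close>
  have split: "norm \<xi> powr (2 * (real m + s)) = norm \<xi> powr (2 * s) * norm \<xi> ^ (2 * m)" for \<xi> :: "real ^ 'n"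
  proof (cases "\<xi> = 0")
    case False
    then have "norm \<xi> ^ (2 * m) = norm \<xi> powr (2 * real m)" by (simp add: powr_realpow[symmetric])
    then show ?thesis by (simp add: powr_add[symmetric] algebra_simps)
  qed simp
  show ?thesis
  proof
    assume L: "\<forall>\<alpha>. mi_order \<alpha> = m \<longrightarrow> homogeneous_norm s (\<lambda>\<xi>. symbol \<alpha> \<xi> * g \<xi>) < \<infinity>"
    define c where "c = real CARD('n) ^ m"
    have c: "0 \<le> c" by (simp add: c_def)
    have "homogeneous_norm (real m + s) g \<le> (\<integral>\<^sup>+\<xi>. ennreal c *
        (\<Sum>i\<in>UNIV. ennreal (norm \<xi> powr (2 * s) * (cmod (symbol (axis i m) \<xi> * g \<xi>))\<^sup>2)) \<partial>lborel)"
      unfolding homogeneous_norm_def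
    proof (rule nn_integral_mono)
      fix \<xi> :: "real ^ 'n"
      have "norm \<xi> powr (2 * (real m + s)) * (cmod (g \<xi>))\<^sup>2 \<le>
          norm \<xi> powr (2 * s) * (c * (\<Sum>i\<in>UNIV. (norm (symbol (axis i m) \<xi>))\<^sup>2)) * (cmod (g \<xi>))\<^sup>2"
        unfolding split c_def by (intro mult_right_mono mult_left_mono norm_power_le_sum_monomials) auto
      also have "\<dots> = c * (\<Sum>i\<in>UNIV. norm \<xi> powr (2 * s) * (cmod (symbol (axis i m) \<xi> * g \<xi>))\<^sup>2)"
        by (simp add: sum_distrib_left sum_distrib_right norm_mult power_mult_distrib mult_ac)
      finally show "ennreal (norm \<xi> powr (2 * (real m + s)) * (cmod (g \<xi>))\<^sup>2) \<le> ennreal c *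
          (\<Sum>i\<in>UNIV. ennreal (norm \<xi> powr (2 * s) * (cmod (symbol (axis i m) \<xi> * g \<xi>))\<^sup>2))"
        using c by (subst sum_ennreal) (auto simp: ennreal_mult[symmetric] sum_nonneg intro!: ennreal_leI)
    qed
    also have "\<dots> = ennreal c * (\<Sum>i\<in>UNIV. homogeneous_norm s (\<lambda>\<xi>. symbol (axis i m) \<xi> * g \<xi>))"
      unfolding homogeneous_norm_def by (subst nn_integral_cmult, measurable, subst nn_integral_sum) auto
    also have "\<dots> < \<infinity>"
      using L by (auto simp: ennreal_mult_less_top mi_order_axis)
    finally show "homogeneous_norm (real m + s) g < \<infinity>" .
  next
    assume R: "homogeneous_norm (real m + s) g < \<infinity>"
    show "\<forall>\<alpha>. mi_order \<alpha> = m \<longrightarrow> homogeneous_norm s (\<lambda>\<xi>. symbol \<alpha> \<xi> * g \<xi>) < \<infinity>"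
    proof (intro allI impI)
      fix \<alpha> :: "nat ^ 'n" assume \<alpha>: "mi_order \<alpha> = m"
      have "homogeneous_norm s (\<lambda>\<xi>. symbol \<alpha> \<xi> * g \<xi>) \<le> homogeneous_norm (real m + s) g"
        unfolding homogeneous_norm_def
      proof (intro nn_integral_mono ennreal_leI)
        fix \<xi> :: "real ^ 'n"
        have "(norm (symbol \<alpha> \<xi>))\<^sup>2 \<le> (norm \<xi> ^ m)\<^sup>2"
          unfolding norm_symbol \<alpha>[symmetric] by (intro power_mono abs_mi_monomial_le) auto
        then have "(norm (symbol \<alpha> \<xi>))\<^sup>2 \<le> norm \<xi> ^ (2 * m)" by (simp add: power_mult[symmetric] mult.commute)
        then show "norm \<xi> powr (2 * s) * (cmod (symbol \<alpha> \<xi> * g \<xi>))\<^sup>2 \<le> norm \<xi> powr (2 * (real m + s)) * (cmod (g \<xi>))\<^sup>2"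
          unfolding split norm_mult power_mult_distrib mult.assoc
          by (intro mult_left_mono mult_right_mono) auto
      qed
      with R show "homogeneous_norm s (\<lambda>\<xi>. symbol \<alpha> \<xi> * g \<xi>) < \<infinity>" by simp
    qed
  qed
qed

text \<open>Low frequencies are controlled by the L^2 norm and high frequencies by the larger
  exponent. This recovers intermediate derivatives from the highest ones.\<close>

lemma homogeneous_norm_le_add:
  assumes [measurable]: "g \<in> borel_measurable borel" and t: "0 \<le> t" "t \<le> r"
  shows "homogeneous_norm t g \<le> l2sq g + homogeneous_norm r g"
proof -
  have "homogeneous_norm t g \<le> (\<integral>\<^sup>+\<xi>. ennreal ((cmod (g \<xi>))\<^sup>2) +
      ennreal (norm \<xi> powr (2 * r) * (cmod (g \<xi>))\<^sup>2) \<partial>lborel)"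
    unfolding homogeneous_norm_def
  proof (rule nn_integral_mono)
    fix \<xi> :: "real ^ 'a"
    have "norm \<xi> powr (2 * t) \<le> 1 + norm \<xi> powr (2 * r)"
    proof (cases "norm \<xi> \<le> 1")
      case True
      then have "norm \<xi> powr (2 * t) \<le> 1" using t by (intro powr_le1) auto
      then show ?thesis using powr_ge_zero[of "norm \<xi>" "2 * r"] by linarith
    next
      case False
      then have "norm \<xi> powr (2 * t) \<le> norm \<xi> powr (2 * r)" using t by (intro powr_mono) auto
      then show ?thesis by simp
    qed
    then have "norm \<xi> powr (2 * t) * (cmod (g \<xi>))\<^sup>2 \<le> (1 + norm \<xi> powr (2 * r)) * (cmod (g \<xi>))\<^sup>2"
      by (intro mult_right_mono) auto
    then show "ennreal (norm \<xi> powr (2 * t) * (cmod (g \<xi>))\<^sup>2) \<le> ennreal ((cmod (g \<xi>))\<^sup>2) +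
        ennreal (norm \<xi> powr (2 * r) * (cmod (g \<xi>))\<^sup>2)"
      by (simp add: ennreal_plus[symmetric] distrib_right ennreal_leI del: ennreal_plus)
  qed
  also have "\<dots> = l2sq g + homogeneous_norm r g"
    unfolding homogeneous_norm_def l2sq_def by (rule nn_integral_add) measurable
  finally show ?thesis .
qed

lemma homogeneous_norm_0: "homogeneous_norm 0 g = l2sq g"
  unfolding homogeneous_norm_def l2sq_def
proof (rule nn_integral_cong_AE)
  \<comment> \<open>The weight is 1 except at the origin, where \<open>0 powr 0 = 0\<close>.\<close>
  show "AE \<xi> in lborel. ennreal (norm \<xi> powr (2 * 0) * (cmod (g \<xi>))\<^sup>2) = ennreal ((cmod (g \<xi>))\<^sup>2)"
    using AE_lborel_singleton[of 0] by eventually_elim simp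
qed

lemma sobolev_nat_iff:
  assumes fg: "L2_fourier f g"
  shows "regular_dist f \<in> sobolev_nat k \<longleftrightarrow> homogeneous_norm (real k) g < \<infinity>"
proof -
  have [measurable]: "g \<in> borel_measurable borel"
    by (rule square_integrable_measurable[OF L2_fourierD(2)[OF fg]])
  have sq: "square_integrable (\<lambda>\<xi>. symbol \<alpha> \<xi> * g \<xi>) \<longleftrightarrow> homogeneous_norm 0 (\<lambda>\<xi>. symbol \<alpha> \<xi> * g \<xi>) < \<infinity>" for \<alpha>
    by (simp add: square_integrable_l2sq homogeneous_norm_0)
  have "regular_dist f \<in> sobolev_nat k \<longleftrightarrow>
      (\<forall>\<alpha>. mi_order \<alpha> \<le> k \<longrightarrow> homogeneous_norm 0 (\<lambda>\<xi>. symbol \<alpha> \<xi> * g \<xi>) < \<infinity>)"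
  proof -
    have "regular_dist f \<in> L2_space" using L2_fourierD(1)[OF fg] by (simp add: L2_space_def)
    then show ?thesis by (simp add: sobolev_nat_def dist_deriv_in_L2_iff[OF fg] sq)
  qed
  also have "\<dots> \<longleftrightarrow> (\<forall>m\<le>k. homogeneous_norm (real m) g < \<infinity>)"
    using homogeneous_norm_symbol_iff[of g _ 0] by auto
  also have "\<dots> \<longleftrightarrow> homogeneous_norm (real k) g < \<infinity>"
  proof
    assume k: "homogeneous_norm (real k) g < \<infinity>"
    show "\<forall>m\<le>k. homogeneous_norm (real m) g < \<infinity>"
    proof (intro allI impI)
      fix m assume "m \<le> k"
      then have "homogeneous_norm (real m) g \<le> l2sq g + homogeneous_norm (real k) g"
        by (intro homogeneous_norm_le_add) auto
      also have "\<dots> < \<infinity>" using k L2_fourierD(2)[OF fg] by (simp add: square_integrable_l2sq)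
      finally show "homogeneous_norm (real m) g < \<infinity>" .
    qed
  qed auto
  finally show ?thesis .
qed

lemma beppo_levi_iff:
  assumes fg: "L2_fourier f g"
  shows "regular_dist f \<in> beppo_levi m s \<longleftrightarrow> homogeneous_norm (real m + s) g < \<infinity>"
proof -
  have [measurable]: "g \<in> borel_measurable borel"
    by (rule square_integrable_measurable[OF L2_fourierD(2)[OF fg]])
  show ?thesis
    using regular_dist_distribution[OF square_integrable_locally_integrable[OF L2_fourierD(1)[OF fg]]]
    unfolding homogeneous_norm_symbol_iff[of g m s, symmetric, OF \<open>g \<in> borel_measurable borel\<close>]
    by (simp add: beppo_levi_def dist_deriv_in_H_tilde_iff[OF fg])
qed

section \<open>The Gagliardo seminorm on the Fourier side\<close>

definition gagliardo :: "real \<Rightarrow> (real ^ 'n::finite \<Rightarrow> complex) \<Rightarrow> ennreal" where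
  "gagliardo \<sigma> h = (\<integral>\<^sup>+(x, y). ennreal ((cmod (h x - h y))\<^sup>2 / norm (x - y) powr (real CARD('n) + 2 * \<sigma>))
    \<partial>(lborel \<Otimes>\<^sub>M lborel))"

text \<open>The substitution x = z + y separates the singular weight in z from the L^2 distance
  between h and its translate, to which Plancherel applies for each fixed z.\<close>

lemma gagliardo_eq_translates:
  fixes h :: "real ^ 'n::finite \<Rightarrow> complex"
  assumes [measurable]: "h \<in> borel_measurable borel"
  shows "gagliardo \<sigma> h = (\<integral>\<^sup>+z. ennreal (inverse (norm z powr (real CARD('n) + 2 * \<sigma>))) *
    l2sq (\<lambda>x. h (x + z) - h x) \<partial>lborel)"
proof -
  let ?p = "real CARD('n) + 2 * \<sigma>"
  have "gagliardo \<sigma> h = (\<integral>\<^sup>+y. (\<integral>\<^sup>+x. ennreal ((cmod (h x - h y))\<^sup>2 / norm (x - y) powr ?p) \<partial>lborel) \<partial>lborel)"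
    unfolding gagliardo_def by (subst lborel_pair.nn_integral_snd[symmetric]) (simp_all add: split_beta)
  also have "\<dots> = (\<integral>\<^sup>+y. (\<integral>\<^sup>+z. ennreal ((cmod (h (z + y) - h y))\<^sup>2 / norm (z + y - y) powr ?p) \<partial>lborel) \<partial>lborel)"
  proof (rule nn_integral_cong)
    fix y :: "real ^ 'n"
    have [measurable]: "(\<lambda>x. ennreal ((cmod (h x - h y))\<^sup>2 / norm (x - y) powr ?p)) \<in> borel_measurable borel"
      by measurable
    show "(\<integral>\<^sup>+x. ennreal ((cmod (h x - h y))\<^sup>2 / norm (x - y) powr ?p) \<partial>lborel) =
        (\<integral>\<^sup>+z. ennreal ((cmod (h (z + y) - h y))\<^sup>2 / norm (z + y - y) powr ?p) \<partial>lborel)"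
      by (rule nn_integral_translate[symmetric]) measurable
  qed
  also have "\<dots> = (\<integral>\<^sup>+z. (\<integral>\<^sup>+y. ennreal ((cmod (h (z + y) - h y))\<^sup>2 / norm (z + y - y) powr ?p) \<partial>lborel) \<partial>lborel)"
    by (rule lborel_pair.Fubini') measurable
  also have "\<dots> = (\<integral>\<^sup>+z. ennreal (inverse (norm z powr ?p)) * l2sq (\<lambda>x. h (x + z) - h x) \<partial>lborel)"
    unfolding l2sq_def
    by (intro nn_integral_cong, subst nn_integral_cmult[symmetric])
      (simp_all add: ennreal_mult[symmetric] divide_inverse add.commute mult.commute)
  finally show ?thesis .
qed

section \<open>The frequency multiplier and its two-sided bounds\<close>

definition multiplier :: "real \<Rightarrow> real ^ 'n::finite \<Rightarrow> ennreal" where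
  "multiplier \<sigma> \<xi> = (\<integral>\<^sup>+z. ennreal (inverse (norm z powr (real CARD('n) + 2 * \<sigma>)) *
    (norm (plane_wave (- z) \<xi> - 1))\<^sup>2) \<partial>lborel)"

lemma fourier_const_gagliardo:
  fixes h k :: "real ^ 'n::finite \<Rightarrow> complex"
  assumes hk: "L2_fourier h k"
  shows "ennreal (fourier_const TYPE('n)) * gagliardo \<sigma> h =
    (\<integral>\<^sup>+\<xi>. ennreal ((norm (k \<xi>))\<^sup>2) * multiplier \<sigma> \<xi> \<partial>lborel)"
proof -
  let ?p = "real CARD('n) + 2 * \<sigma>"
  have [measurable]: "h \<in> borel_measurable borel" "k \<in> borel_measurable borel"
    by (rule square_integrable_measurable[OF L2_fourierD(1)[OF hk]],
        rule square_integrable_measurable[OF L2_fourierD(2)[OF hk]])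
  have pl: "ennreal (fourier_const TYPE('n)) * l2sq (\<lambda>x. h (x + z) - h x) =
      (\<integral>\<^sup>+\<xi>. ennreal ((norm (plane_wave (- z) \<xi> - 1))\<^sup>2 * (norm (k \<xi>))\<^sup>2) \<partial>lborel)" for z
  proof -
    have "ennreal (fourier_const TYPE('n)) * l2sq (\<lambda>x. h (x + z) - h x) = l2sq (\<lambda>\<xi>. plane_wave (- z) \<xi> * k \<xi> - k \<xi>)"
      by (rule plancherel[OF L2_fourier_diff[OF L2_fourier_translate[OF hk] hk], symmetric])
    also have "\<dots> = (\<integral>\<^sup>+\<xi>. ennreal ((norm (plane_wave (- z) \<xi> - 1))\<^sup>2 * (norm (k \<xi>))\<^sup>2) \<partial>lborel)"
      unfolding l2sq_def
    proof (rule nn_integral_cong)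
      fix \<xi>
      have "plane_wave (- z) \<xi> * k \<xi> - k \<xi> = (plane_wave (- z) \<xi> - 1) * k \<xi>" by (simp add: left_diff_distrib)
      then show "ennreal ((norm (plane_wave (- z) \<xi> * k \<xi> - k \<xi>))\<^sup>2) =
          ennreal ((norm (plane_wave (- z) \<xi> - 1))\<^sup>2 * (norm (k \<xi>))\<^sup>2)"
        by (simp add: norm_mult power_mult_distrib)
    qed
    finally show ?thesis .
  qed
  have [measurable]: "(\<lambda>z. l2sq (\<lambda>x. h (x + z) - h x)) \<in> borel_measurable borel"
    unfolding l2sq_def by measurable
  have "ennreal (fourier_const TYPE('n)) * gagliardo \<sigma> h =
      (\<integral>\<^sup>+z. ennreal (fourier_const TYPE('n)) * (ennreal (inverse (norm z powr ?p)) * l2sq (\<lambda>x. h (x + z) - h x)) \<partial>lborel)"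
    unfolding gagliardo_eq_translates[OF \<open>h \<in> borel_measurable borel\<close>]
    by (rule nn_integral_cmult[symmetric]) measurable
  also have "\<dots> = (\<integral>\<^sup>+z. ennreal (inverse (norm z powr ?p)) *
      (\<integral>\<^sup>+\<xi>. ennreal ((norm (plane_wave (- z) \<xi> - 1))\<^sup>2 * (norm (k \<xi>))\<^sup>2) \<partial>lborel) \<partial>lborel)"
    unfolding pl[symmetric] by (simp only: mult_ac)
  also have "\<dots> = (\<integral>\<^sup>+z. (\<integral>\<^sup>+\<xi>. ennreal ((norm (k \<xi>))\<^sup>2) *
      ennreal (inverse (norm z powr ?p) * (norm (plane_wave (- z) \<xi> - 1))\<^sup>2) \<partial>lborel) \<partial>lborel)"
    by (intro nn_integral_cong, subst nn_integral_cmult[symmetric])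
      (simp_all add: ennreal_mult[symmetric] mult_ac)
  also have "\<dots> = (\<integral>\<^sup>+\<xi>. (\<integral>\<^sup>+z. ennreal ((norm (k \<xi>))\<^sup>2) *
      ennreal (inverse (norm z powr ?p) * (norm (plane_wave (- z) \<xi> - 1))\<^sup>2) \<partial>lborel) \<partial>lborel)"
    by (rule lborel_pair.Fubini') measurable
  also have "\<dots> = (\<integral>\<^sup>+\<xi>. ennreal ((norm (k \<xi>))\<^sup>2) * multiplier \<sigma> \<xi> \<partial>lborel)"
    unfolding multiplier_def by (intro nn_integral_cong nn_integral_cmult) measurable
  finally show ?thesis .
qed

text \<open>Substituting z/|\<xi>| for z yields the Jacobian |\<xi>|^-n against |\<xi>|^(n +
  2*\<sigma>) from the singular weight, and leaves a unit vector in the phase.\<close>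

lemma multiplier_scaling:
  fixes \<xi> :: "real ^ 'n::finite"
  assumes \<xi>: "\<xi> \<noteq> 0"
  shows "multiplier \<sigma> \<xi> = ennreal (norm \<xi> powr (2 * \<sigma>)) * multiplier \<sigma> ((1 / norm \<xi>) *\<^sub>R \<xi>)"
proof -
  let ?p = "real CARD('n) + 2 * \<sigma>"
  define c where "c = 1 / norm \<xi>"
  have c: "0 < c" using \<xi> by (simp add: c_def)
  have fac: "c ^ CARD('n) * inverse (c powr ?p) = norm \<xi> powr (2 * \<sigma>)"
  proof -
    have "c ^ CARD('n) * inverse (c powr ?p) = c powr real CARD('n) * c powr (- ?p)"
      unfolding powr_minus[of c ?p] using c by (simp add: powr_realpow)
    also have "\<dots> = c powr (- (2 * \<sigma>))" by (simp add: powr_add[symmetric])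
    also have "\<dots> = norm \<xi> powr (2 * \<sigma>)"
      using \<xi> by (simp add: c_def powr_minus powr_divide)
    finally show ?thesis .
  qed
  have "multiplier \<sigma> \<xi> = ennreal (\<bar>c\<bar> ^ CARD('n)) * (\<integral>\<^sup>+z. ennreal (inverse (norm (0 + c *\<^sub>R z) powr ?p) *
      (norm (plane_wave (- (0 + c *\<^sub>R z)) \<xi> - 1))\<^sup>2) \<partial>lborel)"
    unfolding multiplier_def by (rule nn_integral_affine_vec) (use c in simp_all)
  also have "\<dots> = (\<integral>\<^sup>+z. ennreal (norm \<xi> powr (2 * \<sigma>)) * ennreal (inverse (norm z powr ?p) *
      (norm (plane_wave (- z) (c *\<^sub>R \<xi>) - 1))\<^sup>2) \<partial>lborel)"
  proof (subst nn_integral_cmult[symmetric], measurable, rule nn_integral_cong)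
    fix z :: "real ^ 'n"
    have "plane_wave (- (c *\<^sub>R z)) \<xi> = plane_wave (- z) (c *\<^sub>R \<xi>)" by (simp add: plane_wave_def)
    moreover have "norm (c *\<^sub>R z) powr ?p = c powr ?p * norm z powr ?p" using c by (simp add: powr_mult)
    ultimately have "c ^ CARD('n) * (inverse (norm (c *\<^sub>R z) powr ?p) * (norm (plane_wave (- (c *\<^sub>R z)) \<xi> - 1))\<^sup>2) =
        (c ^ CARD('n) * inverse (c powr ?p)) * (inverse (norm z powr ?p) * (norm (plane_wave (- z) (c *\<^sub>R \<xi>) - 1))\<^sup>2)"
      by (simp add: mult_ac)
    then have "c ^ CARD('n) * (inverse (norm (c *\<^sub>R z) powr ?p) * (norm (plane_wave (- (c *\<^sub>R z)) \<xi> - 1))\<^sup>2) =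
        norm \<xi> powr (2 * \<sigma>) * (inverse (norm z powr ?p) * (norm (plane_wave (- z) (c *\<^sub>R \<xi>) - 1))\<^sup>2)"
      by (simp only: fac)
    then show "ennreal (\<bar>c\<bar> ^ CARD('n)) * ennreal (inverse (norm (0 + c *\<^sub>R z) powr ?p) *
        (norm (plane_wave (- (0 + c *\<^sub>R z)) \<xi> - 1))\<^sup>2) = ennreal (norm \<xi> powr (2 * \<sigma>)) *
        ennreal (inverse (norm z powr ?p) * (norm (plane_wave (- z) (c *\<^sub>R \<xi>) - 1))\<^sup>2)"
      using c by (simp only: add_0 abs_of_pos ennreal_mult[symmetric] zero_le_power less_imp_le
          powr_ge_zero mult_nonneg_nonneg zero_le_power2 inverse_nonnegative_iff_nonnegative)
  qed
  also have "\<dots> = ennreal (norm \<xi> powr (2 * \<sigma>)) * multiplier \<sigma> (c *\<^sub>R \<xi>)"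
    unfolding multiplier_def by (rule nn_integral_cmult) measurable
  finally show ?thesis by (simp add: c_def)
qed

lemma emeasure_lborel_ball:
  "0 \<le> R \<Longrightarrow> emeasure lborel (ball c R :: (real ^ 'n::finite) set) =
    ennreal (R ^ CARD('n)) * emeasure lborel (ball (0 :: real ^ 'n) 1)"
  using emeasure_lebesgue_ball_conv_unit_ball[of R c] by simp

lemma norm_plane_wave_diff_1:
  "norm (plane_wave (- z) \<xi> - 1) \<le> 2" "norm (plane_wave (- z) \<xi> - 1) \<le> norm z * norm \<xi>"
proof -
  show "norm (plane_wave (- z) \<xi> - 1) \<le> 2"
    using norm_triangle_ineq4[of "plane_wave (- z) \<xi>" 1] by simp
  have "norm (plane_wave (- z) \<xi> - 1) \<le> \<bar>\<xi> \<bullet> z\<bar>"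
    using iexp_approx1[of "\<xi> \<bullet> z" 0] by (simp add: plane_wave_def)
  also have "\<dots> \<le> norm z * norm \<xi>"
    using Cauchy_Schwarz_ineq2[of \<xi> z] by (simp add: mult.commute)
  finally show "norm (plane_wave (- z) \<xi> - 1) \<le> norm z * norm \<xi>" .
qed

lemma dyadic_bracket:
  fixes x :: real
  assumes "1 \<le> x"
  obtains j :: nat where "2 ^ j \<le> x" "x < 2 ^ Suc j"
proof -
  obtain m :: nat where m: "x < 2 ^ m" using real_arch_pow[of 2 x] by auto
  define k where "k = (LEAST m. x < 2 ^ m)"
  have k: "x < 2 ^ k" unfolding k_def by (rule LeastI[of _ m]) (rule m)
  then have "k \<noteq> 0" using assms by (cases "k = 0") auto
  then obtain j where j: "k = Suc j" using not0_implies_Suc by blast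
  then have "2 ^ j \<le> x" unfolding k_def using not_less_Least[of j "\<lambda>m. x < 2 ^ m"] by simp
  then show thesis using k unfolding j by (rule that)
qed

text \<open>On the shell \<open>2\<^sup>j \<le> \<bar>w\<bar> < 2\<^sup>j\<^sup>+\<^sup>1\<close> the integrand is at most \<open>4\<cdot>2\<^sup>-\<^sup>j\<^sup>p\<close>, on the shell
  \<open>2\<^sup>-\<^sup>j\<^sup>-\<^sup>1 < \<bar>w\<bar> \<le> 2\<^sup>-\<^sup>j\<close> at most \<open>4\<^sup>-\<^sup>j\<cdot>2\<^sup>(\<^sup>j\<^sup>+\<^sup>1\<^sup>)\<^sup>p\<close>; here \<open>p = n + 2\<sigma>\<close>.\<close>

lemma multiplier_upper:
  assumes \<sigma>: "0 < \<sigma>" "\<sigma> < 1"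
  shows "\<exists>K<\<infinity>. \<forall>u :: real ^ 'n::finite. norm u = 1 \<longrightarrow> multiplier \<sigma> u \<le> K"
proof -
  let ?n = "CARD('n)"
  define p where "p = real ?n + 2 * \<sigma>"
  have p0: "0 < p" using \<sigma> by (simp add: p_def)
  define V where "V = emeasure lborel (ball (0 :: real ^ 'n) 1)"
  have V: "V < \<infinity>" unfolding V_def by (rule emeasure_lborel_ball_finite)
  define a b :: "nat \<Rightarrow> real" where "a j = ((1/2) ^ j)\<^sup>2 * (2 ^ Suc j) powr p" and "b j = 4 * inverse ((2 ^ j) powr p)" for j
  have ab0: "0 \<le> a j" "0 \<le> b j" for j by (simp_all add: a_def b_def)
  \<comment> \<open>The shells are enlarged to balls, whose volumes scale exactly. The inner radius
    2 * 2^-j leaves room in an open ball for points with |w| = 2^-j.\<close>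
  define q where "q j w = ennreal (a j) * indicator (ball 0 (2 * (1/2) ^ j)) w +
    ennreal (b j) * indicator (ball 0 (2 ^ Suc j)) w" for j and w :: "real ^ 'n"
  define K where "K = (\<integral>\<^sup>+w. (\<Sum>j. q j w) \<partial>lborel)"
  have le: "ennreal (inverse (norm w powr p) * (norm (plane_wave (- w) u - 1))\<^sup>2) \<le> (\<Sum>j. q j w)"
    if u: "norm u = 1" for u w :: "real ^ 'n"
  proof -
    have single: "q j w \<le> (\<Sum>j. q j w)" for j
      using sum_le_suminf[of "\<lambda>j. q j w" "{j}"] by (simp add: summableI)
    consider "w = 0" | "1 \<le> norm w" | "w \<noteq> 0" "norm w < 1" by linarith
    then show ?thesis
    proof cases
      case 1
      then show ?thesis by simp
    next
      case 2
      obtain j where j: "2 ^ j \<le> norm w" "norm w < 2 ^ Suc j" by (rule dyadic_bracket[OF 2])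
      have "inverse (norm w powr p) \<le> inverse ((2 ^ j) powr p)"
        using j(1) p0 by (intro le_imp_inverse_le powr_mono2) auto
      moreover have "(norm (plane_wave (- w) u - 1))\<^sup>2 \<le> 4"
        using power_mono[OF norm_plane_wave_diff_1(1), of w u 2] by simp
      ultimately have "inverse (norm w powr p) * (norm (plane_wave (- w) u - 1))\<^sup>2 \<le> inverse ((2 ^ j) powr p) * 4"
        by (intro mult_mono) auto
      then have "ennreal (inverse (norm w powr p) * (norm (plane_wave (- w) u - 1))\<^sup>2) \<le> ennreal (b j)"
        by (intro ennreal_leI) (simp add: b_def)
      also have "\<dots> \<le> q j w" using j(2) by (simp add: q_def)
      finally show ?thesis using single[of j] by (rule order_trans)
    next
      case 3
      then have w: "0 < norm w" by simp
      have "1 \<le> 1 / norm w" using 3 by simp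
      then obtain j where j: "2 ^ j \<le> 1 / norm w" "1 / norm w < 2 ^ Suc j" by (rule dyadic_bracket)
      have j1: "norm w \<le> (1/2) ^ j" using j(1) w by (simp add: field_simps power_one_over)
      have j2: "inverse (norm w) \<le> 2 ^ Suc j" using j(2) by (simp add: inverse_eq_divide)
      have "inverse (norm w powr p) = inverse (norm w) powr p" by (simp add: powr_divide inverse_eq_divide)
      also have "\<dots> \<le> (2 ^ Suc j) powr p" using j2 p0 w by (intro powr_mono2) auto
      finally have "inverse (norm w powr p) \<le> (2 ^ Suc j) powr p" .
      moreover have "(norm (plane_wave (- w) u - 1))\<^sup>2 \<le> ((1/2) ^ j)\<^sup>2"
        using norm_plane_wave_diff_1(2)[of w u] j1 u by (intro power_mono) auto
      ultimately have "inverse (norm w powr p) * (norm (plane_wave (- w) u - 1))\<^sup>2 \<le> (2 ^ Suc j) powr p * ((1/2) ^ j)\<^sup>2"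
        by (intro mult_mono) auto
      then have "ennreal (inverse (norm w powr p) * (norm (plane_wave (- w) u - 1))\<^sup>2) \<le> ennreal (a j)"
        by (intro ennreal_leI) (simp add: a_def mult.commute)
      also have "\<dots> \<le> q j w"
      proof -
        have "(1/2 :: real) ^ j < 2 * (1/2) ^ j" by simp
        with j1 have "norm w < 2 * (1/2) ^ j" by linarith
        then show ?thesis by (simp add: q_def)
      qed
      finally show ?thesis using single[of j] by (rule order_trans)
    qed
  qed
  have K_upper: "multiplier \<sigma> u \<le> K" if "norm u = 1" for u :: "real ^ 'n"
    unfolding multiplier_def K_def p_def[symmetric] by (intro nn_integral_mono le that)
  \<comment> \<open>Bound times ball volume is geometric in j on either side: the ratio is s =
    2^(2*\<sigma>-2) near the origin, below 1 since \<sigma> < 1, and t = 2^(-2*\<sigma>) at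
    infinity, below 1 since \<sigma> > 0.\<close>
  define A B where "A = 2 powr p * 2 ^ ?n" and "B = 4 * (2 :: real) ^ ?n"
  define s t where "s = (2 :: real) powr (2 * \<sigma> - 2)" and "t = (2 :: real) powr (- (2 * \<sigma>))"
  have st: "0 < s" "s < 1" "0 < t" "t < 1" using \<sigma> by (auto simp: s_def t_def powr_less_one)
  have half: "(1/2 :: real) ^ j = 2 powr (- real j)" for j
    by (simp add: powr_minus powr_realpow power_one_over inverse_eq_divide)
  have two: "(2 :: real) ^ j = 2 powr real j" for j by (simp add: powr_realpow)
  have pp: "((2 :: real) powr x) ^ m = 2 powr (x * real m)" for x m
    by (simp add: powr_realpow[symmetric] powr_powr)
  have A: "a j * (2 * (1/2) ^ j) ^ ?n = A * s ^ j" for j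
  proof -
    have 1: "((1/2 :: real) ^ j)\<^sup>2 = 2 powr (- (2 * real j))"
      unfolding half power2_eq_square by (simp add: powr_add[symmetric])
    have 2: "((2 :: real) ^ Suc j) powr p = 2 powr (real (Suc j) * p)"
      unfolding two powr_powr ..
    have "2 * (1/2 :: real) ^ j = 2 powr 1 * 2 powr (- real j)" unfolding half by simp
    then have 3: "(2 * (1/2 :: real) ^ j) ^ ?n = 2 powr ((1 + - real j) * real ?n)"
      by (simp only: powr_add[symmetric] pp)
    have 4: "A * s ^ j = 2 powr p * 2 powr real ?n * 2 powr ((2 * \<sigma> - 2) * real j)"
      unfolding A_def s_def pp two ..
    have "- (2 * real j) + real (Suc j) * p + (1 + - real j) * real ?n = p + real ?n + (2 * \<sigma> - 2) * real j"
      by (simp add: p_def algebra_simps)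
    then show ?thesis
      by (simp only: a_def 1 2 3 4 powr_add[symmetric])
  qed
  have B: "b j * (2 ^ Suc j) ^ ?n = B * t ^ j" for j
  proof -
    have 1: "inverse (((2 :: real) ^ j) powr p) = 2 powr (- (real j * p))"
      unfolding two powr_powr powr_minus ..
    have 2: "((2 :: real) ^ Suc j) ^ ?n = 2 powr (real (Suc j) * real ?n)"
      unfolding two pp ..
    have 3: "B * t ^ j = 4 * (2 powr real ?n * 2 powr (- (2 * \<sigma>) * real j))"
      unfolding B_def t_def pp two by simp
    have "- (real j * p) + real (Suc j) * real ?n = real ?n + - (2 * \<sigma>) * real j"
      by (simp add: p_def algebra_simps)
    then show ?thesis
      by (simp only: b_def 1 2 3 powr_add[symmetric] mult.assoc)
  qed
  have AB0: "0 \<le> A" "0 \<le> B" by (simp_all add: A_def B_def)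
  have [measurable]: "ball (0 :: real ^ 'n) R \<in> sets borel" for R by (rule borel_open[OF open_ball])
  have q_int: "(\<integral>\<^sup>+w. q j w \<partial>lborel) = V * ennreal (A * s ^ j + B * t ^ j)" for j
  proof -
    have "(\<integral>\<^sup>+w. q j w \<partial>lborel) = ennreal (a j) * emeasure lborel (ball (0 :: real ^ 'n) (2 * (1/2) ^ j)) +
        ennreal (b j) * emeasure lborel (ball (0 :: real ^ 'n) (2 ^ Suc j))"
      unfolding q_def by (simp add: nn_integral_add nn_integral_cmult)
    also have "\<dots> = ennreal (a j) * (ennreal ((2 * (1/2) ^ j) ^ ?n) * V) + ennreal (b j) * (ennreal ((2 ^ Suc j) ^ ?n) * V)"
      unfolding V_def by (subst (1 2) emeasure_lborel_ball) (simp_all del: power_Suc)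
    also have "\<dots> = ennreal (a j * (2 * (1/2) ^ j) ^ ?n) * V + ennreal (b j * (2 ^ Suc j) ^ ?n) * V"
      using ab0[of j] by (simp add: ennreal_mult mult.assoc del: power_Suc)
    also have "\<dots> = V * ennreal (A * s ^ j + B * t ^ j)"
      unfolding A B using AB0 st by (simp add: distrib_left mult.commute)
    finally show ?thesis .
  qed
  have [measurable]: "q j \<in> borel_measurable borel" for j unfolding q_def by measurable
  have "K = (\<Sum>j. V * ennreal (A * s ^ j + B * t ^ j))"
    unfolding K_def q_int[symmetric] by (rule nn_integral_suminf) measurable
  also have "\<dots> = V * ennreal (\<Sum>j. A * s ^ j + B * t ^ j)"
    using AB0 st by (subst ennreal_suminf_cmult, subst suminf_ennreal2)
      (auto intro!: summable_add summable_mult summable_geometric)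
  also have "\<dots> < \<infinity>" using V by (simp add: ennreal_mult_less_top)
  finally show ?thesis using K_upper by blast
qed

text \<open>Only the ball of radius 1/4 about (3/4) u is counted. There |w| \<le> 1, so the singular
  weight is at least 1, and theta = w . u lies in (1/2, 1), so |exp(i*theta) - 1| \<ge> theta -
  theta^2/2 \<ge> theta/2 > 1/4; its square gives the 1/16. The volume of the ball does not depend
  on u.\<close>

lemma multiplier_lower:
  assumes \<sigma>: "0 < \<sigma>"
  shows "\<exists>c>0. \<forall>u :: real ^ 'n::finite. norm u = 1 \<longrightarrow> c \<le> multiplier \<sigma> u"
proof -
  let ?p = "real CARD('n) + 2 * \<sigma>"
  define c where "c = ennreal (1/16) * (ennreal ((1/4) ^ CARD('n)) * emeasure lborel (ball (0 :: real ^ 'n) 1))"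
  have "0 < measure lborel (ball (0 :: real ^ 'n) 1)" by (rule content_ball_pos) simp
  then have "emeasure lborel (ball (0 :: real ^ 'n) 1) \<noteq> 0"
    by (auto simp: measure_def)
  then have "0 < c" by (simp add: c_def zero_less_iff_neq_zero)
  moreover have "c \<le> multiplier \<sigma> u" if u: "norm u = 1" for u :: "real ^ 'n"
  proof -
    have "emeasure lborel (ball ((3/4) *\<^sub>R u) (1/4)) =
        ennreal ((1/4) ^ CARD('n)) * emeasure lborel (ball (0 :: real ^ 'n) 1)"
      by (rule emeasure_lborel_ball) simp
    then have "c = ennreal (1/16) * emeasure lborel (ball ((3/4) *\<^sub>R u) (1/4))"
      by (simp only: c_def)
    also have "\<dots> = (\<integral>\<^sup>+w. ennreal (1/16) * indicator (ball ((3/4) *\<^sub>R u) (1/4)) w \<partial>lborel)"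
      by (rule nn_integral_cmult_indicator[symmetric]) simp
    also have "\<dots> \<le> multiplier \<sigma> u"
      unfolding multiplier_def
    proof (rule nn_integral_mono)
      fix w :: "real ^ 'n"
      show "ennreal (1/16) * indicator (ball ((3/4) *\<^sub>R u) (1/4)) w \<le>
          ennreal (inverse (norm w powr ?p) * (norm (plane_wave (- w) u - 1))\<^sup>2)"
      proof (cases "w \<in> ball ((3/4) *\<^sub>R u) (1/4)")
        case True
        then have d: "norm (w - (3/4) *\<^sub>R u) < 1/4" by (simp add: dist_norm norm_minus_commute)
        have "norm w \<le> norm (w - (3/4) *\<^sub>R u) + norm ((3/4) *\<^sub>R u)" using norm_triangle_sub[of w "(3/4) *\<^sub>R u"] by simp
        with d u have w1: "norm w \<le> 1" by simp
        have "(w - (3/4) *\<^sub>R u) \<bullet> u = w \<bullet> u - 3/4"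
          using u by (simp add: inner_diff_left power2_norm_eq_inner[symmetric])
        moreover have "\<bar>(w - (3/4) *\<^sub>R u) \<bullet> u\<bar> \<le> norm (w - (3/4) *\<^sub>R u) * norm u" by (rule Cauchy_Schwarz_ineq2)
        ultimately have \<theta>: "1/2 < w \<bullet> u" "w \<bullet> u < 1" using d u by auto
        then have "w \<noteq> 0" by auto
        define \<theta> where "\<theta> = w \<bullet> u"
        have "plane_wave (- w) u = iexp \<theta>" by (simp add: plane_wave_def \<theta>_def inner_commute)
        moreover have "norm (iexp \<theta> - (1 + \<i> * \<theta>)) \<le> \<theta>\<^sup>2 / 2"
          using iexp_approx1[of \<theta> 1] by (simp add: power2_eq_square)
        moreover have "norm (\<i> * complex_of_real \<theta>) \<le> norm (iexp \<theta> - 1) + norm (iexp \<theta> - (1 + \<i> * \<theta>))"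
          using norm_triangle_ineq4[of "iexp \<theta> - 1" "iexp \<theta> - (1 + \<i> * \<theta>)"] by simp
        ultimately have "\<theta> - \<theta>\<^sup>2 / 2 \<le> norm (plane_wave (- w) u - 1)"
          using \<theta> by (simp add: norm_mult \<theta>_def)
        moreover have "\<theta>\<^sup>2 \<le> \<theta>" using \<theta> by (simp add: \<theta>_def power2_eq_square mult_le_cancel_left1)
        ultimately have "1/4 \<le> norm (plane_wave (- w) u - 1)" using \<theta> unfolding \<theta>_def by linarith
        then have "(1/4)\<^sup>2 \<le> (norm (plane_wave (- w) u - 1))\<^sup>2" by (intro power_mono) auto
        moreover have "1 \<le> inverse (norm w powr ?p)"
        proof -
          have "norm w powr ?p \<le> 1" using w1 \<sigma> by (intro powr_le1) auto
          moreover have "0 < norm w powr ?p" using \<open>w \<noteq> 0\<close> by simp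
          ultimately show ?thesis by (simp add: one_le_inverse)
        qed
        ultimately have "1 * (1/4)\<^sup>2 \<le> inverse (norm w powr ?p) * (norm (plane_wave (- w) u - 1))\<^sup>2"
          by (intro mult_mono) auto
        then have "ennreal (1/16) \<le> ennreal (inverse (norm w powr ?p) * (norm (plane_wave (- w) u - 1))\<^sup>2)"
          by (intro ennreal_leI) (simp add: power2_eq_square)
        with True show ?thesis by simp
      qed simp
    qed
    finally show ?thesis .
  qed
  ultimately show ?thesis by blast
qed

text \<open>Scaling extends the bounds on unit vectors to all frequencies except the origin, a null
  set, so seminorm and weighted integral dominate each other up to positive finite factors.\<close>

lemma gagliardo_finite_iff:
  fixes h k :: "real ^ 'n::finite \<Rightarrow> complex"
  assumes hk: "L2_fourier h k" and \<sigma>: "0 < \<sigma>" "\<sigma> < 1"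
  shows "gagliardo \<sigma> h < \<infinity> \<longleftrightarrow> homogeneous_norm \<sigma> k < \<infinity>"
proof -
  let ?\<kappa> = "ennreal (fourier_const TYPE('n))"
  have \<kappa>: "?\<kappa> \<noteq> 0" "?\<kappa> < \<infinity>" using fourier_const_pos[where 'n = 'n] by auto
  have [measurable]: "k \<in> borel_measurable borel"
    by (rule square_integrable_measurable[OF L2_fourierD(2)[OF hk]])
  obtain K where K: "K < \<infinity>" "\<And>u :: real ^ 'n. norm u = 1 \<Longrightarrow> multiplier \<sigma> u \<le> K"
    using multiplier_upper[OF \<sigma>, where 'n = 'n] by blast
  obtain c where c: "0 < c" "\<And>u :: real ^ 'n. norm u = 1 \<Longrightarrow> c \<le> multiplier \<sigma> u"
    using multiplier_lower[OF \<sigma>(1), where 'n = 'n] by blast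
  have unit: "norm ((1 / norm \<xi>) *\<^sub>R \<xi>) = 1" if "\<xi> \<noteq> 0" for \<xi> :: "real ^ 'n" using that by simp
  have split: "ennreal (norm \<xi> powr (2 * \<sigma>) * (cmod (k \<xi>))\<^sup>2) = ennreal ((norm (k \<xi>))\<^sup>2) * ennreal (norm \<xi> powr (2 * \<sigma>))" for \<xi>
    by (simp add: ennreal_mult mult.commute)
  have "?\<kappa> * gagliardo \<sigma> h \<le> (\<integral>\<^sup>+\<xi>. K * ennreal (norm \<xi> powr (2 * \<sigma>) * (cmod (k \<xi>))\<^sup>2) \<partial>lborel)"
    unfolding fourier_const_gagliardo[OF hk]
  proof (rule nn_integral_mono_AE)
    show "AE \<xi> in lborel. ennreal ((norm (k \<xi>))\<^sup>2) * multiplier \<sigma> \<xi> \<le> K * ennreal (norm \<xi> powr (2 * \<sigma>) * (cmod (k \<xi>))\<^sup>2)"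
      using AE_lborel_singleton[of 0]
    proof eventually_elim
      case (elim \<xi>)
      have "ennreal ((norm (k \<xi>))\<^sup>2) * multiplier \<sigma> \<xi> \<le> ennreal ((norm (k \<xi>))\<^sup>2) * (ennreal (norm \<xi> powr (2 * \<sigma>)) * K)"
        unfolding multiplier_scaling[OF elim] by (intro mult_left_mono K unit elim) auto
      then show ?case unfolding split by (simp only: mult_ac)
    qed
  qed
  also have "\<dots> = K * homogeneous_norm \<sigma> k"
    unfolding homogeneous_norm_def by (rule nn_integral_cmult) measurable
  finally have upper: "?\<kappa> * gagliardo \<sigma> h \<le> K * homogeneous_norm \<sigma> k" .
  have "c * homogeneous_norm \<sigma> k = (\<integral>\<^sup>+\<xi>. c * ennreal (norm \<xi> powr (2 * \<sigma>) * (cmod (k \<xi>))\<^sup>2) \<partial>lborel)"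
    unfolding homogeneous_norm_def by (rule nn_integral_cmult[symmetric]) measurable
  also have "\<dots> \<le> ?\<kappa> * gagliardo \<sigma> h"
    unfolding fourier_const_gagliardo[OF hk]
  proof (rule nn_integral_mono_AE)
    show "AE \<xi> in lborel. c * ennreal (norm \<xi> powr (2 * \<sigma>) * (cmod (k \<xi>))\<^sup>2) \<le> ennreal ((norm (k \<xi>))\<^sup>2) * multiplier \<sigma> \<xi>"
      using AE_lborel_singleton[of 0]
    proof eventually_elim
      case (elim \<xi>)
      have "ennreal ((norm (k \<xi>))\<^sup>2) * (ennreal (norm \<xi> powr (2 * \<sigma>)) * c) \<le> ennreal ((norm (k \<xi>))\<^sup>2) * multiplier \<sigma> \<xi>"
        unfolding multiplier_scaling[OF elim] by (intro mult_left_mono c unit elim) auto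
      then show ?case unfolding split by (simp only: mult_ac)
    qed
  qed
  finally have lower: "c * homogeneous_norm \<sigma> k \<le> ?\<kappa> * gagliardo \<sigma> h" .
  show ?thesis
  proof
    assume "gagliardo \<sigma> h < \<infinity>"
    then have "?\<kappa> * gagliardo \<sigma> h < \<infinity>" using \<kappa>(2) by (simp add: ennreal_mult_less_top)
    with lower have "c * homogeneous_norm \<sigma> k < \<infinity>" by (rule order.strict_trans1)
    then show "homogeneous_norm \<sigma> k < \<infinity>" using c(1) by (auto simp: ennreal_mult_less_top)
  next
    assume "homogeneous_norm \<sigma> k < \<infinity>"
    then have "K * homogeneous_norm \<sigma> k < \<infinity>" using K(1) by (simp add: ennreal_mult_less_top)
    with upper have "?\<kappa> * gagliardo \<sigma> h < \<infinity>" by (rule order.strict_trans1)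
    then show "gagliardo \<sigma> h < \<infinity>" using \<kappa>(1) by (auto simp: ennreal_mult_less_top)
  qed
qed

section \<open>Fourier characterisation of the Sobolev spaces\<close>

text \<open>The representatives of the derivatives are existentially quantified in the definition,
  but finiteness of the seminorm depends only on their transforms, which are fixed up to null sets;
  hence any choice serves.\<close>

lemma sobolev_frac_iff:
  fixes f g :: "real ^ 'n::finite \<Rightarrow> complex"
  assumes fg: "L2_fourier f g" and r: "0 \<le> r" "r \<notin> \<nat>"
  shows "regular_dist f \<in> sobolev_frac r \<longleftrightarrow> homogeneous_norm r g < \<infinity>"
proof -
  define k where "k = nat \<lfloor>r\<rfloor>"
  define \<sigma> where "\<sigma> = r - of_int \<lfloor>r\<rfloor>"
  have k: "real k = of_int \<lfloor>r\<rfloor>" using r(1) by (simp add: k_def)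
  have rk: "r = real k + \<sigma>" by (simp add: \<sigma>_def k)
  have "\<sigma> \<noteq> 0" using r(2) rk of_nat_in_Nats[of k] by auto
  moreover have "0 \<le> \<sigma>" "\<sigma> < 1" unfolding \<sigma>_def by linarith+
  ultimately have \<sigma>: "0 < \<sigma>" "\<sigma> < 1" by auto
  have gm: "g \<in> borel_measurable borel" by (rule square_integrable_measurable[OF L2_fourierD(2)[OF fg]])
  have gag: "gagliardo \<sigma> h < \<infinity> \<longleftrightarrow> homogeneous_norm \<sigma> (\<lambda>\<xi>. symbol \<alpha> \<xi> * g \<xi>) < \<infinity>"
    if h: "square_integrable h" "dist_deriv \<alpha> (regular_dist f) = regular_dist h" for \<alpha> h
  proof -
    obtain l where l: "L2_fourier h l" using L2_fourier_exists_le[OF h(1)] by blast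
    have "AE \<xi> in lborel. l \<xi> = symbol \<alpha> \<xi> * g \<xi>" using dist_deriv_eq_regular_iff[OF fg l] h(2) by blast
    then show ?thesis
      using gagliardo_finite_iff[OF l \<sigma>] homogeneous_norm_cong_AE by metis
  qed
  have frac: "regular_dist f \<in> sobolev_frac r \<longleftrightarrow> regular_dist f \<in> sobolev_nat k \<and>
      (\<exists>G. (\<forall>\<alpha>. mi_order \<alpha> = k \<longrightarrow> square_integrable (G \<alpha>) \<and> dist_deriv \<alpha> (regular_dist f) = regular_dist (G \<alpha>)) \<and>
        (\<Sum>\<alpha> | mi_order \<alpha> = k. gagliardo \<sigma> (G \<alpha>)) < \<infinity>)"
    by (simp add: sobolev_frac_def k_def \<sigma>_def gagliardo_def)
  have sum_fin: "(\<Sum>\<alpha> | mi_order \<alpha> = k. gagliardo \<sigma> (G \<alpha>)) < \<infinity> \<longleftrightarrow>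
      (\<forall>\<alpha>. mi_order \<alpha> = k \<longrightarrow> gagliardo \<sigma> (G \<alpha>) < \<infinity>)" for G :: "nat ^ 'n \<Rightarrow> real ^ 'n \<Rightarrow> complex"
    using finite_mi_order_eq[where 'n = 'n and k = k] by simp
  show ?thesis
  proof
    assume "regular_dist f \<in> sobolev_frac r"
    then obtain G where G: "\<And>\<alpha>. mi_order \<alpha> = k \<Longrightarrow> square_integrable (G \<alpha>)"
        "\<And>\<alpha>. mi_order \<alpha> = k \<Longrightarrow> dist_deriv \<alpha> (regular_dist f) = regular_dist (G \<alpha>)"
        "\<And>\<alpha>. mi_order \<alpha> = k \<Longrightarrow> gagliardo \<sigma> (G \<alpha>) < \<infinity>"
      unfolding frac sum_fin by blast
    then have "\<forall>\<alpha>. mi_order \<alpha> = k \<longrightarrow> homogeneous_norm \<sigma> (\<lambda>\<xi>. symbol \<alpha> \<xi> * g \<xi>) < \<infinity>"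
      using gag by blast
    then show "homogeneous_norm r g < \<infinity>"
      unfolding homogeneous_norm_symbol_iff[OF gm] rk .
  next
    assume fin: "homogeneous_norm r g < \<infinity>"
    have "homogeneous_norm (real k) g \<le> l2sq g + homogeneous_norm r g"
      by (rule homogeneous_norm_le_add[OF gm]) (use \<sigma> rk in auto)
    also have "\<dots> < \<infinity>" using fin L2_fourierD(2)[OF fg] by (simp add: square_integrable_l2sq)
    finally have nat: "regular_dist f \<in> sobolev_nat k" by (simp add: sobolev_nat_iff[OF fg])
    then have "\<forall>\<alpha>. \<exists>h. mi_order \<alpha> = k \<longrightarrow> square_integrable h \<and> dist_deriv \<alpha> (regular_dist f) = regular_dist h"
      by (auto simp: sobolev_nat_def L2_space_def)
    then obtain G where G: "\<And>\<alpha>. mi_order \<alpha> = k \<Longrightarrow> square_integrable (G \<alpha>) \<and> dist_deriv \<alpha> (regular_dist f) = regular_dist (G \<alpha>)"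
      by metis
    have "\<forall>\<alpha>. mi_order \<alpha> = k \<longrightarrow> homogeneous_norm \<sigma> (\<lambda>\<xi>. symbol \<alpha> \<xi> * g \<xi>) < \<infinity>"
      unfolding homogeneous_norm_symbol_iff[OF gm] using fin rk by simp
    then have "\<forall>\<alpha>. mi_order \<alpha> = k \<longrightarrow> gagliardo \<sigma> (G \<alpha>) < \<infinity>"
      using gag G by blast
    then show "regular_dist f \<in> sobolev_frac r"
      unfolding frac sum_fin using nat G by blast
  qed
qed

lemma sobolev_iff:
  assumes fg: "L2_fourier f g" and r: "0 \<le> r"
  shows "regular_dist f \<in> sobolev r \<longleftrightarrow> homogeneous_norm r g < \<infinity>"
proof (cases "r \<in> \<nat>")
  case True
  then obtain k where "r = real k" by (auto simp: Nats_def)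
  with True show ?thesis by (simp add: sobolev_def sobolev_nat_iff[OF fg])
next
  case False
  then show ?thesis by (simp add: sobolev_def sobolev_frac_iff[OF fg r])
qed

lemma sobolev_subset_L2: "sobolev r \<subseteq> L2_space"
  by (auto simp: sobolev_def sobolev_frac_def sobolev_nat_def)

lemma sobolev_eq_beppo_levi:
  assumes "0 \<le> s"
  shows "(sobolev (real m + s) :: 'n::finite functional set) = L2_space \<inter> beppo_levi m s"
proof -
  have "v \<in> sobolev (real m + s) \<longleftrightarrow> v \<in> beppo_levi m s" if v: "v \<in> L2_space" for v :: "'n functional"
  proof -
    obtain f where f: "square_integrable f" "v = regular_dist f" using v by (auto simp: L2_space_def)
    obtain g where g: "L2_fourier f g" using L2_fourier_exists_le[OF f(1)] by blast
    show ?thesis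
      unfolding f(2) sobolev_iff[OF g add_nonneg_nonneg[OF of_nat_0_le_iff assms]] beppo_levi_iff[OF g] ..
  qed
  then show ?thesis using sobolev_subset_L2 by blast
qed

text \<open>The only multi-index of order 0 is 0, and the corresponding derivative leaves regular
  distributions unchanged.\<close>

lemma L2_beppo_levi_0: "L2_space \<inter> beppo_levi 0 s = L2_space \<inter> H_tilde s"
proof -
  have "v \<in> beppo_levi 0 s \<longleftrightarrow> v \<in> H_tilde s" if v: "v \<in> L2_space" for v :: "'n::finite functional"
  proof -
    obtain f where f: "square_integrable f" "v = regular_dist f" using v by (auto simp: L2_space_def)
    have "dist_deriv 0 v = v" by (auto simp: f(2) dist_deriv_def regular_dist_def)
    then show ?thesis
      using regular_dist_distribution[OF square_integrable_locally_integrable[OF f(1)]]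
      by (simp add: beppo_levi_def mi_order_eq_0_iff f(2))
  qed
  then show ?thesis by blast
qed

theorem theorem4p7:
  fixes r :: real
  assumes "0 \<le> r"
  shows "(sobolev r :: 'n::finite functional set) = L2_space \<inter> H_tilde r \<and>
    (\<forall>(m::nat) (s::real). 0 \<le> s \<longrightarrow> r = real m + s \<longrightarrow>
       (sobolev r :: 'n functional set) = L2_space \<inter> beppo_levi m s)"
proof (intro conjI allI impI)
  show "(sobolev r :: 'n functional set) = L2_space \<inter> H_tilde r"
    \<comment> \<open>The first claim is the second one for m = 0 and s = r.\<close>
    using sobolev_eq_beppo_levi[OF assms, of 0, where 'n = 'n] by (simp add: L2_beppo_levi_0)
  show "(sobolev r :: 'n functional set) = L2_space \<inter> beppo_levi m s"
    if "0 \<le> s" "r = real m + s" for m s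
    unfolding that(2) by (rule sobolev_eq_beppo_levi[OF that(1)])
qed

end
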